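(* Let $m\ge2$ be an integer, $p\in\mathbb{N}\cup\{0\}$, let $a_0,\dots,a_m$ be real constants with $a_m\ne0$, and consider $$a_0x(t)+a_1\,{}_0^{C}\mathrm{D}_t^{\alpha_1}x(t)+a_2\,{}_0^{C}\mathrm{D}_t^{\alpha_2}x(t)+\dots+a_m\,{}_0^{C}\mathrm{D}_t^{\alpha_m}x(t)=0,\qquad\text{(E)}$$ where $p<\alpha_1<\alpha_2<\dots<\alpha_m\le p+1$, with initial conditions $x^{(i)}(0)=C_i$, $i=0,1,\dots,p$. Consider the system $$\begin{aligned} {}_0^{C}\mathrm{D}_t^{\alpha_1}x(t)&=y_1(t),\\ {}_0^{C}\mathrm{D}_t^{\alpha_{j+1}-\alpha_j}y_j(t)&=y_{j+1}(t),\qquad j=1,2,\dots,m-2,\\ {}_0^{C}\mathrm{D}_t^{\alpha_m-\alpha_{m-1}}y_{m-1}(t)&=\frac{-1}{a_m}\left[a_0x(t)+a_1y_1(t)+a_2y_2(t)+\dots+a_{m-1}y_{m-1}(t)\right],\end{aligned}\qquad\text{(S)}$$ with initial conditions $x^{(i)}(0)=C_i$, $i=0,1,\dots,p$, and $y_j(0)=0$, $j=1,2,\dots,m-1$. Then the equation (E) is equivalent to the system (S).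
   Context: For $n-1<\alpha<n$, $n\in\mathbb{N}$, the Caputo fractional derivative with lower limit $0$ is $${}_0^{C}\mathrm{D}_t^{\alpha}f(t)=\frac{1}{\Gamma(n-\alpha)}\int_0^t(t-\tau)^{n-\alpha-1}f^{(n)}(\tau)\,d\tau,\qquad t>0,$$ and ${}_0^{C}\mathrm{D}_t^{n}f=f^{(n)}$; it is applied to functions $f$ on $[0,\infty)$ with $f^{(n-1)}$ absolutely continuous on each $[0,T]$. "Equivalent" means that the solution $x$ of (E) with its stated initial conditions coincides with the component $x$ of the solution of (S) with its stated initial conditions, for all initial data $C_0,\dots,C_p$ (equivalently, the Laplace transforms of the two functions $x$ coincide). *)

theory Defs
  imports "HOL-Analysis.Analysis"
begin

text \<open>Functions on $[0,\infty)$ are represented as functions on the reals of which only the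
  restriction to \<open>{0..}\<close> matters; accordingly all derivatives are taken within \<open>{0..}\<close>
  (one-sided at \<open>0\<close>, ordinary at every \<open>t > 0\<close>).\<close>

primrec nth_deriv :: "nat \<Rightarrow> (real \<Rightarrow> real) \<Rightarrow> real \<Rightarrow> real" where
  "nth_deriv 0 f = f"
| "nth_deriv (Suc n) f = (\<lambda>t. vector_derivative (nth_deriv n f) (at t within {0..}))"

definition abs_continuous_on :: "real \<Rightarrow> real \<Rightarrow> (real \<Rightarrow> real) \<Rightarrow> bool" where
  "abs_continuous_on a b f \<longleftrightarrow>
     (\<forall>\<epsilon>>0. \<exists>\<delta>>0. \<forall>(N::nat) (u::nat \<Rightarrow> real) (v::nat \<Rightarrow> real).
        (\<forall>i<N. a \<le> u i \<and> u i \<le> v i \<and> v i \<le> b) \<and>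
        (\<forall>i<N. \<forall>j<N. i \<noteq> j \<longrightarrow> {u i<..<v i} \<inter> {u j<..<v j} = {}) \<and>
        (\<Sum>i<N. v i - u i) < \<delta>
        \<longrightarrow> (\<Sum>i<N. \<bar>f (v i) - f (u i)\<bar>) < \<epsilon>)"

text \<open>For \<open>\<alpha> > 0\<close> the integer \<open>n = \<lceil>\<alpha>\<rceil>\<close> is the one with \<open>n - 1 < \<alpha> \<le> n\<close>. The domain of
  the derivative of order \<open>\<alpha>\<close> consists of the functions whose derivative of order \<open>n - 1\<close>
  exists and is absolutely continuous on every \<open>{0..T}\<close>; the derivative of order \<open>n\<close> then
  exists almost everywhere.\<close>

definition caputo_domain :: "real \<Rightarrow> (real \<Rightarrow> real) \<Rightarrow> bool" where
  "caputo_domain \<alpha> f \<longleftrightarrow>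
     (let n = nat \<lceil>\<alpha>\<rceil> in
        (\<forall>i<n - 1. \<forall>t\<ge>0. nth_deriv i f differentiable (at t within {0..})) \<and>
        (\<forall>T>0. abs_continuous_on 0 T (nth_deriv (n - 1) f)))"

definition caputo_deriv :: "real \<Rightarrow> (real \<Rightarrow> real) \<Rightarrow> real \<Rightarrow> real" where
  "caputo_deriv \<alpha> f t =
     (let n = nat \<lceil>\<alpha>\<rceil> in
        if \<alpha> = real n then nth_deriv n f t
        else 1 / Gamma (real n - \<alpha>) *
             (LINT \<tau>:{0..t}|lebesgue. (t - \<tau>) powr (real n - \<alpha> - 1) * nth_deriv n f \<tau>))"

text \<open>\<^const>\<open>vector_derivative\<close> and the Lebesgue integral are total, so that the value
  \<open>caputo_deriv \<alpha> f t\<close> is meaningful only if the derivative, respectively the integral,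
  exists.\<close>

definition caputo_exists :: "real \<Rightarrow> (real \<Rightarrow> real) \<Rightarrow> real \<Rightarrow> bool" where
  "caputo_exists \<alpha> f t \<longleftrightarrow>
     (let n = nat \<lceil>\<alpha>\<rceil> in
        if \<alpha> = real n then nth_deriv (n - 1) f differentiable (at t within {0..})
        else set_integrable lebesgue {0..t}
               (\<lambda>\<tau>. (t - \<tau>) powr (real n - \<alpha> - 1) * nth_deriv n f \<tau>))"

definition caputo_eq :: "real \<Rightarrow> (real \<Rightarrow> real) \<Rightarrow> (real \<Rightarrow> real) \<Rightarrow> bool" where
  "caputo_eq \<alpha> f g \<longleftrightarrow>
     caputo_domain \<alpha> f \<and> (\<forall>t>0. caputo_exists \<alpha> f t \<and> caputo_deriv \<alpha> f t = g t)"

definition solves_equation ::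
  "nat \<Rightarrow> nat \<Rightarrow> (nat \<Rightarrow> real) \<Rightarrow> (nat \<Rightarrow> real) \<Rightarrow> (nat \<Rightarrow> real) \<Rightarrow> (real \<Rightarrow> real) \<Rightarrow> bool" where
  "solves_equation m p a \<alpha> C x \<longleftrightarrow>
     (\<forall>j\<in>{1..m}. caputo_domain (\<alpha> j) x) \<and>
     (\<forall>t>0. (\<forall>j\<in>{1..m}. caputo_exists (\<alpha> j) x t) \<and>
            a 0 * x t + (\<Sum>j=1..m. a j * caputo_deriv (\<alpha> j) x t) = 0) \<and>
     (\<forall>i\<le>p. nth_deriv i x 0 = C i)"

definition solves_system ::
  "nat \<Rightarrow> nat \<Rightarrow> (nat \<Rightarrow> real) \<Rightarrow> (nat \<Rightarrow> real) \<Rightarrow> (nat \<Rightarrow> real) \<Rightarrow>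
   (real \<Rightarrow> real) \<Rightarrow> (nat \<Rightarrow> real \<Rightarrow> real) \<Rightarrow> bool" where
  "solves_system m p a \<alpha> C x y \<longleftrightarrow>
     caputo_eq (\<alpha> 1) x (y 1) \<and>
     (\<forall>j\<in>{1..m - 2}. caputo_eq (\<alpha> (j + 1) - \<alpha> j) (y j) (y (j + 1))) \<and>
     caputo_eq (\<alpha> m - \<alpha> (m - 1)) (y (m - 1))
       (\<lambda>t. (- 1) / a m * (a 0 * x t + (\<Sum>j=1..m - 1. a j * y j t))) \<and>
     (\<forall>i\<le>p. nth_deriv i x 0 = C i) \<and>
     (\<forall>j\<in>{1..m - 1}. y j 0 = 0)"

end

theory Submission
  imports Defs
begin

text \<open>With the kernels \<open>k a t = t powr (a - 1) / Gamma a\<close> the operators \<open>J a h = k a * h\<close> (convolution)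
  form a semigroup. An absolutely continuous \<open>f\<close> equals \<open>f 0 + J 1 f'\<close>, so a function \<open>x\<close> in the Caputo
  domain is its Taylor polynomial plus \<open>J (p + 1) h\<close>, and its derivative of order \<open>\<alpha>\<close> is
  \<open>J (p + 1 - \<alpha>) h\<close>. For solutions of the equation and for solutions of the system alike, the derivative
  \<open>w\<close> of order \<open>\<alpha> m\<close> satisfies one and the same linear Volterra equation, and \<open>x\<close> and \<open>y j\<close> are
  recovered from \<open>J (\<alpha> m) w\<close> and \<open>J (\<alpha> m - \<alpha> j) w\<close>. The Volterra equation is uniquely solvable in \<open>L1\<close>,
  since an exponential weight makes its kernel small, and its solution is a constant plus \<open>J 1 v\<close>;
  this is the regularity that the domains of the steps of order \<open>\<alpha> (j + 1) - \<alpha> j\<close> require.\<close>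

section \<open>Fractional integrals\<close>

text \<open>The difficulty lies between pointwise and almost everywhere statements. Both problems
  demand their identities at every t > 0, whereas densities, convolutions of L1 functions and L1
  solutions of the Volterra equation are determined only up to null sets, and \<open>J a h\<close>
  with \<open>a < 1\<close> may diverge at single points. Three facts bridge the gap:
  \<open>J a\<close> ignores null sets, so whatever is recovered by integration is determined
  everywhere; \<open>J a h\<close> exists at every point once \<open>a \<ge> 1\<close>; for smaller
  orders integrability comes from the required existence of the Caputo derivatives (equation) or
  from local boundedness of \<open>w\<close> (system, whose last line expresses \<open>w\<close> by
  continuous functions). L1 replaces the space of continuous functions because differentiating the
  Volterra equation for \<open>w = u + J 1 v\<close> produces terms
  \<open>t powr (\<alpha> m - \<alpha> j - 1)\<close>, unbounded at 0. The constant \<open>u\<close>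
  is the limit of \<open>w\<close> at 0 from the right and need not vanish, although all
  \<open>y j\<close> start at 0.\<close>

definition frac_kernel :: "real \<Rightarrow> real \<Rightarrow> real" where
  "frac_kernel a u = (if u > 0 then u powr (a - 1) / Gamma a else 0)"

definition frac_int :: "real \<Rightarrow> (real \<Rightarrow> real) \<Rightarrow> real \<Rightarrow> real" where
  "frac_int a h t = (\<integral>s. frac_kernel a (t - s) * h s \<partial>lborel)"

definition frac_integrable :: "real \<Rightarrow> (real \<Rightarrow> real) \<Rightarrow> real \<Rightarrow> bool" where
  "frac_integrable a h t \<longleftrightarrow> integrable lborel (\<lambda>s. frac_kernel a (t - s) * h s)"

text \<open>Local L1 of the positive half-line: \<open>frac_integrable 1 h t\<close> is
  integrability of \<open>h\<close> on the part below \<open>t\<close>. Extension by 0 lets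
  convolutions run over the whole line.\<close>

definition causal_L1 :: "(real \<Rightarrow> real) \<Rightarrow> bool" where
  "causal_L1 h \<longleftrightarrow> h \<in> borel_measurable borel \<and> (\<forall>s\<le>0. h s = 0) \<and> (\<forall>t. frac_integrable 1 h t)"

lemma frac_kernel_measurable [measurable]: "frac_kernel a \<in> borel_measurable borel"
  unfolding frac_kernel_def by measurable

lemma frac_kernel_nonneg [simp]: "a > 0 \<Longrightarrow> frac_kernel a u \<ge> 0"
  by (simp add: frac_kernel_def)

lemma frac_kernel_nonpos [simp]: "u \<le> 0 \<Longrightarrow> frac_kernel a u = 0"
  by (simp add: frac_kernel_def)

lemma frac_kernel_1 [simp]: "frac_kernel 1 u = (if u > 0 then 1 else 0)"
  by (simp add: frac_kernel_def)

lemma frac_int_measurable [measurable]: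
  assumes [measurable]: "h \<in> borel_measurable borel"
  shows "frac_int a h \<in> borel_measurable borel"
  unfolding frac_int_def[abs_def] by measurable

text \<open>Semigroup law of the Riemann-Liouville kernels. The substitution
  \<open>s = r + (t - r) * x\<close> leads to the Beta integral over \<open>{0..1}\<close>, and
  \<open>Beta b a\<close> supplies exactly the quotient of Gamma values.\<close>

lemma has_bochner_integral_frac_kernel_conv:
  assumes "a > 0" "b > 0"
  shows "has_bochner_integral lborel (\<lambda>s. frac_kernel a (t - s) * frac_kernel b (s - r))
           (frac_kernel (a + b) (t - r))"
proof (cases "r < t")
  case False
  then have "frac_kernel a (t - s) * frac_kernel b (s - r) = 0" for s
    by (simp add: frac_kernel_def)
  then have "(\<lambda>s. frac_kernel a (t - s) * frac_kernel b (s - r)) = (\<lambda>s. 0)" by blast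
  with False show ?thesis by (simp add: has_bochner_integral_zero)
next
  case True
  define d where "d = t - r"
  have d: "d > 0" using True by (simp add: d_def)
  define B where "B x = indicator {0..1} x * (x powr (b - 1) * (1 - x) powr (a - 1))" for x :: real
  have [measurable]: "B \<in> borel_measurable borel" unfolding B_def[abs_def] by measurable
  have "((\<lambda>x. x powr (b - 1) * (1 - x) powr (a - 1)) has_integral Beta b a) {0..1}"
    using assms by (intro has_integral_Beta_real) auto
  from nn_integral_has_integral_lebesgue[OF _ this]
  have "(\<integral>\<^sup>+x. ennreal (B x) \<partial>lborel) = ennreal (Beta b a)"
    by (simp add: B_def mult_ac)
  then have B: "has_bochner_integral lborel B (Beta b a)"
    using assms by (intro has_bochner_integral_nn_integral)
      (auto simp: B_def Beta_def intro!: divide_nonneg_nonneg)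
  define c where "c = d powr (a + b - 2) / (Gamma a * Gamma b)"
  have "has_bochner_integral lborel (\<lambda>x. c * B x) (c * Beta b a)"
    by (rule has_bochner_integral_mult_right) (rule B)
  also have "c * Beta b a = frac_kernel (a + b) d / d"
    using d assms Gamma_real_pos[of a, THEN less_imp_neq] Gamma_real_pos[of b, THEN less_imp_neq] Gamma_real_pos[of a] Gamma_real_pos[of b]
    by (simp add: c_def Beta_def frac_kernel_def powr_diff field_simps power2_eq_square add.commute)
  finally have *: "has_bochner_integral lborel (\<lambda>x. c * B x) (frac_kernel (a + b) d /\<^sub>R \<bar>d\<bar>)"
    using d by (simp add: field_simps)
  have "has_bochner_integral lborel
          (\<lambda>x. frac_kernel a (t - (r + d * x)) * frac_kernel b ((r + d * x) - r)) (frac_kernel (a + b) d /\<^sub>R \<bar>d\<bar>)"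
  proof (rule has_bochner_integralI_AE[OF *])
    have "AE x in lborel. x \<noteq> (0::real)" "AE x in lborel. x \<noteq> (1::real)"
      by (simp_all add: AE_lborel_singleton)
    then show "AE x in lborel. c * B x = frac_kernel a (t - (r + d * x)) * frac_kernel b ((r + d * x) - r)"
    proof eventually_elim
      case (elim x)
      have e: "t - (r + d * x) = d * (1 - x)" by (simp add: d_def algebra_simps)
      show ?case
      proof (cases "0 < x \<and> x < 1")
        case True
        then have "frac_kernel a (t - (r + d * x)) * frac_kernel b ((r + d * x) - r)
            = (d powr (a-1) * d powr (b-1)) * (x powr (b - 1) * (1 - x) powr (a - 1)) / (Gamma a * Gamma b)"
          using d unfolding e by (simp add: frac_kernel_def powr_mult)
        also have "d powr (a-1) * d powr (b-1) = d powr (a + b - 2)"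
          by (simp flip: powr_add add: algebra_simps)
        finally show ?thesis using True by (simp add: c_def B_def)
      next
        case False
        with elim consider "x < 0" | "x > 1" by linarith
        then have "d * x < 0 \<or> d * (1 - x) < 0" using d
          by (auto simp: mult_less_0_iff)
        then show ?thesis unfolding e using False elim
          by (auto simp: frac_kernel_def B_def)
      qed
    qed
  qed auto
  then show ?thesis
    using d lborel_has_bochner_integral_real_affine_iff[of d "\<lambda>s. frac_kernel a (t - s) * frac_kernel b (s - r)" "frac_kernel (a+b) d" r]
    by (simp add: d_def)
qed

text \<open>Fubini at one fixed \<open>t\<close>. The kernels are nonnegative, so integrating the
  absolute value of the double integrand over \<open>s\<close> gives exactly the absolute value of
  the integrand of order \<open>a + b\<close>, which is integrable by assumption.\<close>

lemma
  assumes a: "a > 0" and b: "b > 0" and [measurable]: "h \<in> borel_measurable borel"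
    and h: "frac_integrable (a + b) h t"
  shows frac_integrable_frac_int: "frac_integrable a (frac_int b h) t"
    and frac_int_frac_int: "frac_int a (frac_int b h) t = frac_int (a + b) h t"
proof -
  let ?F = "\<lambda>r s. frac_kernel a (t - s) * frac_kernel b (s - r) * h r"
  note conv = has_bochner_integral_frac_kernel_conv[OF a b]
  have inner: "integrable lborel (?F r)" "(\<integral>s. ?F r s \<partial>lborel) = frac_kernel (a + b) (t - r) * h r"
    "(\<integral>s. norm (?F r s) \<partial>lborel) = norm (frac_kernel (a + b) (t - r) * h r)" for r
    using conv[of t r] a b
    by (auto simp: has_bochner_integral_iff abs_mult)
  have "integrable (lborel \<Otimes>\<^sub>M lborel) (\<lambda>(r, s). ?F r s)"
  proof (rule lborel_pair.Fubini_integrable)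
    show "integrable lborel (\<lambda>r. \<integral>s. norm (case (r, s) of (r, s) \<Rightarrow> ?F r s) \<partial>lborel)"
      using h unfolding frac_integrable_def by (simp only: inner prod.case integrable_norm)
  qed (use inner in auto)
  note F = this
  have e: "(\<integral>r. ?F r s \<partial>lborel) = frac_kernel a (t - s) * frac_int b h s" for s
    by (simp add: frac_int_def mult.assoc)
  show "frac_integrable a (frac_int b h) t"
    using lborel_pair.integrable_snd[OF F] by (simp add: frac_integrable_def e)
  show "frac_int a (frac_int b h) t = frac_int (a + b) h t"
    using lborel_pair.Fubini_integral[OF F] unfolding e inner
    by (simp add: frac_int_def)
qed

text \<open>For 0 < s < t the extra factor \<open>(t - s) powr (b - a)\<close> is at most
  \<open>t powr (b - a)\<close>. With \<open>a = 1\<close> it follows that locally integrable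
  functions have integrals of every order at least 1 at every point.\<close>

lemma frac_integrable_mono_order:
  assumes "0 < a" "a \<le> b" "h \<in> borel_measurable borel" "\<And>s. s \<le> 0 \<Longrightarrow> h s = 0" "frac_integrable a h t"
  shows "frac_integrable b h t"
  unfolding frac_integrable_def
proof (rule Bochner_Integration.integrable_bound)
  let ?c = "t powr (b - a) * Gamma a / Gamma b"
  show "integrable lborel (\<lambda>s. ?c * (frac_kernel a (t - s) * h s))"
    using assms by (intro integrable_mult_right) (simp add: frac_integrable_def)
  show "AE s in lborel. norm (frac_kernel b (t - s) * h s) \<le> norm (?c * (frac_kernel a (t - s) * h s))"
  proof (rule AE_I2)
    fix s
    show "norm (frac_kernel b (t - s) * h s) \<le> norm (?c * (frac_kernel a (t - s) * h s))"
    proof (cases "0 < s \<and> s < t")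
      case True
      have "Gamma a > 0" "Gamma b > 0" using assms by (auto intro: Gamma_real_pos)
      note [simp] = this[THEN less_imp_neq, symmetric] this
      have "(t - s) powr (b - 1) = (t - s) powr (b - a) * (t - s) powr (a - 1)"
        by (simp flip: powr_add)
      also have "\<dots> \<le> t powr (b - a) * (t - s) powr (a - 1)"
        using True assms by (intro mult_right_mono powr_mono2) auto
      finally have "frac_kernel b (t - s) \<le> ?c * frac_kernel a (t - s)"
        using True assms by (simp add: frac_kernel_def divide_right_mono)
      then have "frac_kernel b (t - s) * \<bar>h s\<bar> \<le> ?c * frac_kernel a (t - s) * \<bar>h s\<bar>"
        by (intro mult_right_mono) auto
      then show ?thesis using assms by (simp add: abs_mult mult_ac)
    next
      case False
      then show ?thesis using assms by (auto simp: not_less)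
    qed
  qed
  show "(\<lambda>s. frac_kernel b (t - s) * h s) \<in> borel_measurable lborel"
    using assms(3) by measurable
qed

lemma causal_L1D:
  assumes "causal_L1 h"
  shows "h \<in> borel_measurable borel" "s \<le> 0 \<Longrightarrow> h s = 0" "a \<ge> 1 \<Longrightarrow> frac_integrable a h t"
  using assms frac_integrable_mono_order[of 1 a h t] by (auto simp: causal_L1_def)

lemma frac_int_nonpos:
  assumes "\<And>s. s \<le> 0 \<Longrightarrow> h s = 0" "t \<le> 0"
  shows "frac_int a h t = 0"
proof -
  have "frac_kernel a (t - s) * h s = 0" for s
    using assms by (cases "s \<le> 0") auto
  then have "(\<lambda>s. frac_kernel a (t - s) * h s) = (\<lambda>s. 0)" by blast
  then show ?thesis by (simp add: frac_int_def)
qed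

lemma causal_L1_frac_int:
  assumes "causal_L1 h" "a > 0"
  shows "causal_L1 (frac_int a h)"
  unfolding causal_L1_def
  using frac_integrable_frac_int[of 1 a h] causal_L1D[OF assms(1)] assms(2)
  by (auto intro!: frac_int_nonpos frac_int_measurable)

lemma frac_integrable_kernel: "a > 0 \<Longrightarrow> b > 0 \<Longrightarrow> frac_integrable a (frac_kernel b) t"
  using has_bochner_integral_frac_kernel_conv[of a b t 0]
  by (simp add: frac_integrable_def has_bochner_integral_iff)

lemma frac_int_kernel: "a > 0 \<Longrightarrow> b > 0 \<Longrightarrow> frac_int a (frac_kernel b) t = frac_kernel (a + b) t"
  using has_bochner_integral_frac_kernel_conv[of a b t 0]
  by (simp add: frac_int_def has_bochner_integral_iff)

lemma causal_L1_kernel: "a > 0 \<Longrightarrow> causal_L1 (frac_kernel a)"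
  using frac_integrable_kernel[of 1 a] by (auto simp: causal_L1_def)

lemma frac_integrable_add:
  "frac_integrable a f t \<Longrightarrow> frac_integrable a g t \<Longrightarrow> frac_integrable a (\<lambda>s. f s + g s) t"
  by (simp add: frac_integrable_def distrib_left)

lemma frac_int_add:
  "frac_integrable a f t \<Longrightarrow> frac_integrable a g t \<Longrightarrow>
    frac_int a (\<lambda>s. f s + g s) t = frac_int a f t + frac_int a g t"
  by (simp add: frac_integrable_def frac_int_def distrib_left)

lemma frac_integrable_cmult: "frac_integrable a f t \<Longrightarrow> frac_integrable a (\<lambda>s. c * f s) t"
  unfolding frac_integrable_def
  by (subst mult.left_commute) (rule integrable_mult_right)

lemma frac_int_cmult: "frac_int a (\<lambda>s. c * f s) t = c * frac_int a f t"
  by (simp add: frac_int_def mult.left_commute)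

lemma frac_integrable_sum:
  "(\<And>i. i \<in> A \<Longrightarrow> frac_integrable a (f i) t) \<Longrightarrow> frac_integrable a (\<lambda>s. \<Sum>i\<in>A. f i s) t"
  by (simp add: frac_integrable_def sum_distrib_left)

lemma frac_int_sum:
  "(\<And>i. i \<in> A \<Longrightarrow> frac_integrable a (f i) t) \<Longrightarrow>
    frac_int a (\<lambda>s. \<Sum>i\<in>A. f i s) t = (\<Sum>i\<in>A. frac_int a (f i) t)"
  by (simp add: frac_integrable_def frac_int_def sum_distrib_left)

lemma causal_L1_add: "causal_L1 f \<Longrightarrow> causal_L1 g \<Longrightarrow> causal_L1 (\<lambda>s. f s + g s)"
  using frac_integrable_add by (auto simp: causal_L1_def)

lemma causal_L1_cmult: "causal_L1 f \<Longrightarrow> causal_L1 (\<lambda>s. c * f s)"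
  using frac_integrable_cmult by (auto simp: causal_L1_def)

lemma causal_L1_sum: "(\<And>i. i \<in> A \<Longrightarrow> causal_L1 (f i)) \<Longrightarrow> causal_L1 (\<lambda>s. \<Sum>i\<in>A. f i s)"
  using frac_integrable_sum[of A 1 f] by (auto simp: causal_L1_def intro!: sum.neutral borel_measurable_sum)

lemma frac_int_cong_AE:
  assumes [measurable]: "f \<in> borel_measurable borel" "g \<in> borel_measurable borel"
    and "AE s in lborel. f s = g s"
  shows "frac_int a f t = frac_int a g t"
proof -
  have ae: "AE s in lborel. frac_kernel a (t - s) * f s = frac_kernel a (t - s) * g s"
    using assms(3) by eventually_elim simp
  show ?thesis
    unfolding frac_int_def by (rule integral_cong_AE[OF _ _ ae]) measurable
qed

lemma frac_int_cong:
  assumes "\<And>s. s < t \<Longrightarrow> f s = g s"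
  shows "frac_int a f t = frac_int a g t"
proof -
  have "frac_kernel a (t - s) * f s = frac_kernel a (t - s) * g s" for s
    using assms[of s] by (cases "s < t") auto
  then have "(\<lambda>s. frac_kernel a (t - s) * f s) = (\<lambda>s. frac_kernel a (t - s) * g s)" by blast
  then show ?thesis by (simp add: frac_int_def)
qed

text \<open>Comparison with a constant, whose fractional integrals are kernels. This reaches orders
  below 1 at every point, where local integrability alone would give them almost everywhere
  only.\<close>

lemma frac_integrable_bounded:
  assumes [measurable]: "w \<in> borel_measurable borel" and "\<And>s. s \<le> 0 \<Longrightarrow> w s = 0"
    and "\<And>s. 0 < s \<Longrightarrow> s < t \<Longrightarrow> \<bar>w s\<bar> \<le> B" and "a > 0"
  shows "frac_integrable a w t"
  unfolding frac_integrable_def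
proof (rule Bochner_Integration.integrable_bound)
  show "integrable lborel (\<lambda>s. B * (frac_kernel a (t - s) * frac_kernel 1 s))"
    using frac_integrable_kernel[of a 1 t] assms(4) by (intro integrable_mult_right) (simp add: frac_integrable_def)
  show "AE s in lborel. norm (frac_kernel a (t - s) * w s) \<le> norm (B * (frac_kernel a (t - s) * frac_kernel 1 s))"
  proof (rule AE_I2)
    fix s
    show "norm (frac_kernel a (t - s) * w s) \<le> norm (B * (frac_kernel a (t - s) * frac_kernel 1 s))"
    proof (cases "0 < s \<and> s < t")
      case True
      then have "frac_kernel a (t - s) * \<bar>w s\<bar> \<le> frac_kernel a (t - s) * \<bar>B\<bar>"
        using assms(3)[of s] assms(4) by (intro mult_left_mono) auto
      then show ?thesis using True assms(4) by (simp add: abs_mult mult_ac)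
    qed (use assms in \<open>auto simp: not_less\<close>)
  qed
qed measurable

section \<open>Absolutely continuous functions\<close>

text \<open>Index sets of any type are allowed, so that disjoint sums, Sigma sets and sets of
  integers serve directly; \<open>nonoverlapping_reindex\<close> returns to initial segments of the
  naturals.\<close>

definition nonoverlapping :: "'i set \<Rightarrow> ('i \<Rightarrow> real) \<Rightarrow> ('i \<Rightarrow> real) \<Rightarrow> real \<Rightarrow> real \<Rightarrow> bool" where
  "nonoverlapping I u v a b \<longleftrightarrow> finite I \<and> (\<forall>i\<in>I. a \<le> u i \<and> u i \<le> v i \<and> v i \<le> b) \<and>
     (\<forall>i\<in>I. \<forall>j\<in>I. i \<noteq> j \<longrightarrow> {u i<..<v i} \<inter> {u j<..<v j} = {})"

lemma nonoverlapping_disjoint: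
  "nonoverlapping I u v a b \<Longrightarrow> i \<in> I \<Longrightarrow> j \<in> I \<Longrightarrow> i \<noteq> j \<Longrightarrow> {u i<..<v i} \<inter> {u j<..<v j} = {}"
  unfolding nonoverlapping_def by blast

lemma nonoverlapping_reindex:
  assumes "nonoverlapping I u v a b"
  obtains N :: nat and e where "nonoverlapping {..<N} (u \<circ> e) (v \<circ> e) a b"
    "\<And>g :: real \<Rightarrow> real \<Rightarrow> real. (\<Sum>i<N. g ((u \<circ> e) i) ((v \<circ> e) i)) = (\<Sum>i\<in>I. g (u i) (v i))"
proof -
  obtain e where e: "bij_betw e {..<card I} I"
    using assms ex_bij_betw_nat_finite[of I] by (auto simp: nonoverlapping_def atLeast0LessThan)
  show thesis
  proof
    show "nonoverlapping {..<card I} (u \<circ> e) (v \<circ> e) a b"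
      unfolding nonoverlapping_def
    proof (intro conjI ballI impI)
      fix i j assume "i \<in> {..<card I}" "j \<in> {..<card I}" "i \<noteq> j"
      then have "e i \<in> I" "e j \<in> I" "e i \<noteq> e j"
        using e by (auto simp: bij_betw_def inj_on_def)
      then show "{(u \<circ> e) i<..<(v \<circ> e) i} \<inter> {(u \<circ> e) j<..<(v \<circ> e) j} = {}"
        using assms unfolding nonoverlapping_def comp_def by blast
    qed (use assms e in \<open>auto simp: nonoverlapping_def bij_betw_def\<close>)
    show "(\<Sum>i<card I. g ((u \<circ> e) i) ((v \<circ> e) i)) = (\<Sum>i\<in>I. g (u i) (v i))" for g :: "real \<Rightarrow> real \<Rightarrow> real"
      using sum.reindex_bij_betw[OF e, of "\<lambda>i. g (u i) (v i)"] by simp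
  qed
qed

lemma abs_continuous_on_iff:
  "abs_continuous_on a b f \<longleftrightarrow> (\<forall>\<epsilon>>0. \<exists>\<delta>>0. \<forall>(N::nat) u v. nonoverlapping {..<N} u v a b \<longrightarrow>
     (\<Sum>i<N. v i - u i) < \<delta> \<longrightarrow> (\<Sum>i<N. \<bar>f (v i) - f (u i)\<bar>) < \<epsilon>)"
  by (simp add: abs_continuous_on_def nonoverlapping_def Ball_def imp_conjL)

lemma nonoverlapping_finite_less:
  fixes f :: "real \<Rightarrow> real"
  assumes "\<forall>(N::nat) u v. nonoverlapping {..<N} u v a b \<longrightarrow>
     (\<Sum>i<N. v i - u i) < \<delta> \<longrightarrow> (\<Sum>i<N. \<bar>f (v i) - f (u i)\<bar>) < \<epsilon>"
    and "nonoverlapping I u v a b" "(\<Sum>i\<in>I. v i - u i) < \<delta>"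
  shows "(\<Sum>i\<in>I. \<bar>f (v i) - f (u i)\<bar>) < \<epsilon>"
proof -
  obtain N :: nat and e where "nonoverlapping {..<N} (u \<circ> e) (v \<circ> e) a b"
    and *: "\<And>g :: real \<Rightarrow> real \<Rightarrow> real. (\<Sum>i<N. g ((u \<circ> e) i) ((v \<circ> e) i)) = (\<Sum>i\<in>I. g (u i) (v i))"
    using nonoverlapping_reindex[OF assms(2)] by metis
  then show ?thesis
    using assms(1)[rule_format, of N "u \<circ> e" "v \<circ> e"] assms(3) *[of "\<lambda>x y. y - x"] *[of "\<lambda>x y. \<bar>f y - f x\<bar>"]
    by simp
qed

lemma nonoverlapping_length_le:
  assumes "nonoverlapping I u v a b" "a \<le> b"
  shows "(\<Sum>i\<in>I. v i - u i) \<le> b - a"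
proof -
  have I: "finite I" and i: "\<And>i. i \<in> I \<Longrightarrow> a \<le> u i \<and> u i \<le> v i \<and> v i \<le> b"
    and d: "disjoint_family_on (\<lambda>i. {u i<..<v i}) I"
    using assms by (auto simp: nonoverlapping_def disjoint_family_on_def)
  have "ennreal (\<Sum>i\<in>I. v i - u i) = (\<Sum>i\<in>I. ennreal (v i - u i))"
    using i by (intro sum_ennreal[symmetric]) auto
  also have "\<dots> = (\<Sum>i\<in>I. emeasure lborel {u i<..<v i})"
    using i by (intro sum.cong) auto
  also have "\<dots> = emeasure lborel (\<Union>i\<in>I. {u i<..<v i})"
    using I d by (intro sum_emeasure) auto
  also have "\<dots> \<le> emeasure lborel {a..b}"
    using i by (intro emeasure_mono) force+
  finally show ?thesis using assms(2) by simp
qed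

section \<open>Total variation of an absolutely continuous function\<close>

definition variation_sums :: "(real \<Rightarrow> real) \<Rightarrow> real \<Rightarrow> real \<Rightarrow> real set" where
  "variation_sums f a b =
     {(\<Sum>i<N. \<bar>f (v i) - f (u i)\<bar>) | (N::nat) u v. nonoverlapping {..<N} u v a b}"

lemma variation_sumsI:
  assumes "nonoverlapping I u v a b"
  shows "(\<Sum>i\<in>I. \<bar>f (v i) - f (u i)\<bar>) \<in> variation_sums f a b"
proof -
  obtain N :: nat and e where "nonoverlapping {..<N} (u \<circ> e) (v \<circ> e) a b"
    and *: "\<And>g :: real \<Rightarrow> real \<Rightarrow> real. (\<Sum>i<N. g ((u \<circ> e) i) ((v \<circ> e) i)) = (\<Sum>i\<in>I. g (u i) (v i))"
    using nonoverlapping_reindex[OF assms] by metis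
  then show ?thesis
    unfolding variation_sums_def using *[of "\<lambda>x y. \<bar>f y - f x\<bar>"]
    by (intro CollectI exI[of _ N] exI[of _ "u \<circ> e"] exI[of _ "v \<circ> e"]) simp
qed

lemma variation_sums_0: "0 \<in> variation_sums f a b"
  using variation_sumsI[of "{}::nat set" undefined undefined a b f] by (simp add: nonoverlapping_def)

lemma variation_sums_join:
  assumes "x \<in> variation_sums f a c" "y \<in> variation_sums f c b" "a \<le> c" "c \<le> b"
  shows "x + y \<in> variation_sums f a b"
proof -
  obtain N :: nat and u v where x: "x = (\<Sum>i<N. \<bar>f (v i) - f (u i)\<bar>)" "nonoverlapping {..<N} u v a c"
    using assms(1) unfolding variation_sums_def by blast
  obtain M :: nat and u' v' where y: "y = (\<Sum>i<M. \<bar>f (v' i) - f (u' i)\<bar>)" "nonoverlapping {..<M} u' v' c b"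
    using assms(2) unfolding variation_sums_def by blast
  let ?I = "{..<N} <+> {..<M}"
  have "nonoverlapping ?I (case_sum u u') (case_sum v v') a b"
    unfolding nonoverlapping_def
  proof (intro conjI ballI impI)
    show "finite ?I" by simp
  next
    fix i assume i: "i \<in> ?I"
    have "a \<le> u k \<and> u k \<le> v k \<and> v k \<le> b" if "k < N" for k
      using x(2) that assms(4) unfolding nonoverlapping_def by (meson lessThan_iff order_trans)
    moreover have "a \<le> u' k \<and> u' k \<le> v' k \<and> v' k \<le> b" if "k < M" for k
      using y(2) that assms(3) unfolding nonoverlapping_def by (meson lessThan_iff order_trans)
    ultimately show "a \<le> case_sum u u' i" "case_sum u u' i \<le> case_sum v v' i" "case_sum v v' i \<le> b"
      using i by (cases i; auto)+
  next
    fix i j assume ij: "i \<in> ?I" "j \<in> ?I" "i \<noteq> j"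
    have sep: "{u k<..<v k} \<inter> {u' l<..<v' l} = {}" if "k < N" "l < M" for k l
    proof -
      have "v k \<le> c" "c \<le> u' l" using that x(2) y(2) by (auto simp: nonoverlapping_def)
      then show ?thesis by auto
    qed
    show "{case_sum u u' i<..<case_sum v v' i} \<inter> {case_sum u u' j<..<case_sum v v' j} = {}"
    proof (cases i; cases j)
      fix k l assume kl: "i = Inl k" "j = Inl l"
      then have "{u k<..<v k} \<inter> {u l<..<v l} = {}"
        using ij x(2) by (intro nonoverlapping_disjoint) auto
      with kl show ?thesis by simp
    next
      fix k l assume kl: "i = Inl k" "j = Inr l"
      then have "{u k<..<v k} \<inter> {u' l<..<v' l} = {}"
        using ij by (intro sep) auto
      with kl show ?thesis by simp
    next
      fix k l assume kl: "i = Inr k" "j = Inl l"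
      then have "{u l<..<v l} \<inter> {u' k<..<v' k} = {}"
        using ij by (intro sep) auto
      then have "{u' k<..<v' k} \<inter> {u l<..<v l} = {}" by blast
      with kl show ?thesis by simp
    next
      fix k l assume kl: "i = Inr k" "j = Inr l"
      then have "{u' k<..<v' k} \<inter> {u' l<..<v' l} = {}"
        using ij y(2) by (intro nonoverlapping_disjoint) auto
      with kl show ?thesis by simp
    qed
  qed
  from variation_sumsI[OF this, of f] show ?thesis
    by (simp add: x y sum.Plus comp_def)
qed

text \<open>Every interval is clipped to both sides of \<open>c\<close>. An interval straddling
  \<open>c\<close> becomes two pieces and the triangle inequality applies; a clipped interval that
  degenerates to a point contributes 0.\<close>

lemma variation_sums_cut:
  assumes "x \<in> variation_sums f a b" "a \<le> c" "c \<le> b"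
  obtains y z where "y \<in> variation_sums f a c" "z \<in> variation_sums f c b" "x \<le> y + z"
proof -
  obtain N :: nat and u v where x: "x = (\<Sum>i<N. \<bar>f (v i) - f (u i)\<bar>)" "nonoverlapping {..<N} u v a b"
    using assms(1) unfolding variation_sums_def by blast
  show thesis
  proof
    have "nonoverlapping {..<N} (\<lambda>i. min (u i) c) (\<lambda>i. min (v i) c) a c"
      unfolding nonoverlapping_def
    proof (intro conjI ballI impI)
      fix i j assume "i \<in> {..<N}" "j \<in> {..<N}" "i \<noteq> j"
      then have "{u i<..<v i} \<inter> {u j<..<v j} = {}" using x(2) unfolding nonoverlapping_def by blast
      moreover have "{min (u k) c<..<min (v k) c} \<subseteq> {u k<..<v k}" for k by (auto simp: min_less_iff_disj)
      ultimately show "{min (u i) c<..<min (v i) c} \<inter> {min (u j) c<..<min (v j) c} = {}" by blast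
    next
      fix i assume "i \<in> {..<N}"
      then have "u i \<le> v i" "a \<le> u i" using x(2) by (auto simp: nonoverlapping_def)
      then show "a \<le> min (u i) c" "min (u i) c \<le> min (v i) c" "min (v i) c \<le> c"
        using assms(2) by linarith+
    qed simp
    from variation_sumsI[OF this, of f]
    show "(\<Sum>i<N. \<bar>f (min (v i) c) - f (min (u i) c)\<bar>) \<in> variation_sums f a c" .
    have "nonoverlapping {..<N} (\<lambda>i. max (u i) c) (\<lambda>i. max (v i) c) c b"
      unfolding nonoverlapping_def
    proof (intro conjI ballI impI)
      fix i j assume "i \<in> {..<N}" "j \<in> {..<N}" "i \<noteq> j"
      then have "{u i<..<v i} \<inter> {u j<..<v j} = {}" using x(2) unfolding nonoverlapping_def by blast
      moreover have "{max (u k) c<..<max (v k) c} \<subseteq> {u k<..<v k}" for k by (auto simp: less_max_iff_disj)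
      ultimately show "{max (u i) c<..<max (v i) c} \<inter> {max (u j) c<..<max (v j) c} = {}" by blast
    next
      fix i assume "i \<in> {..<N}"
      then have "u i \<le> v i" "v i \<le> b" using x(2) by (auto simp: nonoverlapping_def)
      then show "c \<le> max (u i) c" "max (u i) c \<le> max (v i) c" "max (v i) c \<le> b"
        using assms(3) by linarith+
    qed simp
    from variation_sumsI[OF this, of f]
    show "(\<Sum>i<N. \<bar>f (max (v i) c) - f (max (u i) c)\<bar>) \<in> variation_sums f c b" .
    show "x \<le> (\<Sum>i<N. \<bar>f (min (v i) c) - f (min (u i) c)\<bar>) + (\<Sum>i<N. \<bar>f (max (v i) c) - f (max (u i) c)\<bar>)"
      unfolding x sum.distrib[symmetric] by (intro sum_mono) (auto simp: min_def max_def)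
  qed
qed

lemma abs_continuous_onE:
  assumes "abs_continuous_on a b f" "\<epsilon> > 0"
  obtains \<delta> where "\<delta> > 0" "\<forall>(N::nat) u v. nonoverlapping {..<N} u v a b \<longrightarrow>
     (\<Sum>i<N. v i - u i) < \<delta> \<longrightarrow> (\<Sum>i<N. \<bar>f (v i) - f (u i)\<bar>) < \<epsilon>"
  using assms unfolding abs_continuous_on_iff by blast

text \<open>Absolute continuity bounds the sums by 1 on every interval shorter than
  \<open>\<delta>\<close>, and finitely many such intervals cover \<open>{0..T}\<close>.\<close>

lemma bdd_above_variation_sums:
  assumes ac: "abs_continuous_on 0 T f"
  shows "bdd_above (variation_sums f 0 T)"
proof (cases "T \<ge> 0")
  case False
  then have "x = 0" if "x \<in> variation_sums f 0 T" for x
  proof -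
    obtain N :: nat and u v where x: "x = (\<Sum>i<N. \<bar>f (v i) - f (u i)\<bar>)" "nonoverlapping {..<N} u v 0 T"
      using \<open>x \<in> _\<close> unfolding variation_sums_def by blast
    with False have "N = 0" by (cases N) (force simp: nonoverlapping_def)+
    with x show ?thesis by simp
  qed
  then show ?thesis by (metis bdd_above.I order_refl)
next
  case True
  obtain \<delta> where \<delta>: "\<delta> > 0" "\<forall>(N::nat) u v. nonoverlapping {..<N} u v 0 T \<longrightarrow>
     (\<Sum>i<N. v i - u i) < \<delta> \<longrightarrow> (\<Sum>i<N. \<bar>f (v i) - f (u i)\<bar>) < 1"
    by (rule abs_continuous_onE[OF ac zero_less_one]) (rule that)
  have small: "x \<le> 1" if "x \<in> variation_sums f s t" "0 \<le> s" "s \<le> t" "t \<le> T" "t - s < \<delta>" for x s t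
  proof -
    obtain N :: nat and u v where x: "x = (\<Sum>i<N. \<bar>f (v i) - f (u i)\<bar>)" "nonoverlapping {..<N} u v s t"
      using \<open>x \<in> _\<close> unfolding variation_sums_def by blast
    have "nonoverlapping {..<N} u v 0 T"
      using x(2) that unfolding nonoverlapping_def by (meson order_trans)
    with \<delta>(2)[rule_format, OF this] nonoverlapping_length_le[OF x(2)] that show ?thesis
      unfolding x by linarith
  qed
  have "\<forall>x\<in>variation_sums f 0 t. x \<le> real n + 1" if "0 \<le> t" "t \<le> T" "t \<le> real n * (\<delta> / 2)" for n t
    using that
  proof (induction n arbitrary: t)
    case 0
    then show ?case using small[of _ 0 t] \<delta>(1) by auto
  next
    case (Suc n)
    \<comment> \<open>Cuts off a last piece of length at most \<open>\<delta> / 2\<close>, safely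
      below the strict bound \<open>\<delta>\<close>; the maximum with 0 keeps the cut inside the
      interval.\<close>
    define c where "c = max 0 (t - \<delta> / 2)"
    have c: "0 \<le> c" "c \<le> t" "c \<le> T" "c \<le> real n * (\<delta> / 2)" "t - c < \<delta>"
      using Suc.prems \<delta>(1) by (auto simp: c_def max_def algebra_simps add_divide_distrib)
    show ?case
    proof
      fix x assume "x \<in> variation_sums f 0 t"
      then obtain y z where yz: "y \<in> variation_sums f 0 c" "z \<in> variation_sums f c t" "x \<le> y + z"
        using variation_sums_cut c(1,2) by metis
      have "y \<le> real n + 1" using Suc.IH[of c] c yz by auto
      moreover have "z \<le> 1" using small[OF yz(2)] c Suc.prems by auto
      ultimately show "x \<le> real (Suc n) + 1" using yz(3) by simp
    qed
  qed
  moreover obtain n where "T / (\<delta> / 2) \<le> real n" using real_arch_simple by blast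
  then have "T \<le> real n * (\<delta> / 2)" using \<delta>(1) by (simp add: field_simps)
  ultimately show ?thesis using True by (meson bdd_above.I order_refl)
qed

definition variation :: "(real \<Rightarrow> real) \<Rightarrow> real \<Rightarrow> real" where
  "variation f t = Sup (variation_sums f 0 t)"

text \<open>The single interval from \<open>s\<close> to \<open>t\<close> can be appended to any
  family on \<open>{0..s}\<close>. The inequality makes both \<open>variation f\<close> and its
  difference with \<open>f\<close> nondecreasing, which is the Jordan decomposition.\<close>

lemma abs_diff_le_variation:
  assumes ac: "\<And>T. T > 0 \<Longrightarrow> abs_continuous_on 0 T f" and "0 \<le> s" "s \<le> t"
  shows "\<bar>f t - f s\<bar> \<le> variation f t - variation f s"
proof (cases "t > 0")
  case True
  have "nonoverlapping {0::nat} (\<lambda>_. s) (\<lambda>_. t) s t"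
    using assms by (simp add: nonoverlapping_def)
  from variation_sumsI[OF this, of f] have d: "\<bar>f t - f s\<bar> \<in> variation_sums f s t" by simp
  have "x \<le> variation f t - \<bar>f t - f s\<bar>" if "x \<in> variation_sums f 0 s" for x
    using cSup_upper[OF variation_sums_join[OF that d] bdd_above_variation_sums[OF ac[OF True]]] assms
    by (simp add: variation_def)
  then have "variation f s \<le> variation f t - \<bar>f t - f s\<bar>"
    unfolding variation_def[of f s] using variation_sums_0[of f 0 s] by (intro cSup_least) auto
  then show ?thesis by simp
next
  case False
  with assms have "s = t" by simp
  then show ?thesis by simp
qed

text \<open>Inside each interval of a short family, finitely many subintervals nearly realise the
  increment of the variation. All of them together form one family whose total length does not
  exceed that of the given one, so the modulus of \<open>f\<close> applies to it.\<close>

lemma abs_continuous_on_variation: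
  assumes ac: "\<And>T. T > 0 \<Longrightarrow> abs_continuous_on 0 T f"
  shows "abs_continuous_on 0 T (variation f)"
  unfolding abs_continuous_on_iff
proof (intro allI impI)
  fix \<epsilon> :: real assume "\<epsilon> > 0"
  then have "\<epsilon> / 2 > 0" by simp
  \<comment> \<open>\<open>T\<close> may be nonpositive, whereas \<open>f\<close> is controlled on
    intervals with positive right end only.\<close>
  have ac': "abs_continuous_on 0 (max T 1) f" using ac by simp
  obtain \<delta> where \<delta>: "\<delta> > 0" "\<forall>(N::nat) u v. nonoverlapping {..<N} u v 0 (max T 1) \<longrightarrow>
     (\<Sum>i<N. v i - u i) < \<delta> \<longrightarrow> (\<Sum>i<N. \<bar>f (v i) - f (u i)\<bar>) < \<epsilon> / 2"
    by (rule abs_continuous_onE[OF ac' \<open>\<epsilon> / 2 > 0\<close>]) (rule that)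
  show "\<exists>\<delta>>0. \<forall>(N::nat) u v. nonoverlapping {..<N} u v 0 T \<longrightarrow>
     (\<Sum>i<N. v i - u i) < \<delta> \<longrightarrow> (\<Sum>i<N. \<bar>variation f (v i) - variation f (u i)\<bar>) < \<epsilon>"
  proof (intro exI[of _ \<delta>] conjI allI impI)
    fix N :: nat and u v
    assume uv: "nonoverlapping {..<N} u v 0 T" and len: "(\<Sum>i<N. v i - u i) < \<delta>"
    \<comment> \<open>Each of the \<open>N\<close> suprema is missed by at most
      \<open>\<eta>\<close>, altogether by at most \<open>\<epsilon> / 2\<close>; the summand 1
      avoids division by zero.\<close>
    define \<eta> where "\<eta> = \<epsilon> / (2 * (real N + 1))"
    have \<eta>: "\<eta> > 0" using \<open>\<epsilon> > 0\<close> by (simp add: \<eta>_def)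
    have i: "0 \<le> u i" "u i \<le> v i" "v i \<le> T" if "i < N" for i
      using uv that by (auto simp: nonoverlapping_def)
    define P where "P i M u' v' \<longleftrightarrow> nonoverlapping {..<M} u' v' (u i) (v i) \<and>
        \<bar>variation f (v i) - variation f (u i)\<bar> \<le> (\<Sum>j<M. \<bar>f (v' j) - f (u' j)\<bar>) + \<eta>"
      for i and M :: nat and u' v' :: "nat \<Rightarrow> real"
    have "\<exists>M u' v'. P i M u' v'" if iN: "i < N" for i
    proof -
      have "variation f (v i) - \<eta> < Sup (variation_sums f 0 (v i))"
        using \<eta> by (simp add: variation_def)
      then obtain x where x: "x \<in> variation_sums f 0 (v i)" "variation f (v i) - \<eta> < x"
        using less_cSupD[of "variation_sums f 0 (v i)" "variation f (v i) - \<eta>"] variation_sums_0[of f 0 "v i"]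
        by blast
      \<comment> \<open>A nearly optimal family on \<open>{0..v i}\<close> is cut at
        \<open>u i\<close>. Its left part is at most \<open>variation f (u i)\<close>, so the right
        part carries the increment up to \<open>\<eta>\<close>.\<close>
      obtain y z where yz: "y \<in> variation_sums f 0 (u i)" "z \<in> variation_sums f (u i) (v i)" "x \<le> y + z"
        using variation_sums_cut[OF x(1) i(1,2)[OF iN]] by metis
      have "abs_continuous_on 0 (u i) f \<or> u i = 0" using ac[of "u i"] i[OF iN] by auto
      then have "bdd_above (variation_sums f 0 (u i))"
      proof
        assume "u i = 0"
        then have "w \<le> 0" if "w \<in> variation_sums f 0 (u i)" for w
        proof -
          obtain K :: nat and p q where w: "w = (\<Sum>i<K. \<bar>f (q i) - f (p i)\<bar>)" "nonoverlapping {..<K} p q 0 (u i)"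
            using \<open>w \<in> _\<close> unfolding variation_sums_def by blast
          have "p j = 0 \<and> q j = 0" if "j < K" for j
          proof -
            have "0 \<le> p j" "p j \<le> q j" "q j \<le> 0"
              using w(2) that \<open>u i = 0\<close> by (auto simp: nonoverlapping_def)
            then show ?thesis by linarith
          qed
          then show ?thesis using w(1) by (simp add: sum.neutral)
        qed
        then show ?thesis by (rule bdd_above.I)
      qed (rule bdd_above_variation_sums)
      then have "y \<le> variation f (u i)"
        unfolding variation_def using yz(1) by (intro cSup_upper)
      moreover have "variation f (u i) \<le> variation f (v i)"
        using abs_diff_le_variation[OF ac, of "u i" "v i"] i[OF iN] by linarith
      ultimately have "\<bar>variation f (v i) - variation f (u i)\<bar> \<le> z + \<eta>"
        using x yz(3) by linarith
      moreover obtain M :: nat and u' v' where "z = (\<Sum>j<M. \<bar>f (v' j) - f (u' j)\<bar>)"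
        "nonoverlapping {..<M} u' v' (u i) (v i)"
        using yz(2) unfolding variation_sums_def by blast
      ultimately show ?thesis unfolding P_def by blast
    qed
    then obtain M :: "nat \<Rightarrow> nat" and p q where "\<And>i. i < N \<Longrightarrow> P i (M i) (p i) (q i)"
      by metis
    then have pq: "i < N \<Longrightarrow> nonoverlapping {..<M i} (p i) (q i) (u i) (v i)"
      and V: "i < N \<Longrightarrow> \<bar>variation f (v i) - variation f (u i)\<bar> \<le> (\<Sum>j<M i. \<bar>f (q i j) - f (p i j)\<bar>) + \<eta>" for i
      unfolding P_def by blast+
    let ?I = "SIGMA i:{..<N}. {..<M i}"
    have sub: "{p i j<..<q i j} \<subseteq> {u i<..<v i}" if "i < N" "j < M i" for i j
    proof -
      have "u i \<le> p i j" "q i j \<le> v i"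
        using pq[OF that(1)] that(2) by (simp_all add: nonoverlapping_def)
      then show ?thesis by auto
    qed
    have I: "nonoverlapping ?I (\<lambda>(i, j). p i j) (\<lambda>(i, j). q i j) 0 (max T 1)"
      unfolding nonoverlapping_def
    proof (intro conjI ballI impI)
      fix k assume "k \<in> ?I"
      then obtain i j where k: "k = (i, j)" "i < N" "j < M i" by auto
      have "u i \<le> p i j \<and> p i j \<le> q i j \<and> q i j \<le> v i"
        using pq[OF k(2)] k(3) by (auto simp: nonoverlapping_def)
      with i[OF k(2)] show "0 \<le> (case k of (i, j) \<Rightarrow> p i j)" "(case k of (i, j) \<Rightarrow> p i j) \<le> (case k of (i, j) \<Rightarrow> q i j)"
        "(case k of (i, j) \<Rightarrow> q i j) \<le> max T 1" by (auto simp: k)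
    next
      fix k l assume kl: "k \<in> ?I" "l \<in> ?I" "k \<noteq> l"
      obtain i j where k: "k = (i, j)" "i < N" "j < M i" using kl by auto
      obtain i' j' where l: "l = (i', j')" "i' < N" "j' < M i'" using kl by auto
      show "{case k of (i, j) \<Rightarrow> p i j<..<case k of (i, j) \<Rightarrow> q i j} \<inter>
          {case l of (i, j) \<Rightarrow> p i j<..<case l of (i, j) \<Rightarrow> q i j} = {}"
      proof (cases "i = i'")
        case True
        then have "{p i j<..<q i j} \<inter> {p i j'<..<q i j'} = {}"
          using kl(3) k l by (intro nonoverlapping_disjoint[OF pq[OF k(2)]]) auto
        then show ?thesis using True by (simp add: k l)
      next
        case False
        then have "{u i<..<v i} \<inter> {u i'<..<v i'} = {}"
          using k(2) l(2) by (intro nonoverlapping_disjoint[OF uv]) auto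
        then show ?thesis using sub[OF k(2,3)] sub[OF l(2,3)] unfolding k l prod.case by blast
      qed
    qed auto
    have "(\<Sum>(i, j)\<in>?I. q i j - p i j) = (\<Sum>i<N. \<Sum>j<M i. q i j - p i j)"
      by (subst sum.Sigma) auto
    also have "\<dots> \<le> (\<Sum>i<N. v i - u i)"
      using i by (intro sum_mono nonoverlapping_length_le pq) auto
    also note len
    finally have "(\<Sum>k\<in>?I. (case k of (i, j) \<Rightarrow> q i j) - (case k of (i, j) \<Rightarrow> p i j)) < \<delta>"
      by (simp add: case_prod_unfold)
    from nonoverlapping_finite_less[OF \<delta>(2) I this]
    have "(\<Sum>k\<in>?I. \<bar>f (case k of (i, j) \<Rightarrow> q i j) - f (case k of (i, j) \<Rightarrow> p i j)\<bar>) < \<epsilon> / 2" .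
    moreover have "(\<Sum>k\<in>?I. \<bar>f (case k of (i, j) \<Rightarrow> q i j) - f (case k of (i, j) \<Rightarrow> p i j)\<bar>)
        = (\<Sum>i<N. \<Sum>j<M i. \<bar>f (q i j) - f (p i j)\<bar>)"
      by (subst sum.Sigma) (auto intro!: sum.cong)
    ultimately have s: "(\<Sum>i<N. \<Sum>j<M i. \<bar>f (q i j) - f (p i j)\<bar>) < \<epsilon> / 2"
      by simp
    have "(\<Sum>i<N. \<bar>variation f (v i) - variation f (u i)\<bar>) \<le> (\<Sum>i<N. (\<Sum>j<M i. \<bar>f (q i j) - f (p i j)\<bar>) + \<eta>)"
      using V by (intro sum_mono) auto
    also have "\<dots> = (\<Sum>i<N. \<Sum>j<M i. \<bar>f (q i j) - f (p i j)\<bar>) + real N * \<eta>"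
      by (simp add: sum.distrib)
    also have "real N * \<eta> \<le> \<epsilon> / 2"
      using \<open>\<epsilon> > 0\<close> by (simp add: \<eta>_def field_simps)
    finally show "(\<Sum>i<N. \<bar>variation f (v i) - variation f (u i)\<bar>) < \<epsilon>" using s by linarith
  qed (use \<delta>(1) in simp)
qed

lemma abs_continuous_on_diff:
  assumes "abs_continuous_on a b f" "abs_continuous_on a b g"
  shows "abs_continuous_on a b (\<lambda>x. f x - g x)"
  unfolding abs_continuous_on_iff
proof (intro allI impI)
  fix \<epsilon> :: real assume "\<epsilon> > 0"
  then have e: "\<epsilon> / 2 > 0" by simp
  obtain d1 where d1: "d1 > 0" "\<forall>(N::nat) u v. nonoverlapping {..<N} u v a b \<longrightarrow>
     (\<Sum>i<N. v i - u i) < d1 \<longrightarrow> (\<Sum>i<N. \<bar>f (v i) - f (u i)\<bar>) < \<epsilon> / 2"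
    by (rule abs_continuous_onE[OF assms(1) e]) (rule that)
  obtain d2 where d2: "d2 > 0" "\<forall>(N::nat) u v. nonoverlapping {..<N} u v a b \<longrightarrow>
     (\<Sum>i<N. v i - u i) < d2 \<longrightarrow> (\<Sum>i<N. \<bar>g (v i) - g (u i)\<bar>) < \<epsilon> / 2"
    by (rule abs_continuous_onE[OF assms(2) e]) (rule that)
  show "\<exists>\<delta>>0. \<forall>(N::nat) u v. nonoverlapping {..<N} u v a b \<longrightarrow>
     (\<Sum>i<N. v i - u i) < \<delta> \<longrightarrow> (\<Sum>i<N. \<bar>(f (v i) - g (v i)) - (f (u i) - g (u i))\<bar>) < \<epsilon>"
  proof (intro exI[of _ "min d1 d2"] conjI allI impI)
    fix N :: nat and u v assume uv: "nonoverlapping {..<N} u v a b" "(\<Sum>i<N. v i - u i) < min d1 d2"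
    have "(\<Sum>i<N. \<bar>(f (v i) - g (v i)) - (f (u i) - g (u i))\<bar>) \<le>
      (\<Sum>i<N. \<bar>f (v i) - f (u i)\<bar>) + (\<Sum>i<N. \<bar>g (v i) - g (u i)\<bar>)"
      unfolding sum.distrib[symmetric] by (intro sum_mono) linarith
    then show "(\<Sum>i<N. \<bar>(f (v i) - g (v i)) - (f (u i) - g (u i))\<bar>) < \<epsilon>"
      using d1(2)[rule_format, OF uv(1)] d2(2)[rule_format, OF uv(1)] uv(2) by simp
  qed (use d1(1) d2(1) in simp)
qed

lemma abs_continuous_on_imp_continuous_on:
  assumes ac: "\<And>T. T > 0 \<Longrightarrow> abs_continuous_on 0 T f"
  shows "continuous_on {0..} f"
  unfolding continuous_on_iff
proof (intro ballI allI impI)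
  fix t e :: real assume t: "t \<in> {0..}" and e: "e > 0"
  have "abs_continuous_on 0 (t + 1) f" using t by (intro ac) auto
  from abs_continuous_onE[OF this e] obtain \<delta> where \<delta>: "\<delta> > 0"
    "\<forall>(N::nat) u v. nonoverlapping {..<N} u v 0 (t + 1) \<longrightarrow>
     (\<Sum>i<N. v i - u i) < \<delta> \<longrightarrow> (\<Sum>i<N. \<bar>f (v i) - f (u i)\<bar>) < e" .
  show "\<exists>d>0. \<forall>s\<in>{0..}. dist s t < d \<longrightarrow> dist (f s) (f t) < e"
  proof (intro exI[of _ "min \<delta> 1"] conjI ballI impI)
    fix s assume s: "s \<in> {0..}" "dist s t < min \<delta> 1"
    have "nonoverlapping {..<1::nat} (\<lambda>_. min s t) (\<lambda>_. max s t) 0 (t + 1)"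
      unfolding nonoverlapping_def using s t by (simp add: dist_real_def; linarith)
    moreover have "(\<Sum>i<1::nat. max s t - min s t) < \<delta>"
      using s(2) by (simp add: dist_real_def; linarith)
    ultimately have "(\<Sum>i<1::nat. \<bar>f (max s t) - f (min s t)\<bar>) < e"
      by (rule \<delta>(2)[rule_format])
    then show "dist (f s) (f t) < e"
      by (cases "s \<le> t") (simp_all add: dist_real_def abs_minus_commute)
  qed (use \<delta>(1) in simp)
qed

text \<open>The dyadic intervals of order \<open>n\<close> contained in an open set exhaust it, which lets absolute
  continuity, a statement on finitely many intervals, control the Stieltjes measure of the set.\<close>

lemma emeasure_interval_measure_le_AC:
  fixes F :: "real \<Rightarrow> real"
  assumes mono: "\<And>x y. x \<le> y \<Longrightarrow> F x \<le> F y" and cont: "continuous_on UNIV F"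
    and ac: "\<forall>(N::nat) u v. nonoverlapping {..<N} u v 0 T \<longrightarrow>
     (\<Sum>i<N. v i - u i) < \<delta> \<longrightarrow> (\<Sum>i<N. \<bar>F (v i) - F (u i)\<bar>) < \<epsilon>"
    and U: "open U" "U \<subseteq> {0<..<T}" "emeasure lborel U < ennreal \<delta>"
  shows "emeasure (interval_measure F) U \<le> ennreal \<epsilon>"
proof -
  let ?\<mu> = "interval_measure F"
  have rc: "continuous (at_right a) F" for a
    using cont continuous_on_eq_continuous_at[of UNIV F] continuous_at_imp_continuous_at_within by blast
  \<comment> \<open>Open on the left and closed on the right: at each order \<open>n\<close> these
    sets partition the line, and the index of the one containing \<open>x\<close> is a
    ceiling.\<close>
  define D where "D n k = {(real_of_int k - 1) / 2^n<..real_of_int k / 2^n}" for n :: nat and k :: int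
  have [measurable, simp]: "D n k \<in> sets borel" for n k unfolding D_def by simp
  have inD: "x \<in> D n k \<longleftrightarrow> \<lceil>x * 2^n\<rceil> = k" for x n k
    by (simp add: D_def ceiling_eq_iff pos_divide_less_eq pos_le_divide_eq)
  define K where "K n = {k. D n k \<subseteq> U}" for n
  define A where "A n = (\<Union>k\<in>K n. D n k)" for n
  have K: "1 \<le> k" "real_of_int k / 2^n < T" if "k \<in> K n" for k n
  proof -
    have "real_of_int k / 2^n \<in> D n k" by (simp add: D_def divide_strict_right_mono)
    then have "real_of_int k / 2^n \<in> {0<..<T}" using that U(2) unfolding K_def by blast
    then show "1 \<le> k" "real_of_int k / 2^n < T" by (auto simp: zero_less_divide_iff)
  qed
  have finK: "finite (K n)" for n
  proof (rule finite_subset)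
    show "K n \<subseteq> {1..\<lceil>T * 2^n\<rceil>}"
    proof
      fix k assume "k \<in> K n"
      from K[OF this] have "1 \<le> k" "real_of_int k < T * 2^n" by (simp_all add: pos_divide_less_eq)
      then show "k \<in> {1..\<lceil>T * 2^n\<rceil>}" by (simp add: le_ceiling_iff)
    qed
  qed simp
  have AU: "A n \<subseteq> U" for n by (auto simp: A_def K_def)
  have le: "emeasure ?\<mu> (A n) \<le> ennreal \<epsilon>" for n
  proof -
    let ?u = "\<lambda>k. (real_of_int k - 1) / 2^n" and ?v = "\<lambda>k. real_of_int k / 2^n"
    have dis: "disjoint_family_on (D n) (K n)"
      unfolding disjoint_family_on_def disjoint_iff inD by auto
    have non: "nonoverlapping (K n) ?u ?v 0 T"
      unfolding nonoverlapping_def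
    proof (intro conjI ballI impI)
      fix i j assume "i \<in> K n" "j \<in> K n" "i \<noteq> j"
      then have "D n i \<inter> D n j = {}" using dis unfolding disjoint_family_on_def by blast
      moreover have "{?u k<..<?v k} \<subseteq> D n k" for k unfolding D_def by auto
      ultimately show "{?u i<..<?v i} \<inter> {?u j<..<?v j} = {}" by blast
    next
      fix i assume "i \<in> K n"
      from K[OF this] show "0 \<le> ?u i" "?v i \<le> T" by simp_all
      show "?u i \<le> ?v i" by (simp add: divide_right_mono)
    qed (rule finK)
    have uv: "?u k \<le> ?v k" for k by (simp add: divide_right_mono)
    have "ennreal (\<Sum>k\<in>K n. ?v k - ?u k) = (\<Sum>k\<in>K n. ennreal (?v k - ?u k))"
      using uv by (intro sum_ennreal[symmetric]) auto
    also have "\<dots> = (\<Sum>k\<in>K n. emeasure lborel (D n k))"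
      using uv by (intro sum.cong) (auto simp: D_def)
    also have "\<dots> = emeasure lborel (A n)"
      unfolding A_def using dis finK by (intro sum_emeasure) auto
    also have "\<dots> \<le> emeasure lborel U" using AU U(1) by (intro emeasure_mono) auto
    also note U(3)
    finally have "(\<Sum>k\<in>K n. ?v k - ?u k) < \<delta>"
      using uv by (subst (asm) ennreal_less_iff) (auto intro!: sum_nonneg)
    from nonoverlapping_finite_less[OF ac non this] have s: "(\<Sum>k\<in>K n. \<bar>F (?v k) - F (?u k)\<bar>) < \<epsilon>" .
    have "emeasure ?\<mu> (A n) = (\<Sum>k\<in>K n. emeasure ?\<mu> (D n k))"
      unfolding A_def using dis finK by (intro sum_emeasure[symmetric]) auto
    also have "\<dots> = (\<Sum>k\<in>K n. ennreal \<bar>F (?v k) - F (?u k)\<bar>)"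
      unfolding D_def using uv mono by (intro sum.cong refl, subst emeasure_interval_measure_Ioc[OF _ mono rc]) (auto simp: abs_of_nonneg)
    also have "\<dots> = ennreal (\<Sum>k\<in>K n. \<bar>F (?v k) - F (?u k)\<bar>)"
      by (intro sum_ennreal) auto
    also have "\<dots> \<le> ennreal \<epsilon>" using s by (intro ennreal_leI) simp
    finally show ?thesis .
  qed
  have inA: "x \<in> A n \<longleftrightarrow> D n \<lceil>x * 2^n\<rceil> \<subseteq> U" for x n
    using inD by (auto simp: A_def K_def)
  have "incseq A"
  proof (rule incseq_SucI, rule subsetI)
    fix n x assume x: "x \<in> A n"
    have "D (Suc n) \<lceil>x * 2^Suc n\<rceil> \<subseteq> D n \<lceil>x * 2^n\<rceil>"
    proof
      fix y assume "y \<in> D (Suc n) \<lceil>x * 2^Suc n\<rceil>"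
      then have *: "\<lceil>2 * (y * 2^n)\<rceil> = \<lceil>2 * (x * 2^n)\<rceil>" by (simp add: inD mult_ac)
      \<comment> \<open>The index at order \<open>Suc n\<close> determines the index at order
        \<open>n\<close>; this is the nesting of dyadic intervals.\<close>
      have half: "\<lceil>z\<rceil> = (\<lceil>2 * z\<rceil> + 1) div 2" for z :: real by linarith
      show "y \<in> D n \<lceil>x * 2^n\<rceil>" unfolding inD half[of "y * 2^n"] half[of "x * 2^n"] * by simp
    qed
    then show "x \<in> A (Suc n)" using x unfolding inA by blast
  qed
  moreover have "(\<Union>n. A n) = U"
  proof (intro equalityI subsetI)
    fix x assume "x \<in> U"
    then obtain e where e: "e > 0" "ball x e \<subseteq> U" using U(1) openE by blast
    obtain n where n: "(1/2::real)^n < e" using real_arch_pow_inv[of e "1/2"] e by auto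
    have "D n \<lceil>x * 2^n\<rceil> \<subseteq> ball x e"
    proof
      fix y assume "y \<in> D n \<lceil>x * 2^n\<rceil>"
      then have "\<lceil>y * 2^n\<rceil> = \<lceil>x * 2^n\<rceil>" by (simp add: inD)
      then have "\<bar>x * 2^n - y * 2^n\<bar> < 1" by linarith
      then have "\<bar>x - y\<bar> * 2^n < 1" by (simp add: abs_mult left_diff_distrib[symmetric])
      then have "\<bar>x - y\<bar> < (1/2)^n" by (simp add: field_simps power_one_over)
      then show "y \<in> ball x e" using n by (simp add: dist_real_def)
    qed
    then have "x \<in> A n" using e(2) unfolding inA by (rule subset_trans)
    then show "x \<in> (\<Union>n. A n)" by blast
  next
    fix x assume "x \<in> (\<Union>n. A n)"
    then obtain n where "x \<in> A n" by blast
    then show "x \<in> U" using AU[of n] by (rule subsetD[rotated])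
  qed
  moreover have "range A \<subseteq> sets ?\<mu>"
    using finK by (auto simp: A_def intro!: sets.finite_UN)
  ultimately have "(\<lambda>n. emeasure ?\<mu> (A n)) \<longlonglongrightarrow> emeasure ?\<mu> U"
    using Lim_emeasure_incseq[of A ?\<mu>] by simp
  then show ?thesis by (rule LIMSEQ_le_const2) (use le in blast)
qed

lemma abs_continuous_on_cong:
  assumes ac: "abs_continuous_on a b f" and eq: "\<And>t. a \<le> t \<Longrightarrow> t \<le> b \<Longrightarrow> f t = g t"
  shows "abs_continuous_on a b g"
  unfolding abs_continuous_on_iff
proof (intro allI impI)
  fix \<epsilon> :: real assume "\<epsilon> > 0"
  from abs_continuous_onE[OF ac this] obtain \<delta> where \<delta>: "\<delta> > 0"
    "\<forall>(N::nat) u v. nonoverlapping {..<N} u v a b \<longrightarrow>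
     (\<Sum>i<N. v i - u i) < \<delta> \<longrightarrow> (\<Sum>i<N. \<bar>f (v i) - f (u i)\<bar>) < \<epsilon>" .
  show "\<exists>\<delta>>0. \<forall>(N::nat) u v. nonoverlapping {..<N} u v a b \<longrightarrow>
     (\<Sum>i<N. v i - u i) < \<delta> \<longrightarrow> (\<Sum>i<N. \<bar>g (v i) - g (u i)\<bar>) < \<epsilon>"
  proof (intro exI[of _ \<delta>] conjI allI impI)
    fix N :: nat and u v
    assume uv: "nonoverlapping {..<N} u v a b" "(\<Sum>i<N. v i - u i) < \<delta>"
    have "(\<Sum>i<N. \<bar>g (v i) - g (u i)\<bar>) = (\<Sum>i<N. \<bar>f (v i) - f (u i)\<bar>)"
    proof (rule sum.cong[OF refl])
      fix i assume "i \<in> {..<N}"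
      then have "a \<le> u i" "u i \<le> v i" "v i \<le> b" using uv(1) by (simp_all add: nonoverlapping_def)
      then show "\<bar>g (v i) - g (u i)\<bar> = \<bar>f (v i) - f (u i)\<bar>" using eq[of "u i"] eq[of "v i"] by simp
    qed
    with \<delta>(2)[rule_format, OF uv] show "(\<Sum>i<N. \<bar>g (v i) - g (u i)\<bar>) < \<epsilon>" by simp
  qed (rule \<delta>(1))
qed

text \<open>Radon-Nikodym for the Stieltjes measure of \<open>G\<close>. Lebesgue null sets are null
  for it: by outer regularity such a set lies in an open set of small Lebesgue measure, and absolute
  continuity makes the Stieltjes measure of that open set small as well.\<close>

lemma mono_abs_continuous_representation:
  assumes mono: "\<And>s t. 0 \<le> s \<Longrightarrow> s \<le> t \<Longrightarrow> G s \<le> G t"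
    and ac: "\<And>T. T > 0 \<Longrightarrow> abs_continuous_on 0 T G"
  shows "\<exists>h. causal_L1 h \<and> (\<forall>t\<ge>0. G t = G 0 + frac_int 1 h t)"
proof -
  \<comment> \<open>With constant continuation to the left, the Stieltjes measure charges only the
    positive half-line.\<close>
  define F where "F t = G (max 0 t)" for t
  have FG: "F t = G t" if "t \<ge> 0" for t using that by (simp add: F_def)
  have monoF: "F x \<le> F y" if "x \<le> y" for x y unfolding F_def using that by (intro mono) auto
  have contF: "continuous_on UNIV F" unfolding F_def[abs_def]
    by (rule continuous_on_compose2[OF abs_continuous_on_imp_continuous_on[OF ac]]) (auto intro!: continuous_intros)
  have acF: "abs_continuous_on 0 T F" if "T > 0" for T
    by (rule abs_continuous_on_cong[OF ac[OF that]]) (simp add: F_def)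
  have rc: "continuous (at_right a) F" for a
    using contF continuous_on_eq_continuous_at[of UNIV F] continuous_at_imp_continuous_at_within by blast
  let ?\<mu> = "interval_measure F"
  note Ioc = emeasure_interval_measure_Ioc[OF _ monoF rc]
  have null_pos: "emeasure ?\<mu> (N \<inter> {0<..<real n}) = 0" if N: "N \<in> null_sets lborel" for N n
  proof (cases "n = 0")
    case False
    have *: "emeasure ?\<mu> (N \<inter> {0<..<real n}) \<le> ennreal \<epsilon>" if "\<epsilon> > 0" for \<epsilon>
    proof -
      from False have "real n > 0" by simp
      from abs_continuous_onE[OF acF[OF this] that] obtain \<delta> where \<delta>: "\<delta> > 0"
        "\<forall>(N::nat) u v. nonoverlapping {..<N} u v 0 (real n) \<longrightarrow>
         (\<Sum>i<N. v i - u i) < \<delta> \<longrightarrow> (\<Sum>i<N. \<bar>F (v i) - F (u i)\<bar>) < \<epsilon>" .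
      have "N \<in> sets borel" using N by auto
      from outer_regular_lborel[OF this \<delta>(1)] obtain U where U: "open U" "N \<subseteq> U" "emeasure lborel (U - N) < ennreal \<delta>" .
      have "emeasure lborel U \<le> emeasure lborel (U - N) + emeasure lborel N"
        using U N by (intro order_trans[OF emeasure_mono emeasure_subadditive]) auto
      also have "\<dots> = emeasure lborel (U - N)" using N by (simp add: null_setsD1)
      finally have U': "emeasure lborel U < ennreal \<delta>" using U(3) by (rule le_less_trans)
      have "emeasure lborel (U \<inter> {0<..<real n}) \<le> emeasure lborel U"
        using U(1) by (intro emeasure_mono) auto
      from le_less_trans[OF this U'] have "emeasure ?\<mu> (U \<inter> {0<..<real n}) \<le> ennreal \<epsilon>"
        using U(1) by (intro emeasure_interval_measure_le_AC[OF monoF contF \<delta>(2)]) auto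
      moreover have "emeasure ?\<mu> (N \<inter> {0<..<real n}) \<le> emeasure ?\<mu> (U \<inter> {0<..<real n})"
        using U(1,2) by (intro emeasure_mono) auto
      ultimately show ?thesis by (rule order_trans[rotated])
    qed
    have "emeasure ?\<mu> (N \<inter> {0<..<real n}) \<le> 0"
    proof (rule ennreal_le_epsilon)
      fix e :: real assume "e > 0"
      from *[OF this] show "emeasure ?\<mu> (N \<inter> {0<..<real n}) \<le> 0 + ennreal e"
        by (simp only: add_0)
    qed
    then show ?thesis by (simp only: le_zero_eq)
  qed simp
  have "emeasure ?\<mu> {- real n<..0} = 0" for n :: nat
    using Ioc[of "- real n" 0] by (simp add: F_def)
  then have nonpos: "(\<Union>n. {- real n<..0}) \<in> null_sets ?\<mu>"
    by (intro null_sets_UN) (auto simp: null_sets_def)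
  have "absolutely_continuous lborel ?\<mu>"
    unfolding absolutely_continuous_def
  proof
    fix N :: "real set" assume N: "N \<in> null_sets lborel"
    then have [measurable]: "N \<in> sets borel" by auto
    have "(\<Union>n. N \<inter> {0<..<real n}) \<in> null_sets ?\<mu>"
      using null_pos[OF N] by (intro null_sets_UN) (auto simp: null_sets_def)
    with nonpos have "(\<Union>n. {- real n<..0}) \<union> (\<Union>n. N \<inter> {0<..<real n}) \<in> null_sets ?\<mu>"
      by (rule null_sets.Un)
    moreover have "N \<subseteq> (\<Union>n. {- real n<..0}) \<union> (\<Union>n. N \<inter> {0<..<real n})"
    proof
      fix x assume x: "x \<in> N"
      obtain n where "\<bar>x\<bar> < real n" using reals_Archimedean2 by blast
      with x show "x \<in> (\<Union>n. {- real n<..0}) \<union> (\<Union>n. N \<inter> {0<..<real n})"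
        by (cases "x > 0") (auto intro!: exI[of _ n])
    qed
    ultimately show "N \<in> null_sets ?\<mu>" by (intro null_sets_subset[where A = N]) simp_all
  qed
  then obtain f where f [measurable]: "f \<in> borel_measurable borel" and dens: "density lborel f = ?\<mu>"
    using sigma_finite_measure.Radon_Nikodym[OF lborel.sigma_finite_measure_axioms, of ?\<mu>] by auto
  \<comment> \<open>The integral of the density over each \<open>{0<..t}\<close> is the finite
    number \<open>G t - G 0\<close>, so on the positive half-line the density is infinite on a null
    set only, and \<open>enn2real\<close> loses nothing.\<close>
  define h where "h s = (if s > 0 then enn2real (f s) else 0)" for s
  have [measurable]: "h \<in> borel_measurable borel" unfolding h_def[abs_def] by measurable
  have hb: "has_bochner_integral lborel (\<lambda>s. frac_kernel 1 (t - s) * h s) (G t - G 0)" if t: "t \<ge> 0" for t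
  proof (rule has_bochner_integral_nn_integral)
    have "(\<integral>\<^sup>+s. f s * indicator {0<..t} s \<partial>lborel) = emeasure ?\<mu> {0<..t}"
      by (simp flip: dens add: emeasure_density)
    also have "\<dots> = ennreal (G t - G 0)" using Ioc[OF t] t by (simp add: F_def)
    finally have I: "(\<integral>\<^sup>+s. f s * indicator {0<..t} s \<partial>lborel) = ennreal (G t - G 0)" .
    then have fin: "AE s in lborel. f s * indicator {0<..t} s \<noteq> \<infinity>"
      by (intro nn_integral_PInf_AE) auto
    have "(\<integral>\<^sup>+s. ennreal (frac_kernel 1 (t - s) * h s) \<partial>lborel) = (\<integral>\<^sup>+s. f s * indicator {0<..t} s \<partial>lborel)"
      using fin AE_lborel_singleton[of t]
      by (intro nn_integral_cong_AE, eventually_elim)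
        (auto simp: h_def indicator_def ennreal_enn2real_if)
    then show "(\<integral>\<^sup>+s. ennreal (frac_kernel 1 (t - s) * h s) \<partial>lborel) = ennreal (G t - G 0)" using I by simp
  qed (use mono[of 0 t] t in \<open>auto simp: h_def\<close>)
  have "causal_L1 h"
    unfolding causal_L1_def
  proof (intro conjI allI impI)
    fix t show "frac_integrable 1 h t"
    proof (cases "t \<ge> 0")
      case True
      then show ?thesis using hb[OF True] by (simp add: frac_integrable_def has_bochner_integral_iff)
    next
      case False
      then have "(\<lambda>s. frac_kernel 1 (t - s) * h s) = (\<lambda>s. 0)" by (auto simp: h_def)
      then show ?thesis by (simp add: frac_integrable_def)
    qed
  qed (auto simp: h_def)
  moreover have "G t = G 0 + frac_int 1 h t" if "t \<ge> 0" for t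
    using hb[OF that] by (simp add: frac_int_def has_bochner_integral_iff)
  ultimately show ?thesis by blast
qed

text \<open>Jordan decomposition: \<open>f\<close> is the variation minus the difference of
  variation and \<open>f\<close>. Both are monotone and absolutely continuous, and their densities
  are subtracted.\<close>

theorem abs_continuous_representation:
  assumes ac: "\<And>T. T > 0 \<Longrightarrow> abs_continuous_on 0 T f"
  obtains h where "causal_L1 h" "\<And>t. t \<ge> 0 \<Longrightarrow> f t = f 0 + frac_int 1 h t"
proof -
  let ?V = "variation f" and ?W = "\<lambda>t. variation f t - f t"
  have acV: "abs_continuous_on 0 T ?V" for T by (rule abs_continuous_on_variation[OF ac])
  have "\<exists>h. causal_L1 h \<and> (\<forall>t\<ge>0. ?V t = ?V 0 + frac_int 1 h t)"
  proof (rule mono_abs_continuous_representation[OF _ acV])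
    fix s t :: real assume "0 \<le> s" "s \<le> t"
    from abs_diff_le_variation[OF ac this] show "?V s \<le> ?V t" by linarith
  qed
  then obtain h1 where h1: "causal_L1 h1" "\<And>t. t \<ge> 0 \<Longrightarrow> ?V t = ?V 0 + frac_int 1 h1 t" by blast
  have "\<exists>h. causal_L1 h \<and> (\<forall>t\<ge>0. ?W t = ?W 0 + frac_int 1 h t)"
  proof (rule mono_abs_continuous_representation[OF _ abs_continuous_on_diff[OF acV ac]])
    fix s t :: real assume "0 \<le> s" "s \<le> t"
    from abs_diff_le_variation[OF ac this] show "?W s \<le> ?W t" by linarith
  qed
  then obtain h2 where h2: "causal_L1 h2" "\<And>t. t \<ge> 0 \<Longrightarrow> ?W t = ?W 0 + frac_int 1 h2 t" by blast
  show thesis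
  proof
    show "causal_L1 (\<lambda>s. h1 s + (-1) * h2 s)"
      by (intro causal_L1_add causal_L1_cmult h1 h2)
    fix t :: real assume t: "t \<ge> 0"
    have "frac_int 1 (\<lambda>s. h1 s + (-1) * h2 s) t = frac_int 1 h1 t + (-1) * frac_int 1 h2 t"
      unfolding frac_int_cmult[symmetric] using h1(1) h2(1)
      by (intro frac_int_add frac_integrable_cmult causal_L1D(3)) auto
    then show "f t = f 0 + frac_int 1 (\<lambda>s. h1 s + (-1) * h2 s) t" using h1(2)[OF t] h2(2)[OF t] by simp
  qed
qed


section \<open>Primitives of locally integrable functions\<close>

lemma frac_int_1_diff:
  assumes "causal_L1 h" "u \<le> v"
  shows "integrable lborel (\<lambda>s. indicator {u<..<v} s * h s)"
    and "frac_int 1 h v - frac_int 1 h u = (\<integral>s. indicator {u<..<v} s * h s \<partial>lborel)"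
proof -
  note [measurable] = causal_L1D(1)[OF assms(1)]
  have i: "integrable lborel (\<lambda>s. frac_kernel 1 (t - s) * h s)" for t
    using causal_L1D(3)[OF assms(1), of 1 t] by (simp add: frac_integrable_def)
  have e: "frac_kernel 1 (v - s) * h s - frac_kernel 1 (u - s) * h s = indicator {u..<v} s * h s" for s
    using assms(2) by (auto simp: indicator_def)
  have d: "integrable lborel (\<lambda>s. indicator {u..<v} s * h s)"
    using Bochner_Integration.integrable_diff[OF i[of v] i[of u]] unfolding e .
  have ae: "AE s in lborel. indicator {u..<v} s * h s = indicator {u<..<v} s * h s"
    using AE_lborel_singleton[of u] by eventually_elim (auto simp: indicator_def)
  show "integrable lborel (\<lambda>s. indicator {u<..<v} s * h s)"
    using d by (subst integrable_cong_AE[OF _ _ ae, symmetric]) measurable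
  have "frac_int 1 h v - frac_int 1 h u = (\<integral>s. indicator {u..<v} s * h s \<partial>lborel)"
    unfolding frac_int_def Bochner_Integration.integral_diff[OF i i, symmetric] e ..
  also have "\<dots> = (\<integral>s. indicator {u<..<v} s * h s \<partial>lborel)"
    by (rule integral_cong_AE[OF _ _ ae]) measurable
  finally show "frac_int 1 h v - frac_int 1 h u = (\<integral>s. indicator {u<..<v} s * h s \<partial>lborel)" .
qed

lemma causal_L1_abs: "causal_L1 h \<Longrightarrow> causal_L1 (\<lambda>s. \<bar>h s\<bar>)"
proof -
  assume h: "causal_L1 h"
  have "frac_integrable 1 (\<lambda>s. \<bar>h s\<bar>) t" for t
    using integrable_abs[of lborel "\<lambda>r. frac_kernel 1 (t - r) * h r"] causal_L1D(3)[OF h, of 1 t]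
    by (simp add: frac_integrable_def abs_mult del: frac_kernel_1)
  with causal_L1D(1,2)[OF h] show ?thesis by (auto simp: causal_L1_def)
qed

text \<open>Uniform integrability by truncation. Below \<open>T\<close>,
  \<open>\<bar>h\<bar> \<le> r + n\<close>, where the excess \<open>r\<close> over a high level
  \<open>n\<close> has integral less than \<open>\<epsilon> / 2\<close> by dominated convergence,
  and the bounded part costs at most \<open>n\<close> times the total length.\<close>

lemma abs_continuous_on_frac_int:
  assumes h: "causal_L1 h"
  shows "abs_continuous_on 0 T (frac_int 1 h)"
  unfolding abs_continuous_on_iff
proof (intro allI impI)
  fix \<epsilon> :: real assume \<epsilon>: "\<epsilon> > 0"
  define g where "g s = frac_kernel 1 (T - s) * \<bar>h s\<bar>" for s
  have g: "integrable lborel g"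
    using causal_L1D(3)[OF causal_L1_abs[OF h], of 1 T] by (simp add: frac_integrable_def g_def[abs_def])
  have gnn: "g s \<ge> 0" for s by (simp add: g_def)
  have "(\<lambda>n. \<integral>s. max (g s - real n) 0 \<partial>lborel) \<longlonglongrightarrow> (\<integral>s. 0 \<partial>(lborel :: real measure))"
  proof (rule integral_dominated_convergence[where w = g])
    show "AE s in lborel. (\<lambda>n. max (g s - real n) 0) \<longlonglongrightarrow> 0"
    proof (rule AE_I2, rule tendsto_eventually)
      fix s
      obtain n0 where "g s \<le> real n0" using real_arch_simple by blast
      then show "\<forall>\<^sub>F n in sequentially. max (g s - real n) 0 = 0"
        by (intro eventually_sequentiallyI[of n0]) simp
    qed
    show "AE s in lborel. norm (max (g s - real n) 0) \<le> g s" for n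
      using gnn by (intro AE_I2) auto
  qed (use g in \<open>auto intro: borel_measurable_integrable\<close>)
  then have "(\<lambda>n. \<integral>s. max (g s - real n) 0 \<partial>lborel) \<longlonglongrightarrow> 0" by simp
  then have "\<forall>\<^sub>F n in sequentially. (\<integral>s. max (g s - real n) 0 \<partial>lborel) < \<epsilon> / 2"
    using \<epsilon> by (intro order_tendstoD) auto
  then obtain n where n: "(\<integral>s. max (g s - real n) 0 \<partial>lborel) < \<epsilon> / 2"
    by (meson eventually_sequentially order_refl)
  define r where "r s = max (g s - real n) 0" for s
  have r: "integrable lborel r"
    unfolding r_def[abs_def]
    by (rule Bochner_Integration.integrable_bound[OF g]) (use gnn g in \<open>auto intro: borel_measurable_integrable\<close>)
  \<comment> \<open>Keeps \<open>n * \<delta>\<close> at most \<open>\<epsilon> / 2\<close>; the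
    summand 1 covers \<open>n = 0\<close>.\<close>
  define \<delta> where "\<delta> = \<epsilon> / (2 * (real n + 1))"
  show "\<exists>\<delta>>0. \<forall>(N::nat) u v. nonoverlapping {..<N} u v 0 T \<longrightarrow>
     (\<Sum>i<N. v i - u i) < \<delta> \<longrightarrow> (\<Sum>i<N. \<bar>frac_int 1 h (v i) - frac_int 1 h (u i)\<bar>) < \<epsilon>"
  proof (intro exI[of _ \<delta>] conjI allI impI)
    fix N :: nat and u v
    assume uv: "nonoverlapping {..<N} u v 0 T" "(\<Sum>i<N. v i - u i) < \<delta>"
    define I where "I i = {u i<..<v i}" for i
    have [measurable]: "I i \<in> sets borel" for i by (simp add: I_def)
    have ri: "integrable lborel (\<lambda>s. indicator (I i) s * r s)" for i
      using integrable_mult_indicator[OF _ r, of "I i"] by simp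
    have le: "\<bar>frac_int 1 h (v i) - frac_int 1 h (u i)\<bar> \<le> (\<integral>s. indicator (I i) s * r s \<partial>lborel) + real n * (v i - u i)"
      if "i < N" for i
    proof -
      have i: "u i \<le> v i" "v i \<le> T" using uv(1) that by (auto simp: nonoverlapping_def)
      have ci: "integrable lborel (\<lambda>s. indicator (I i) s * real n)"
        using i by (intro integrable_mult_left) (auto simp: I_def)
      have "\<bar>frac_int 1 h (v i) - frac_int 1 h (u i)\<bar> = \<bar>\<integral>s. indicator (I i) s * h s \<partial>lborel\<bar>"
        using frac_int_1_diff(2)[OF h i(1)] by (simp add: I_def)
      also have "\<dots> \<le> (\<integral>s. \<bar>indicator (I i) s * h s\<bar> \<partial>lborel)" by (rule integral_abs_bound)
      also have "\<dots> \<le> (\<integral>s. indicator (I i) s * r s + indicator (I i) s * real n \<partial>lborel)"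
      proof (rule integral_mono)
        show "integrable lborel (\<lambda>s. \<bar>indicator (I i) s * h s\<bar>)"
          using frac_int_1_diff(1)[OF h i(1)] by (intro integrable_abs) (simp add: I_def)
        show "integrable lborel (\<lambda>s. indicator (I i) s * r s + indicator (I i) s * real n)"
          by (intro Bochner_Integration.integrable_add ri ci)
        show "\<bar>indicator (I i) s * h s\<bar> \<le> indicator (I i) s * r s + indicator (I i) s * real n" for s
          using i by (auto simp: I_def r_def g_def indicator_def)
      qed
      also have "\<dots> = (\<integral>s. indicator (I i) s * r s \<partial>lborel) + real n * (v i - u i)"
        using i by (simp add: Bochner_Integration.integral_add[OF ri ci]) (simp add: I_def mult.commute)
      finally show ?thesis .
    qed
    have dis: "disjoint_family_on I {..<N}"
      using nonoverlapping_disjoint[OF uv(1)] by (simp add: disjoint_family_on_def I_def)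
    have "(\<Sum>i<N. \<bar>frac_int 1 h (v i) - frac_int 1 h (u i)\<bar>) \<le>
        (\<Sum>i<N. (\<integral>s. indicator (I i) s * r s \<partial>lborel) + real n * (v i - u i))"
      by (intro sum_mono le) simp
    also have "\<dots> = (\<integral>s. (\<Sum>i<N. indicator (I i) s * r s) \<partial>lborel) + real n * (\<Sum>i<N. v i - u i)"
      by (simp only: sum.distrib sum_distrib_left Bochner_Integration.integral_sum[OF ri])
    also have "(\<integral>s. (\<Sum>i<N. indicator (I i) s * r s) \<partial>lborel) \<le> (\<integral>s. r s \<partial>lborel)"
    proof (rule integral_mono[OF _ r])
      show "integrable lborel (\<lambda>s. \<Sum>i<N. indicator (I i) s * r s)"
        by (intro Bochner_Integration.integrable_sum ri)
      fix s
      have "(\<Sum>i<N. indicator (I i) s * r s) = indicator (\<Union>i<N. I i) s * r s"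
        by (simp add: sum_distrib_right[symmetric] indicator_UN_disjoint[OF _ dis])
      also have "\<dots> \<le> r s" by (simp add: indicator_def r_def)
      finally show "(\<Sum>i<N. indicator (I i) s * r s) \<le> r s" .
    qed
    also have "(\<integral>s. r s \<partial>lborel) < \<epsilon> / 2" using n by (simp add: r_def)
    also have "real n * (\<Sum>i<N. v i - u i) \<le> real n * \<delta>" using uv(2) by (intro mult_left_mono) auto
    also have "real n * \<delta> \<le> \<epsilon> / 2" using \<epsilon> by (simp add: \<delta>_def field_simps)
    finally show "(\<Sum>i<N. \<bar>frac_int 1 h (v i) - frac_int 1 h (u i)\<bar>) < \<epsilon>" by simp
  qed (use \<epsilon> in \<open>simp add: \<delta>_def\<close>)
qed

lemma has_integral_frac_int_1:
  assumes h: "causal_L1 h" and "u \<le> v"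
  shows "(h has_integral (frac_int 1 h v - frac_int 1 h u)) {u..v}"
proof -
  have "((\<lambda>s. indicator {u<..<v} s * h s) has_integral (frac_int 1 h v - frac_int 1 h u)) UNIV"
    using frac_int_1_diff[OF assms] has_integral_integral_lborel by metis
  then have "(h has_integral (frac_int 1 h v - frac_int 1 h u)) {u<..<v}"
    by (subst has_integral_restrict_UNIV[symmetric]) (simp add: indicator_def of_bool_def if_distrib[where f = "\<lambda>c. c * _"] cong: if_cong)
  then show ?thesis by (simp add: has_integral_Icc_iff_Ioo)
qed

text \<open>Lebesgue's differentiation theorem enters in a one-sided form, for intervals that start
  at the point. Applied to \<open>h\<close> at \<open>t\<close> it yields the right derivative,
  applied to the reflection of \<open>h\<close> at \<open>- t\<close> the left derivative.\<close>

lemma AE_frac_int_1_has_derivative: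
  assumes h: "causal_L1 h"
  shows "AE t in lborel. (frac_int 1 h has_real_derivative h t) (at t)"
proof -
  note hi = has_integral_frac_int_1[OF h]
  have int1: "h integrable_on cbox a b" for a b
    using hi[of a b] by (cases "a \<le> b") (auto simp: integrable_on_def)
  have hi2: "((\<lambda>s. h (- s)) has_integral (frac_int 1 h (- u) - frac_int 1 h (- v))) {u..v}" if "u \<le> v" for u v
    using hi[of "- v" "- u"] that has_integral_reflect_real[where f = h and a = "- v" and b = "- u"] by simp
  have int2: "(\<lambda>s. h (- s)) integrable_on cbox a b" for a b
    using hi2[of a b] by (cases "a \<le> b") (auto simp: integrable_on_def)
  from integrable_ccontinuous_explicit[OF int1] obtain N1 where N1: "negligible N1"
    "\<And>x e. \<lbrakk>x \<notin> N1; 0 < e\<rbrakk> \<Longrightarrow> \<exists>d>0. \<forall>k. 0 < k \<and> k < d \<longrightarrow>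
       norm (integral (cbox x (x + k *\<^sub>R One)) h /\<^sub>R k ^ DIM(real) - h x) < e"
    by blast
  from integrable_ccontinuous_explicit[OF int2] obtain N2 where N2: "negligible N2"
    "\<And>x e. \<lbrakk>x \<notin> N2; 0 < e\<rbrakk> \<Longrightarrow> \<exists>d>0. \<forall>k. 0 < k \<and> k < d \<longrightarrow>
       norm (integral (cbox x (x + k *\<^sub>R One)) (\<lambda>s. h (- s)) /\<^sub>R k ^ DIM(real) - h (- x)) < e"
    by blast
  have "(frac_int 1 h has_real_derivative h t) (at t)" if t: "t \<notin> N1" "- t \<notin> N2" for t
    unfolding DERIV_def LIM_eq
  proof (intro allI impI)
    fix e :: real assume e: "e > 0"
    obtain d1 where d1: "d1 > 0" "\<And>k. 0 < k \<and> k < d1 \<Longrightarrow> norm (integral {t..t + k} h / k - h t) < e"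
      using N1(2)[OF t(1) e] by (auto simp: field_simps)
    obtain d2 where d2: "d2 > 0" "\<And>k. 0 < k \<and> k < d2 \<Longrightarrow> norm (integral {- t..- t + k} (\<lambda>s. h (- s)) / k - h t) < e"
      using N2(2)[OF t(2) e] by (auto simp: field_simps)
    show "\<exists>s>0. \<forall>x. x \<noteq> 0 \<and> norm (x - 0) < s \<longrightarrow> norm ((frac_int 1 h (t + x) - frac_int 1 h t) / x - h t) < e"
    proof (intro exI[of _ "min d1 d2"] conjI allI impI)
      fix x :: real assume x: "x \<noteq> 0 \<and> norm (x - 0) < min d1 d2"
      show "norm ((frac_int 1 h (t + x) - frac_int 1 h t) / x - h t) < e"
      proof (cases "x > 0")
        case True
        then show ?thesis using d1(2)[of x] x hi[of t "t + x"] by (simp add: integral_unique)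
      next
        case False
        with x have "x < 0" by simp
        then have "norm ((frac_int 1 h t - frac_int 1 h (t + x)) / (- x) - h t) < e"
          using d2(2)[of "- x"] x hi2[of "- t" "- t + - x"] by (simp add: integral_unique add.commute)
        then show ?thesis by (simp add: minus_divide_left[symmetric] minus_divide_right[symmetric] diff_divide_distrib)
      qed
    qed (use d1(1) d2(1) in simp)
  qed
  note der = this
  have "AE t in lborel. t \<notin> N1 \<and> - t \<notin> N2"
  proof -
    have "negligible (uminus ` N2)"
      by (rule negligible_differentiable_image_negligible[OF _ N2(1)])
        (auto intro!: derivative_intros)
    with N1(1) have "negligible (N1 \<union> uminus ` N2)" by (rule negligible_Un)
    then have "N1 \<union> uminus ` N2 \<in> null_sets lebesgue" by (simp add: negligible_iff_null_sets)
    then have "AE t in lebesgue. t \<notin> N1 \<union> uminus ` N2" by (rule AE_not_in)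
    then have "AE t in lborel. t \<notin> N1 \<union> uminus ` N2" by (simp add: AE_completion_iff)
    then show ?thesis by eventually_elim (auto simp: image_iff)
  qed
  then show ?thesis by eventually_elim (blast intro: der)
qed

section \<open>Representation of the Caputo domain\<close>

lemma nth_deriv_Suc_shift: "nth_deriv (Suc n) f = nth_deriv n (nth_deriv 1 f)"
  by (induction n) auto

lemma at_within_nonneg_neq_bot: "t \<ge> 0 \<Longrightarrow> at t within {0::real..} \<noteq> bot"
proof -
  assume "t \<ge> 0"
  have "{0..} \<noteq> {a}" for a :: real
  proof
    assume "{0..} = {a}"
    then have "0 \<in> {a}" "1 \<in> {a}" by (metis atLeast_iff order_refl, metis atLeast_iff zero_le_one)
    then show False by simp
  qed
  with \<open>t \<ge> 0\<close> have "t islimpt {0..}" by (intro connected_imp_perfect) auto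
  then show ?thesis by (simp add: trivial_limit_within)
qed

lemma vector_derivative_nonneg_eqI:
  assumes "\<And>s. s \<ge> 0 \<Longrightarrow> f s = g s" "t \<ge> 0" "(g has_vector_derivative d) (at t within {0..})"
  shows "(f has_vector_derivative d) (at t within {0..})" "vector_derivative f (at t within {0..}) = d"
proof -
  show *: "(f has_vector_derivative d) (at t within {0..})"
    by (rule has_vector_derivative_transform[OF _ _ assms(3)]) (use assms in auto)
  show "vector_derivative f (at t within {0..}) = d"
    by (rule vector_derivative_within[OF at_within_nonneg_neq_bot *]) (rule assms)
qed

lemma continuous_on_frac_int:
  assumes "causal_L1 h" "a \<ge> 1"
  shows "continuous_on {0..} (frac_int a h)"
proof (cases "a = 1")
  case True
  then show ?thesis using abs_continuous_on_imp_continuous_on[OF abs_continuous_on_frac_int[OF assms(1)]] by simp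
next
  case False
  have "frac_int a h = frac_int 1 (frac_int (a - 1) h)"
    using frac_int_frac_int[of 1 "a - 1" h] causal_L1D(1,3)[OF assms(1)] assms(2) False by (auto simp: fun_eq_iff)
  moreover have "causal_L1 (frac_int (a - 1) h)" using assms False by (intro causal_L1_frac_int) auto
  ultimately show ?thesis
    using abs_continuous_on_imp_continuous_on[OF abs_continuous_on_frac_int] by metis
qed

lemma frac_int_1_has_vector_derivative:
  assumes w: "causal_L1 w" and c: "continuous_on {0..} w" and t: "t \<ge> 0"
  shows "(frac_int 1 w has_vector_derivative w t) (at t within {0..})"
proof -
  have e: "at t within {0..t + 1} = at t within {0..}"
    by (rule at_within_nhd[of t "{..<t+1}"]) auto
  have eq: "frac_int 1 w s = integral {0..s} w" if "s \<ge> 0" for s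
    using integral_unique[OF has_integral_frac_int_1[OF w that]] frac_int_nonpos[of w 0 1] causal_L1D(2)[OF w]
    by simp
  have "((\<lambda>s. integral {0..s} w) has_vector_derivative w t) (at t within {0..t + 1})"
    using t by (intro integral_has_vector_derivative continuous_on_subset[OF c]) auto
  then have "((\<lambda>s. integral {0..s} w) has_vector_derivative w t) (at t within {0..})"
    unfolding e .
  from vector_derivative_nonneg_eqI(1)[OF _ t this] show ?thesis using eq by blast
qed

section \<open>Taylor's formula with integral remainder\<close>

definition taylor :: "nat \<Rightarrow> (nat \<Rightarrow> real) \<Rightarrow> real \<Rightarrow> real" where
  "taylor p C t = (\<Sum>i\<le>p. C i * t ^ i / fact i)"

lemma taylor_0 [simp]: "taylor p C 0 = C 0"
  by (simp add: taylor_def sum.atMost_shift)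

lemma taylor_frac_int_has_vector_derivative:
  assumes h: "causal_L1 h" and t: "t \<ge> 0"
  shows "((\<lambda>t. taylor (Suc p) C t + frac_int (real (Suc p) + 1) h t) has_vector_derivative
           taylor p (\<lambda>i. C (Suc i)) t + frac_int (real p + 1) h t) (at t within {0..})"
proof (rule has_vector_derivative_add)
  have "((\<lambda>t. C (Suc i) * t ^ Suc i / fact (Suc i)) has_real_derivative C (Suc i) * t ^ i / fact i)
      (at t within {0..})" for i
  proof -
    have "((\<lambda>t. C (Suc i) / fact (Suc i) * t ^ Suc i) has_real_derivative
        C (Suc i) / fact (Suc i) * (real (Suc i) * t ^ i)) (at t within {0..})"
      using DERIV_cmult[OF DERIV_pow[of "Suc i" t "{0..}"], of "C (Suc i) / fact (Suc i)"]
      by (simp del: fact_Suc)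
    moreover have "C (Suc i) / fact (Suc i) * (real (Suc i) * t ^ i) = C (Suc i) * t ^ i / fact i"
      unfolding fact_Suc by (simp add: divide_simps del: of_nat_Suc)
    ultimately show ?thesis by (simp del: fact_Suc power_Suc of_nat_Suc)
  qed
  then have "((\<lambda>t. C 0 + (\<Sum>i\<le>p. C (Suc i) * t ^ Suc i / fact (Suc i))) has_real_derivative
      0 + (\<Sum>i\<le>p. C (Suc i) * t ^ i / fact i)) (at t within {0..})"
    by (intro DERIV_add DERIV_const DERIV_sum)
  then show "(taylor (Suc p) C has_vector_derivative taylor p (\<lambda>i. C (Suc i)) t) (at t within {0..})"
    by (simp add: taylor_def[abs_def] sum.atMost_Suc_shift has_real_derivative_iff_has_vector_derivative del: power_Suc fact_Suc sum.atMost_Suc)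
  have e: "frac_int (real (Suc p) + 1) h = frac_int 1 (frac_int (real p + 1) h)"
    using frac_int_frac_int[of 1 "real p + 1" h] causal_L1D(1,3)[OF h] by (auto simp: fun_eq_iff add_ac)
  show "(frac_int (real (Suc p) + 1) h has_vector_derivative frac_int (real p + 1) h t) (at t within {0..})"
    unfolding e by (intro frac_int_1_has_vector_derivative causal_L1_frac_int continuous_on_frac_int h t) auto
qed

text \<open>The Caputo domain common to all orders in \<open>p < \<alpha> \<le> p + 1\<close>,
  indexed by \<open>p\<close> to permit induction on the number of derivatives.\<close>

definition regular :: "nat \<Rightarrow> (real \<Rightarrow> real) \<Rightarrow> bool" where
  "regular p f \<longleftrightarrow> (\<forall>i<p. \<forall>t\<ge>0. nth_deriv i f differentiable (at t within {0..})) \<and>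
     (\<forall>T>0. abs_continuous_on 0 T (nth_deriv p f))"

lemma regular_Suc:
  "regular (Suc p) f \<longleftrightarrow> (\<forall>t\<ge>0. f differentiable (at t within {0..})) \<and> regular p (nth_deriv 1 f)"
  unfolding regular_def nth_deriv_Suc_shift[symmetric] All_less_Suc2 by auto

lemma abs_continuous_on_const_add:
  "abs_continuous_on a b f \<Longrightarrow> abs_continuous_on a b (\<lambda>t. c + f t)"
  by (simp add: abs_continuous_on_def)

text \<open>Induction through the derivative: given the expansion of \<open>nth_deriv 1 x\<close>,
  the function and its proposed expansion have equal derivatives on \<open>{0..}\<close> and agree
  at 0. The base case is the representation of absolutely continuous functions.\<close>

lemma regular_representation:
  assumes "regular p x"
  obtains h where "causal_L1 h"
    "\<And>t. t \<ge> 0 \<Longrightarrow> x t = taylor p (\<lambda>i. nth_deriv i x 0) t + frac_int (real p + 1) h t"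
proof -
  have "\<exists>h. causal_L1 h \<and>
    (\<forall>t\<ge>0. x t = taylor p (\<lambda>i. nth_deriv i x 0) t + frac_int (real p + 1) h t)"
    using assms
  proof (induction p arbitrary: x)
    case 0
    show ?case
    proof (rule abs_continuous_representation)
      show "abs_continuous_on 0 T x" if "T > 0" for T using that 0 by (simp add: regular_def)
      show ?case if h: "causal_L1 h" and x: "\<And>t. t \<ge> 0 \<Longrightarrow> x t = x 0 + frac_int 1 h t" for h
      proof (intro exI[of _ h] conjI allI impI h)
        fix t :: real assume "t \<ge> 0"
        from x[OF this] show "x t = taylor 0 (\<lambda>i. nth_deriv i x 0) t + frac_int (real 0 + 1) h t"
          unfolding taylor_def by simp
      qed
    qed
  next
    case (Suc p)
    let ?C = "\<lambda>i. nth_deriv i x 0"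
    have d: "\<And>t. t \<ge> 0 \<Longrightarrow> x differentiable (at t within {0..})" and "regular p (nth_deriv 1 x)"
      using Suc.prems unfolding regular_Suc by blast+
    from Suc.IH[OF this(2)] have "\<exists>h. causal_L1 h \<and>
      (\<forall>t\<ge>0. nth_deriv 1 x t = taylor p (\<lambda>i. ?C (Suc i)) t + frac_int (real p + 1) h t)"
      by (simp only: nth_deriv_Suc_shift)
    then obtain h where h: "causal_L1 h"
      and x': "\<And>t. t \<ge> 0 \<Longrightarrow> nth_deriv 1 x t = taylor p (\<lambda>i. ?C (Suc i)) t + frac_int (real p + 1) h t"
      by blast
    let ?X = "\<lambda>t. taylor (Suc p) ?C t + frac_int (real (Suc p) + 1) h t"
    have "((\<lambda>t. x t - ?X t) has_derivative (\<lambda>h. 0)) (at t within {0..})" if t: "t \<in> {0..}" for t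
    proof -
      have "(x has_vector_derivative nth_deriv 1 x t) (at t within {0..})"
        using d[of t] t by (simp add: vector_derivative_works)
      from has_vector_derivative_diff[OF this taylor_frac_int_has_vector_derivative[OF h, of t p ?C]] t x'[of t]
      have "((\<lambda>t. x t - ?X t) has_vector_derivative 0) (at t within {0..})"
        by (simp del: nth_deriv.simps of_nat_Suc)
      then show ?thesis by (simp add: has_vector_derivative_def)
    qed
    then have "\<exists>c. \<forall>t\<in>{0..}. x t - ?X t = c"
      by (intro has_derivative_zero_constant) auto
    then obtain c where c: "\<And>t. t \<ge> 0 \<Longrightarrow> x t - ?X t = c" by auto
    have "frac_int (real (Suc p) + 1) h 0 = 0" using causal_L1D(2)[OF h] by (intro frac_int_nonpos) auto
    with c[of 0] have "c = 0" by simp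
    with c h show ?case by (intro exI[of _ h]) auto
  qed
  with that show thesis by blast
qed

text \<open>Converse of \<open>regular_representation\<close>: differentiating the expansion lowers
  \<open>p\<close> by one and shifts the coefficients \<open>C\<close>, until a constant plus a
  primitive of \<open>h\<close> remains.\<close>

lemma representation_regular:
  assumes h: "causal_L1 h"
    and x: "\<And>t. t \<ge> 0 \<Longrightarrow> x t = taylor p C t + frac_int (real p + 1) h t"
  shows "regular p x" "i \<le> p \<Longrightarrow> nth_deriv i x 0 = C i"
    "t \<ge> 0 \<Longrightarrow> nth_deriv p x t = C p + frac_int 1 h t"
proof -
  have "regular p x \<and> (\<forall>i\<le>p. nth_deriv i x 0 = C i) \<and> (\<forall>t\<ge>0. nth_deriv p x t = C p + frac_int 1 h t)"
    using x
  proof (induction p arbitrary: x C)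
    case 0
    have f0: "frac_int 1 h 0 = 0" using causal_L1D(2)[OF h] by (intro frac_int_nonpos) auto
    have x: "x t = C 0 + frac_int 1 h t" if "t \<ge> 0" for t using 0[OF that] by (simp add: taylor_def)
    have "abs_continuous_on 0 T x" for T
      by (rule abs_continuous_on_cong[OF abs_continuous_on_const_add[OF abs_continuous_on_frac_int[OF h]]])
        (simp add: x)
    with x f0 show ?case by (simp add: regular_def)
  next
    case (Suc p)
    have der: "(x has_vector_derivative taylor p (\<lambda>i. C (Suc i)) t + frac_int (real p + 1) h t) (at t within {0..})"
      and x': "nth_deriv 1 x t = taylor p (\<lambda>i. C (Suc i)) t + frac_int (real p + 1) h t" if "t \<ge> 0" for t
      using vector_derivative_nonneg_eqI[of x _ t, OF _ that taylor_frac_int_has_vector_derivative[OF h that, of p C]] Suc.prems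
      by simp_all
    have f0: "frac_int (real (Suc p) + 1) h 0 = 0" using causal_L1D(2)[OF h] by (intro frac_int_nonpos) auto
    from Suc.IH[of "nth_deriv 1 x" "\<lambda>i. C (Suc i)"] x' have IH: "regular p (nth_deriv 1 x)" "\<forall>i\<le>p. nth_deriv (Suc i) x 0 = C (Suc i)"
      "\<forall>t\<ge>0. nth_deriv (Suc p) x t = C (Suc p) + frac_int 1 h t"
      unfolding nth_deriv_Suc_shift[symmetric] by auto
    moreover have "\<forall>t\<ge>0. x differentiable (at t within {0..})"
      using der differentiableI_vector by blast
    moreover have "nth_deriv i x 0 = C i" if "i \<le> Suc p" for i
      using that IH(2) Suc.prems[of 0] f0 by (cases i) auto
    ultimately show ?case by (auto simp: regular_Suc)
  qed
  then show "regular p x" "i \<le> p \<Longrightarrow> nth_deriv i x 0 = C i"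
    "t \<ge> 0 \<Longrightarrow> nth_deriv p x t = C p + frac_int 1 h t" by blast+
qed

lemma representation_AE:
  assumes h: "causal_L1 h"
    and x: "\<And>t. t \<ge> 0 \<Longrightarrow> x t = taylor p C t + frac_int (real p + 1) h t"
  shows "AE t in lborel. t > 0 \<longrightarrow> nth_deriv (Suc p) x t = h t"
  using AE_frac_int_1_has_derivative[OF h]
proof eventually_elim
  case (elim t)
  show ?case
  proof
    assume t: "t > 0"
    have "((\<lambda>t. C p + frac_int 1 h t) has_vector_derivative 0 + h t) (at t within {0..})"
      using elim by (intro has_vector_derivative_add has_vector_derivative_const)
        (auto simp: has_real_derivative_iff_has_vector_derivative[symmetric] intro: has_field_derivative_at_within)
    from vector_derivative_nonneg_eqI(2)[OF _ _ this] representation_regular(3)[of h x p C] h x t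
    show "nth_deriv (Suc p) x t = h t" by simp
  qed
qed

text \<open>The derivative of order \<open>p + 1\<close> equals the density \<open>h\<close> almost
  everywhere only, but the integral does not see the difference. Existence of the Caputo derivative
  at \<open>t\<close> thereby becomes integrability of \<open>h\<close> against the kernel of
  complementary order.\<close>

lemma caputo_representation:
  assumes h: "causal_L1 h"
    and x: "\<And>t. t \<ge> 0 \<Longrightarrow> x t = taylor p C t + frac_int (real p + 1) h t"
    and \<alpha>: "real p < \<alpha>" "\<alpha> < real p + 1" and t: "t > 0"
  shows "caputo_exists \<alpha> x t \<longleftrightarrow> frac_integrable (real p + 1 - \<alpha>) h t"
    and "caputo_deriv \<alpha> x t = frac_int (real p + 1 - \<alpha>) h t"
proof -
  note [measurable] = causal_L1D(1)[OF h]
  have n: "nat \<lceil>\<alpha>\<rceil> = Suc p"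
  proof -
    have "\<lceil>\<alpha>\<rceil> = int p + 1" using \<alpha> by (intro ceiling_unique) auto
    then show ?thesis by simp
  qed
  have r: "real (Suc p) - \<alpha> - 1 = real p - \<alpha>" "real (Suc p) - \<alpha> = real p + 1 - \<alpha>"
    "\<alpha> \<noteq> real (Suc p)" using \<alpha> by simp_all
  define c where "c = Gamma (real p + 1 - \<alpha>)"
  have "c > 0" unfolding c_def by (rule Gamma_real_pos) (use \<alpha> in simp)
  then have c: "c \<noteq> 0" by simp
  define F where "F s = indicator {0..t} s * ((t - s) powr (real p - \<alpha>) * nth_deriv (Suc p) x s)" for s
  define G where "G s = c * (frac_kernel (real p + 1 - \<alpha>) (t - s) * h s)" for s
  have [measurable]: "G \<in> borel_measurable borel" unfolding G_def[abs_def] by measurable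
  have "AE s in lborel. s > 0 \<longrightarrow> nth_deriv (Suc p) x s = h s"
    by (rule representation_AE[OF h x])
  then have "AE s in lborel. G s = F s"
    using AE_lborel_singleton[of 0] AE_lborel_singleton[of t]
  proof eventually_elim
    case (elim s)
    then consider "s < 0" | "s > t" | "0 < s" "s < t" "nth_deriv (Suc p) x s = h s" by fastforce
    then show ?case
      using c causal_L1D(2)[OF h, of s] by cases (auto simp: F_def G_def frac_kernel_def c_def[symmetric] simp del: nth_deriv.simps)
  qed
  then have ae: "AE s in lebesgue. G s = F s" by (rule AE_completion)
  have Gm: "G \<in> borel_measurable lebesgue" by (rule measurable_completion) simp
  \<comment> \<open>Nothing is known about \<open>nth_deriv (Suc p) x\<close> where it differs from
    \<open>h\<close>; completeness of Lebesgue measure makes \<open>F\<close> measurable all the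
    same.\<close>
  have Fm: "F \<in> borel_measurable lebesgue"
    using Gm ae by (rule borel_measurable_AE)
  have "integrable lebesgue F \<longleftrightarrow> integrable lebesgue G"
    using ae by (intro integrable_cong_AE Fm Gm) auto
  also have "\<dots> \<longleftrightarrow> integrable lborel G" by (intro integrable_completion) simp
  also have "\<dots> \<longleftrightarrow> frac_integrable (real p + 1 - \<alpha>) h t"
    using c by (simp add: G_def[abs_def] frac_integrable_def)
  finally show "caputo_exists \<alpha> x t \<longleftrightarrow> frac_integrable (real p + 1 - \<alpha>) h t"
    using \<alpha> by (simp add: caputo_exists_def n r set_integrable_def F_def[abs_def] del: nth_deriv.simps of_nat_Suc)
  have "integral\<^sup>L lebesgue F = integral\<^sup>L lebesgue G"
    using ae by (intro integral_cong_AE Fm Gm) auto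
  also have "\<dots> = integral\<^sup>L lborel G" by (intro integral_completion) simp
  also have "\<dots> = c * frac_int (real p + 1 - \<alpha>) h t"
    by (simp add: G_def[abs_def] frac_int_def)
  finally show "caputo_deriv \<alpha> x t = frac_int (real p + 1 - \<alpha>) h t"
    using \<alpha> c by (simp add: caputo_deriv_def n r set_lebesgue_integral_def F_def[abs_def] c_def[symmetric] del: nth_deriv.simps of_nat_Suc)
qed

lemma caputo_domain_iff_regular:
  assumes "real p < \<alpha>" "\<alpha> \<le> real p + 1"
  shows "caputo_domain \<alpha> x \<longleftrightarrow> regular p x"
proof -
  have "\<lceil>\<alpha>\<rceil> = int p + 1" using assms by (intro ceiling_unique) auto
  then have "nat \<lceil>\<alpha>\<rceil> = Suc p" by simp
  then show ?thesis by (simp add: caputo_domain_def regular_def del: nth_deriv.simps)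
qed

section \<open>Linear Volterra equations with fractional kernels\<close>

definition conv :: "(real \<Rightarrow> real) \<Rightarrow> (real \<Rightarrow> real) \<Rightarrow> real \<Rightarrow> real" where
  "conv f g t = (\<integral>s. f (t - s) * g s \<partial>lborel)"

lemma conv_measurable [measurable]:
  assumes [measurable]: "f \<in> borel_measurable borel" "g \<in> borel_measurable borel"
  shows "conv f g \<in> borel_measurable borel"
  unfolding conv_def[abs_def] by measurable

lemma conv_nonpos:
  assumes "\<And>s. s \<le> 0 \<Longrightarrow> f s = 0" "\<And>s. s \<le> 0 \<Longrightarrow> g s = 0" "t \<le> 0"
  shows "conv f g t = 0"
proof -
  have "f (t - s) * g s = 0" for s
    using assms(1)[of "t - s"] assms(2)[of s] assms(3) by (cases "s \<le> 0") auto
  then have "(\<lambda>s. f (t - s) * g s) = (\<lambda>s. 0)" by blast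
  then show ?thesis by (simp add: conv_def)
qed

text \<open>Young's inequality in L1: by translation invariance the inner integral over
  \<open>t\<close> is the norm of \<open>f\<close> times \<open>\<bar>g s\<bar>\<close>, so Fubini
  applies to the double integrand.\<close>

lemma
  fixes f g :: "real \<Rightarrow> real"
  assumes f: "integrable lborel f" and g: "integrable lborel g"
  shows AE_integrable_conv: "AE t in lborel. integrable lborel (\<lambda>s. f (t - s) * g s)"
    and integrable_conv: "integrable lborel (conv f g)"
    and conv_norm_le: "(\<integral>t. \<bar>conv f g t\<bar> \<partial>lborel) \<le> (\<integral>t. \<bar>f t\<bar> \<partial>lborel) * (\<integral>t. \<bar>g t\<bar> \<partial>lborel)"
proof -
  have [measurable]: "f \<in> borel_measurable borel" "g \<in> borel_measurable borel"
    using f g by auto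
  let ?F = "\<lambda>s t. f (t - s) * g s"
  have tr: "(\<integral>t. \<bar>f (t - s)\<bar> \<partial>lborel) = (\<integral>t. \<bar>f t\<bar> \<partial>lborel)" for s
    using lborel_integral_real_affine[of 1 "\<lambda>t. \<bar>f t\<bar>" "- s"] by simp
  have int: "integrable lborel (\<lambda>t. f (t - s))" for s
    using lborel_integrable_real_affine[OF f, of 1 "- s"] by simp
  have inner: "(\<integral>t. norm (?F s t) \<partial>lborel) = (\<integral>t. \<bar>f t\<bar> \<partial>lborel) * \<bar>g s\<bar>" for s
    by (simp add: abs_mult tr)
  have F: "integrable (lborel \<Otimes>\<^sub>M lborel) (\<lambda>(s, t). ?F s t)"
  proof (rule lborel_pair.Fubini_integrable)
    show "integrable lborel (\<lambda>s. \<integral>t. norm (case (s, t) of (s, t) \<Rightarrow> ?F s t) \<partial>lborel)"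
      using g by (simp only: inner prod.case) (intro integrable_mult_right integrable_abs)
    show "AE s in lborel. integrable lborel (\<lambda>t. case (s, t) of (s, t) \<Rightarrow> ?F s t)"
      using int by simp
  qed measurable
  then have F': "integrable (lborel \<Otimes>\<^sub>M lborel) (\<lambda>(s, t). norm (?F s t))"
    using integrable_norm[OF F] by (simp add: case_prod_unfold)
  show "AE t in lborel. integrable lborel (\<lambda>s. f (t - s) * g s)"
    using lborel_pair.AE_integrable_snd[OF F] by simp
  show i: "integrable lborel (conv f g)"
    using lborel_pair.integrable_snd[OF F] by (simp add: conv_def[abs_def])
  have "(\<integral>t. \<bar>conv f g t\<bar> \<partial>lborel) \<le> (\<integral>t. (\<integral>s. norm (?F s t) \<partial>lborel) \<partial>lborel)"
  proof (rule integral_mono)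
    show "integrable lborel (\<lambda>t. \<integral>s. norm (?F s t) \<partial>lborel)"
      using lborel_pair.integrable_snd[OF F'] by simp
    show "\<bar>conv f g t\<bar> \<le> (\<integral>s. norm (?F s t) \<partial>lborel)" for t
      unfolding conv_def using integral_norm_bound[of lborel "\<lambda>s. ?F s t"] by simp
  qed (use i in auto)
  also have "\<dots> = (\<integral>s. (\<integral>t. norm (?F s t) \<partial>lborel) \<partial>lborel)"
    using lborel_pair.Fubini_integral[OF F'] .
  also have "\<dots> = (\<integral>t. \<bar>f t\<bar> \<partial>lborel) * (\<integral>t. \<bar>g t\<bar> \<partial>lborel)"
    unfolding inner by simp
  finally show "(\<integral>t. \<bar>conv f g t\<bar> \<partial>lborel) \<le> (\<integral>t. \<bar>f t\<bar> \<partial>lborel) * (\<integral>t. \<bar>g t\<bar> \<partial>lborel)" .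
qed

text \<open>By monotone convergence the sum of the absolute values has finite integral, so it is
  finite almost everywhere.\<close>

lemma AE_summable_norm:
  fixes f :: "nat \<Rightarrow> real \<Rightarrow> real"
  assumes i: "\<And>n. integrable lborel (f n)" and s: "summable (\<lambda>n. \<integral>t. \<bar>f n t\<bar> \<partial>lborel)"
  shows "AE t in lborel. summable (\<lambda>n. \<bar>f n t\<bar>)"
proof -
  have [measurable]: "f n \<in> borel_measurable borel" for n using i[of n] by auto
  have "(\<integral>\<^sup>+t. (\<Sum>n. ennreal \<bar>f n t\<bar>) \<partial>lborel) = (\<Sum>n. \<integral>\<^sup>+t. ennreal \<bar>f n t\<bar> \<partial>lborel)"
    by (intro nn_integral_suminf) measurable
  also have "\<dots> = (\<Sum>n. ennreal (\<integral>t. \<bar>f n t\<bar> \<partial>lborel))"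
    using i by (intro suminf_cong nn_integral_eq_integral) auto
  also have "\<dots> = ennreal (\<Sum>n. \<integral>t. \<bar>f n t\<bar> \<partial>lborel)"
    by (intro suminf_ennreal2 s) simp
  finally have "(\<integral>\<^sup>+t. (\<Sum>n. ennreal \<bar>f n t\<bar>) \<partial>lborel) \<noteq> \<infinity>" by simp
  then have "AE t in lborel. (\<Sum>n. ennreal \<bar>f n t\<bar>) \<noteq> \<infinity>"
    by (intro nn_integral_PInf_AE) measurable
  then show ?thesis
    by eventually_elim (auto intro: summable_suminf_not_top)
qed

text \<open>Existence by the Neumann series \<open>v = g + k * g + k * k * g + \<dots>\<close>.\<close>

lemma convolution_equation:
  fixes k g :: "real \<Rightarrow> real"
  assumes k: "integrable lborel k" and q: "(\<integral>t. \<bar>k t\<bar> \<partial>lborel) < 1" and g: "integrable lborel g"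
    and k0: "\<And>s. s \<le> 0 \<Longrightarrow> k s = 0" and g0: "\<And>s. s \<le> 0 \<Longrightarrow> g s = 0"
  obtains v where "integrable lborel v" "\<And>s. s \<le> 0 \<Longrightarrow> v s = 0"
    "AE t in lborel. v t = g t + conv k v t"
proof -
  define q where "q = (\<integral>t. \<bar>k t\<bar> \<partial>lborel)"
  have q01: "0 \<le> q" "q < 1" using q by (simp_all add: q_def)
  define w where "w n = (conv k ^^ n) g" for n
  have w0: "w 0 = g" and wSuc: "w (Suc n) = conv k (w n)" for n by (simp_all add: w_def)
  have wi: "integrable lborel (w n)" for n
    by (induction n) (simp_all add: w0 wSuc g integrable_conv k)
  have wz: "w n s = 0" if "s \<le> 0" for n s
    using that by (induction n arbitrary: s) (simp_all add: w0 wSuc g0 k0 conv_nonpos)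
  have wn: "(\<integral>t. \<bar>w n t\<bar> \<partial>lborel) \<le> q ^ n * (\<integral>t. \<bar>g t\<bar> \<partial>lborel)" for n
  proof (induction n)
    case (Suc n)
    have "(\<integral>t. \<bar>w (Suc n) t\<bar> \<partial>lborel) \<le> q * (\<integral>t. \<bar>w n t\<bar> \<partial>lborel)"
      unfolding wSuc q_def by (rule conv_norm_le[OF k wi])
    also have "\<dots> \<le> q * (q ^ n * (\<integral>t. \<bar>g t\<bar> \<partial>lborel))" using Suc q01 by (intro mult_left_mono) auto
    finally show ?case by simp
  qed (simp add: w0)
  have ws: "summable (\<lambda>n. \<integral>t. \<bar>w n t\<bar> \<partial>lborel)"
    by (rule summable_comparison_test'[OF summable_mult2[OF summable_geometric]])
      (use wn q01 in auto)
  have sumw: "AE t in lborel. summable (\<lambda>n. \<bar>w n t\<bar>)" by (rule AE_summable_norm[OF wi ws])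
  define v where "v t = (\<Sum>n. w n t)" for t
  have v: "integrable lborel v"
    unfolding v_def[abs_def] by (rule integrable_suminf[OF wi]) (use sumw ws in auto)
  have [measurable]: "k \<in> borel_measurable borel" "v \<in> borel_measurable borel" "w n \<in> borel_measurable borel" for n
    using k v wi[of n] by auto
  have ki: "integrable lborel (\<lambda>t. \<bar>k t\<bar>)" "integrable lborel (\<lambda>t. \<bar>w n t\<bar>)" for n
    using k wi by auto
  \<comment> \<open>The series with absolute values inside the convolutions converges almost
    everywhere, which justifies term by term integration in \<open>conv k v\<close>.\<close>
  have "summable (\<lambda>n. \<integral>t. \<bar>conv (\<lambda>t. \<bar>k t\<bar>) (\<lambda>t. \<bar>w n t\<bar>) t\<bar> \<partial>lborel)"
  proof (rule summable_comparison_test'[OF summable_mult[OF ws, of q]])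
    show "norm (\<integral>t. \<bar>conv (\<lambda>t. \<bar>k t\<bar>) (\<lambda>t. \<bar>w n t\<bar>) t\<bar> \<partial>lborel) \<le> q * (\<integral>t. \<bar>w n t\<bar> \<partial>lborel)" for n
      using conv_norm_le[OF ki(1) ki(2)[of n]] by (simp add: q_def)
  qed
  then have sumc: "AE t in lborel. summable (\<lambda>n. \<bar>conv (\<lambda>t. \<bar>k t\<bar>) (\<lambda>t. \<bar>w n t\<bar>) t\<bar>)"
    by (intro AE_summable_norm integrable_conv ki)
  have "AE t in lborel. \<forall>n. integrable lborel (\<lambda>s. k (t - s) * w n s)"
    unfolding AE_all_countable using AE_integrable_conv[OF k wi] by blast
  with sumc sumw have vae: "AE t in lborel. v t = g t + conv k v t"
  proof eventually_elim
    case (elim t)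
    have c: "conv (\<lambda>t. \<bar>k t\<bar>) (\<lambda>t. \<bar>w n t\<bar>) t = (\<integral>s. norm (k (t - s) * w n s) \<partial>lborel)" for n
      by (simp add: conv_def abs_mult)
    have "conv k v t = (\<integral>s. (\<Sum>n. k (t - s) * w n s) \<partial>lborel)"
      unfolding conv_def
    proof (rule integral_cong_AE)
      show "AE s in lborel. k (t - s) * v s = (\<Sum>n. k (t - s) * w n s)"
        using sumw by eventually_elim (simp add: v_def suminf_mult summable_rabs_cancel)
    qed measurable
    also have "\<dots> = (\<Sum>n. \<integral>s. k (t - s) * w n s \<partial>lborel)"
    proof (rule integral_suminf)
      show "integrable lborel (\<lambda>s. k (t - s) * w n s)" for n using elim by blast
      show "AE s in lborel. summable (\<lambda>n. norm (k (t - s) * w n s))"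
        using sumw by eventually_elim (simp add: abs_mult summable_mult)
      show "summable (\<lambda>n. \<integral>s. norm (k (t - s) * w n s) \<partial>lborel)"
        using elim(1) unfolding c by simp
    qed
    also have "\<dots> = (\<Sum>n. w (Suc n) t)" by (simp add: wSuc conv_def)
    finally have "conv k v t = (\<Sum>n. w (Suc n) t)" .
    moreover have "summable (\<lambda>n. w n t)" using elim(2) by (rule summable_rabs_cancel)
    ultimately show ?case using suminf_split_head[of "\<lambda>n. w n t"] by (simp add: v_def w0)
  qed
  show thesis by (rule that[OF v _ vae]) (simp add: v_def wz)
qed

section \<open>Exponential weights\<close>

lemma has_bochner_integral_exp_frac_kernel:
  assumes "e > 0" "l > 0"
  shows "has_bochner_integral lborel (\<lambda>u. exp (- l * u) * frac_kernel e u) (l powr - e)"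
proof -
  define B where "B u = exp (- u) * frac_kernel e u" for u
  have [measurable]: "B \<in> borel_measurable borel" unfolding B_def[abs_def] by measurable
  have G: "Gamma e > 0" using assms by (intro Gamma_real_pos)
  have "(\<integral>\<^sup>+u. ennreal (indicator {0..} u * (u powr (e - 1) / exp u)) \<partial>lborel) = ennreal (Gamma e)"
    using nn_integral_has_integral_lebesgue[OF _ Gamma_integral_real[OF assms(1)]] by simp
  then have "has_bochner_integral lborel (\<lambda>u. indicator {0..} u * (u powr (e - 1) / exp u)) (Gamma e)"
    using G by (intro has_bochner_integral_nn_integral) auto
  from has_bochner_integral_mult_right[OF this, of "inverse (Gamma e)"]
  have "has_bochner_integral lborel (\<lambda>u. inverse (Gamma e) * (indicator {0..} u * (u powr (e - 1) / exp u))) 1"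
    using G by simp
  then have "has_bochner_integral lborel B 1"
  proof (rule has_bochner_integralI_AE)
    show "AE u in lborel. inverse (Gamma e) * (indicator {0..} u * (u powr (e - 1) / exp u)) = B u"
      using AE_lborel_singleton[of 0]
      by eventually_elim (auto simp: B_def frac_kernel_def exp_minus field_simps)
  qed simp
  then have "has_bochner_integral lborel (\<lambda>u. B (0 + l * u)) (1 /\<^sub>R \<bar>l\<bar>)"
    using assms by (subst lborel_has_bochner_integral_real_affine_iff[symmetric]) auto
  from has_bochner_integral_mult_right[OF this, of "l powr (1 - e)"]
  have "has_bochner_integral lborel (\<lambda>u. l powr (1 - e) * B (l * u)) (l powr (1 - e) / l)"
    using assms by (simp add: divide_inverse)
  also have "l powr (1 - e) / l = l powr - e"
    using assms by (simp add: powr_diff powr_minus field_simps)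
  also have "(\<lambda>u. l powr (1 - e) * B (l * u)) = (\<lambda>u. exp (- l * u) * frac_kernel e u)"
  proof
    fix u
    show "l powr (1 - e) * B (l * u) = exp (- l * u) * frac_kernel e u"
    proof (cases "u > 0")
      case True
      have "l powr (1 - e) * (l * u) powr (e - 1) = u powr (e - 1)"
      proof -
        have "l powr (1 - e) * (l * u) powr (e - 1) = (l powr (1 - e) * l powr (e - 1)) * u powr (e - 1)"
          using True assms by (simp add: powr_mult)
        also have "l powr (1 - e) * l powr (e - 1) = 1"
          using assms unfolding powr_add[symmetric] by simp
        finally show ?thesis by simp
      qed
      with True assms show ?thesis by (simp add: B_def frac_kernel_def mult_ac)
    qed (use assms in \<open>simp add: B_def frac_kernel_def zero_less_mult_iff\<close>)
  qed
  finally show ?thesis .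
qed

text \<open>By the Laplace transform of the kernels, the norm is at most the sum of
  \<open>\<bar>c j\<bar> * l powr - e j\<close>, which tends to 0 as \<open>l\<close> grows. The
  value 1/2 merely stands for a contraction constant below 1.\<close>

lemma weighted_kernel:
  fixes c e :: "'i \<Rightarrow> real"
  assumes "finite A" "\<And>j. j \<in> A \<Longrightarrow> e j > 0"
  obtains l where "l > 0"
    "(\<integral>u. \<bar>\<Sum>j\<in>A. c j * (exp (- l * u) * frac_kernel (e j) u)\<bar> \<partial>lborel) \<le> 1 / 2"
proof -
  have "((\<lambda>l. \<Sum>j\<in>A. \<bar>c j\<bar> * l powr - e j) \<longlongrightarrow> (\<Sum>j\<in>A. \<bar>c j\<bar> * 0)) at_top"
    using assms(2) by (intro tendsto_sum tendsto_mult tendsto_const tendsto_neg_powr filterlim_ident) auto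
  then have "\<forall>\<^sub>F l in at_top. (\<Sum>j\<in>A. \<bar>c j\<bar> * l powr - e j) < 1 / 2"
    by (intro order_tendstoD(2)) auto
  then have "\<forall>\<^sub>F l in at_top. (\<Sum>j\<in>A. \<bar>c j\<bar> * l powr - e j) < 1 / 2 \<and> l > 0"
    by (intro eventually_conj eventually_gt_at_top)
  from eventually_happens'[OF trivial_limit_at_top_linorder this]
  obtain l where l: "(\<Sum>j\<in>A. \<bar>c j\<bar> * l powr - e j) < 1 / 2" "l > 0" by blast
  have hb: "has_bochner_integral lborel (\<lambda>u. exp (- l * u) * frac_kernel (e j) u) (l powr - e j)" if "j \<in> A" for j
    using assms(2)[OF that] l(2) by (rule has_bochner_integral_exp_frac_kernel)
  have "(\<integral>u. \<bar>\<Sum>j\<in>A. c j * (exp (- l * u) * frac_kernel (e j) u)\<bar> \<partial>lborel)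
      \<le> (\<integral>u. (\<Sum>j\<in>A. \<bar>c j\<bar> * (exp (- l * u) * frac_kernel (e j) u)) \<partial>lborel)"
  proof (rule integral_mono)
    show "integrable lborel (\<lambda>u. \<bar>\<Sum>j\<in>A. c j * (exp (- l * u) * frac_kernel (e j) u)\<bar>)"
      "integrable lborel (\<lambda>u. \<Sum>j\<in>A. \<bar>c j\<bar> * (exp (- l * u) * frac_kernel (e j) u))"
      using hb by (auto intro!: integrable_abs Bochner_Integration.integrable_sum integrable_mult_right
          simp: has_bochner_integral_iff simp del: mult_minus_left)
    show "\<bar>\<Sum>j\<in>A. c j * (exp (- l * u) * frac_kernel (e j) u)\<bar> \<le>
      (\<Sum>j\<in>A. \<bar>c j\<bar> * (exp (- l * u) * frac_kernel (e j) u))" for u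
      using assms(2) by (intro order_trans[OF sum_abs] sum_mono) (simp add: abs_mult)
  qed
  also have "\<dots> = (\<Sum>j\<in>A. \<bar>c j\<bar> * l powr - e j)"
    using hb by (subst Bochner_Integration.integral_sum)
      (auto simp: has_bochner_integral_iff simp del: mult_minus_left)
  finally show thesis using l by (intro that[of l]) auto
qed

text \<open>Multiplication by \<open>exp (- l t)\<close> commutes with convolution; this reduces the fractional
  equation to a convolution equation whose kernel has small norm.\<close>

lemma conv_exp_sum:
  assumes "\<And>j. j \<in> A \<Longrightarrow> integrable lborel (\<lambda>s. exp (- l * (t - s)) * frac_kernel (e j) (t - s) * (exp (- l * s) * v s))"
  shows "conv (\<lambda>u. \<Sum>j\<in>A. c j * (exp (- l * u) * frac_kernel (e j) u)) (\<lambda>s. exp (- l * s) * v s) t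
      = exp (- l * t) * (\<Sum>j\<in>A. c j * frac_int (e j) v t)"
proof -
  have e: "exp (- l * (t - s)) * frac_kernel (e j) (t - s) * (exp (- l * s) * v s)
      = exp (- l * t) * (frac_kernel (e j) (t - s) * v s)" for s j
    by (simp add: exp_diff exp_minus field_simps)
  have "conv (\<lambda>u. \<Sum>j\<in>A. c j * (exp (- l * u) * frac_kernel (e j) u)) (\<lambda>s. exp (- l * s) * v s) t
      = (\<integral>s. (\<Sum>j\<in>A. c j * (exp (- l * (t - s)) * frac_kernel (e j) (t - s) * (exp (- l * s) * v s))) \<partial>lborel)"
    unfolding conv_def sum_distrib_right by (simp only: mult.assoc)
  also have "\<dots> = (\<Sum>j\<in>A. \<integral>s. c j * (exp (- l * (t - s)) * frac_kernel (e j) (t - s) * (exp (- l * s) * v s)) \<partial>lborel)"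
    using assms by (intro Bochner_Integration.integral_sum integrable_mult_right)
  also have "\<dots> = (\<Sum>j\<in>A. c j * (exp (- l * t) * frac_int (e j) v t))"
    unfolding e by (simp add: frac_int_def)
  finally show ?thesis by (simp add: sum_distrib_left mult_ac)
qed

text \<open>The weight \<open>l\<close> is dictated by the kernel, so \<open>g\<close> is assumed
  integrable against every decaying exponential. The weighted unknown is integrable on the whole
  line, and removing the weight leaves local integrability.\<close>

lemma fractional_equation_exists:
  fixes c e :: "'i \<Rightarrow> real"
  assumes A: "finite A" "\<And>j. j \<in> A \<Longrightarrow> e j > 0"
    and g: "causal_L1 g" "\<And>l. l > 0 \<Longrightarrow> integrable lborel (\<lambda>t. exp (- l * t) * g t)"
  obtains v where "causal_L1 v" "AE t in lborel. v t = g t + (\<Sum>j\<in>A. c j * frac_int (e j) v t)"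
proof -
  obtain l where l: "l > 0"
    "(\<integral>u. \<bar>\<Sum>j\<in>A. c j * (exp (- l * u) * frac_kernel (e j) u)\<bar> \<partial>lborel) \<le> 1 / 2"
    using weighted_kernel[of A e c] A by blast
  let ?k = "\<lambda>u. \<Sum>j\<in>A. c j * (exp (- l * u) * frac_kernel (e j) u)"
  have kj: "integrable lborel (\<lambda>u. exp (- l * u) * frac_kernel (e j) u)" if "j \<in> A" for j
    using has_bochner_integral_exp_frac_kernel[OF A(2)[OF that] l(1)] by (simp add: has_bochner_integral_iff)
  have "integrable lborel ?k"
    using kj by (intro Bochner_Integration.integrable_sum integrable_mult_right)
  then obtain w where w: "integrable lborel w" "\<And>s. s \<le> 0 \<Longrightarrow> w s = 0"
    "AE t in lborel. w t = exp (- l * t) * g t + conv ?k w t"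
    using convolution_equation[of ?k "\<lambda>t. exp (- l * t) * g t"] l g(2)[OF l(1)] causal_L1D(2)[OF g(1)] by auto
  define v where "v t = exp (l * t) * w t" for t
  have wv: "w = (\<lambda>t. exp (- l * t) * v t)"
    by (simp add: v_def fun_eq_iff exp_minus)
  have wm [measurable]: "w \<in> borel_measurable borel" using w(1) by auto
  have vm [measurable]: "v \<in> borel_measurable borel" unfolding v_def[abs_def] by measurable
  have "causal_L1 v"
    unfolding causal_L1_def
  proof (intro conjI allI impI)
    show "v s = 0" if "s \<le> 0" for s using w(2)[OF that] by (simp add: v_def)
    show "frac_integrable 1 v t" for t
      unfolding frac_integrable_def
    proof (rule Bochner_Integration.integrable_bound)
      show "integrable lborel (\<lambda>s. exp (l * t) * w s)" using w(1) by simp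
      show "AE s in lborel. norm (frac_kernel 1 (t - s) * v s) \<le> norm (exp (l * t) * w s)"
        using l(1) by (intro AE_I2) (auto simp: v_def abs_mult intro!: mult_right_mono)
    qed measurable
  qed (rule vm)
  moreover have "AE t in lborel. v t = g t + (\<Sum>j\<in>A. c j * frac_int (e j) v t)"
  proof -
    have "AE t in lborel. \<forall>j\<in>A. integrable lborel (\<lambda>s. exp (- l * (t - s)) * frac_kernel (e j) (t - s) * w s)"
      using AE_integrable_conv[OF kj w(1)] A(1) by (intro AE_finite_allI) auto
    with w(3) show ?thesis
    proof eventually_elim
      case (elim t)
      have "conv ?k w t = exp (- l * t) * (\<Sum>j\<in>A. c j * frac_int (e j) v t)"
        unfolding wv using elim(2) by (intro conv_exp_sum) (simp only: wv)
      with elim(1) have "exp (l * t) * w t = exp (l * t) * exp (- l * t) * (g t + (\<Sum>j\<in>A. c j * frac_int (e j) v t))"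
        by (simp add: algebra_simps)
      then show ?case by (simp add: v_def flip: exp_add)
    qed
  qed
  ultimately show thesis by (rule that)
qed

text \<open>\<open>d\<close> may grow faster than any exponential, so it is first cut off at
  \<open>T\<close>. By causality the convolution at \<open>t < T\<close> does not notice the cut,
  and for \<open>t \<ge> T\<close> the truncated function is 0; hence its weighted norm is at most
  half of itself.\<close>

lemma fractional_equation_unique:
  fixes c e :: "'i \<Rightarrow> real"
  assumes A: "finite A" "\<And>j. j \<in> A \<Longrightarrow> e j > 0"
    and d: "causal_L1 d" "AE t in lborel. d t = (\<Sum>j\<in>A. c j * frac_int (e j) d t)"
  shows "AE t in lborel. d t = 0"
proof -
  note [measurable] = causal_L1D(1)[OF d(1)]
  obtain l where l: "l > 0"
    "(\<integral>u. \<bar>\<Sum>j\<in>A. c j * (exp (- l * u) * frac_kernel (e j) u)\<bar> \<partial>lborel) \<le> 1 / 2"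
    using weighted_kernel[of A e c] A by blast
  let ?k = "\<lambda>u. \<Sum>j\<in>A. c j * (exp (- l * u) * frac_kernel (e j) u)"
  have kj: "integrable lborel (\<lambda>u. exp (- l * u) * frac_kernel (e j) u)" if "j \<in> A" for j
    using has_bochner_integral_exp_frac_kernel[OF A(2)[OF that] l(1)] by (simp add: has_bochner_integral_iff)
  have k: "integrable lborel ?k"
    using kj by (intro Bochner_Integration.integrable_sum integrable_mult_right)
  have zero: "AE t in lborel. t < T \<longrightarrow> d t = 0" for T
  proof -
    define b where "b s = frac_kernel 1 (T - s) * d s" for s
    define w where "w s = exp (- l * s) * b s" for s
    have [measurable]: "b \<in> borel_measurable borel" unfolding b_def[abs_def] by measurable
    have [measurable]: "w \<in> borel_measurable borel" unfolding w_def[abs_def] by measurable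
    have b: "integrable lborel b"
      using causal_L1D(3)[OF d(1), of 1 T] by (simp add: b_def[abs_def] frac_integrable_def)
    have w: "integrable lborel w"
    proof (rule Bochner_Integration.integrable_bound[OF b])
      show "AE s in lborel. norm (w s) \<le> norm (b s)"
      proof (rule AE_I2)
        fix s show "norm (w s) \<le> norm (b s)"
          using causal_L1D(2)[OF d(1), of s] l(1)
          by (cases "s \<le> 0") (auto simp: w_def b_def abs_mult intro!: mult_left_le_one_le)
      qed
    qed measurable
    have "AE t in lborel. \<forall>j\<in>A. integrable lborel (\<lambda>s. exp (- l * (t - s)) * frac_kernel (e j) (t - s) * w s)"
      using AE_integrable_conv[OF kj w] A(1) by (intro AE_finite_allI) auto
    with d(2) have ae: "AE t in lborel. \<bar>w t\<bar> \<le> \<bar>conv ?k w t\<bar>"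
    proof eventually_elim
      case (elim t)
      show ?case
      proof (cases "t < T")
        case True
        have "conv ?k w t = exp (- l * t) * (\<Sum>j\<in>A. c j * frac_int (e j) b t)"
          unfolding w_def[abs_def] using elim(2) by (intro conv_exp_sum) (simp only: w_def)
        also have "(\<Sum>j\<in>A. c j * frac_int (e j) b t) = (\<Sum>j\<in>A. c j * frac_int (e j) d t)"
          using True by (intro sum.cong refl arg_cong2[where f = "(*)"] frac_int_cong) (simp add: b_def)
        also have "exp (- l * t) * \<dots> = w t"
          using elim(1) True by (simp add: w_def b_def)
        finally show ?thesis by simp
      qed (simp add: w_def b_def)
    qed
    have "(\<integral>t. \<bar>w t\<bar> \<partial>lborel) \<le> (\<integral>t. \<bar>conv ?k w t\<bar> \<partial>lborel)"
      using ae by (intro integral_mono_AE integrable_abs w integrable_conv k)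
    also have "\<dots> \<le> (\<integral>t. \<bar>?k t\<bar> \<partial>lborel) * (\<integral>t. \<bar>w t\<bar> \<partial>lborel)"
      by (rule conv_norm_le[OF k w])
    also have "\<dots> \<le> 1 / 2 * (\<integral>t. \<bar>w t\<bar> \<partial>lborel)"
      using l(2) by (intro mult_right_mono) auto
    finally have "(\<integral>t. \<bar>w t\<bar> \<partial>lborel) \<le> 0" by simp
    moreover have "0 \<le> (\<integral>t. \<bar>w t\<bar> \<partial>lborel)" by (intro Bochner_Integration.integral_nonneg) simp
    ultimately have "(\<integral>t. \<bar>w t\<bar> \<partial>lborel) = 0" by simp
    then have "AE t in lborel. \<bar>w t\<bar> = 0"
      using w by (subst (asm) integral_nonneg_eq_0_iff_AE) auto
    then show ?thesis
      by eventually_elim (auto simp: w_def b_def)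
  qed
  then have "AE t in lborel. \<forall>n. t < real n \<longrightarrow> d t = 0"
    unfolding AE_all_countable by blast
  then show ?thesis
    by eventually_elim (use reals_Archimedean2 in blast)
qed

section \<open>The multi-term equation and its system\<close>

text \<open>For \<open>t < T\<close> only kernel arguments below \<open>T\<close> occur, so kernel
  and \<open>h\<close> may both be cut off at \<open>T\<close>. Both are then integrable on the line
  and their convolution exists almost everywhere.\<close>

lemma AE_frac_integrable:
  assumes h: "causal_L1 h" and a: "a > 0"
  shows "AE t in lborel. frac_integrable a h t"
proof -
  have "AE t in lborel. t < T \<longrightarrow> frac_integrable a h t" for T
  proof -
    have k: "integrable lborel (\<lambda>u. frac_kernel a u * frac_kernel 1 (T - u))"
      using frac_integrable_kernel[of 1 a T] a by (simp add: frac_integrable_def mult.commute del: frac_kernel_1)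
    have g: "integrable lborel (\<lambda>s. frac_kernel 1 (T - s) * h s)"
      using causal_L1D(3)[OF h, of 1 T] by (simp add: frac_integrable_def del: frac_kernel_1)
    from AE_integrable_conv[OF k g] show ?thesis
    proof eventually_elim
      case (elim t)
      show ?case
      proof
        assume t: "t < T"
        have "frac_kernel a (t - s) * frac_kernel 1 (T - (t - s)) * (frac_kernel 1 (T - s) * h s)
            = frac_kernel a (t - s) * h s" for s
          using t causal_L1D(2)[OF h, of s] by (cases "s \<le> 0"; cases "s < t") auto
        with elim show "frac_integrable a h t" by (simp add: frac_integrable_def del: frac_kernel_1)
      qed
    qed
  qed
  then have "AE t in lborel. \<forall>n. t < real n \<longrightarrow> frac_integrable a h t"
    unfolding AE_all_countable by blast
  then show ?thesis by eventually_elim (use reals_Archimedean2 in blast)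
qed

text \<open>\<open>lincomb u v c\<close> is the fractional integral of order \<open>c - 1\<close> of \<open>u\<close> plus the primitive of \<open>v\<close>;
  for \<open>c < 1\<close> it is the corresponding derivative of order \<open>1 - c\<close>.\<close>

definition lincomb :: "real \<Rightarrow> (real \<Rightarrow> real) \<Rightarrow> real \<Rightarrow> real \<Rightarrow> real" where
  "lincomb u v c t = u * frac_kernel c t + frac_int c v t"

lemma lincomb_0: "causal_L1 v \<Longrightarrow> t \<le> 0 \<Longrightarrow> lincomb u v c t = 0"
  using causal_L1D(2) by (simp add: lincomb_def frac_int_nonpos)

lemma causal_L1_lincomb: "causal_L1 v \<Longrightarrow> c > 0 \<Longrightarrow> causal_L1 (lincomb u v c)"
  unfolding lincomb_def[abs_def]
  by (intro causal_L1_add causal_L1_cmult causal_L1_kernel causal_L1_frac_int)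

text \<open>For \<open>c < 1\<close> the integral of \<open>v\<close> of order \<open>c\<close> may
  diverge at single points; the total order \<open>a + c \<ge> 1\<close> provides integrability at
  every \<open>t\<close>, and with it the semigroup law.\<close>

lemma
  assumes v: "causal_L1 v" and "a > 0" "c > 0" "a + c \<ge> 1"
  shows frac_integrable_lincomb: "frac_integrable a (lincomb u v c) t"
    and frac_int_lincomb: "frac_int a (lincomb u v c) t = lincomb u v (a + c) t"
proof -
  note i = frac_integrable_cmult[OF frac_integrable_kernel[OF assms(2,3)], of u t]
    frac_integrable_frac_int[OF assms(2,3) causal_L1D(1)[OF v] causal_L1D(3)[OF v assms(4)], of t]
  show "frac_integrable a (lincomb u v c) t"
    unfolding lincomb_def[abs_def] by (rule frac_integrable_add[OF i])
  show "frac_int a (lincomb u v c) t = lincomb u v (a + c) t"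
    unfolding lincomb_def[abs_def] frac_int_add[OF i] frac_int_cmult frac_int_kernel[OF assms(2,3)]
      frac_int_frac_int[OF assms(2,3) causal_L1D(1)[OF v] causal_L1D(3)[OF v assms(4)]] ..
qed

text \<open>Monomials over factorials are kernels of integer order, so the Taylor polynomial is a
  sum of kernels. At \<open>t = 0\<close> this breaks down for \<open>i = 0\<close>, since the
  kernel is 0 there.\<close>

lemma frac_kernel_Suc: "t > 0 \<Longrightarrow> frac_kernel (real i + 1) t = t ^ i / fact i"
  using Gamma_fact[of i, where 'a = real] by (simp add: frac_kernel_def powr_realpow add.commute)

lemma taylor_eq_frac_kernel: "t > 0 \<Longrightarrow> taylor p C t = (\<Sum>i\<le>p. C i * frac_kernel (real i + 1) t)"
  by (simp add: taylor_def frac_kernel_Suc)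

lemma continuous_on_taylor [continuous_intros]: "continuous_on S (taylor p C)"
  unfolding taylor_def[abs_def] by (intro continuous_intros) auto

lemma integrable_exp_frac_kernel: "e > 0 \<Longrightarrow> l > 0 \<Longrightarrow> integrable lborel (\<lambda>u. exp (- l * u) * frac_kernel e u)"
  using has_bochner_integral_exp_frac_kernel by (simp add: has_bochner_integral_iff)

lemma
  assumes "a > 0" "\<And>i. i \<in> A \<Longrightarrow> e i > 0"
  shows frac_integrable_sum_kernel: "frac_integrable a (\<lambda>t. \<Sum>i\<in>A. c i * frac_kernel (e i) t) t"
    and frac_int_sum_kernel: "frac_int a (\<lambda>t. \<Sum>i\<in>A. c i * frac_kernel (e i) t) t = (\<Sum>i\<in>A. c i * frac_kernel (a + e i) t)"
proof -
  have i: "frac_integrable a (\<lambda>t. c i * frac_kernel (e i) t) t" if "i \<in> A" for i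
    using assms(1) assms(2)[OF that] by (intro frac_integrable_cmult frac_integrable_kernel)
  show "frac_integrable a (\<lambda>t. \<Sum>i\<in>A. c i * frac_kernel (e i) t) t" by (rule frac_integrable_sum[OF i])
  show "frac_int a (\<lambda>t. \<Sum>i\<in>A. c i * frac_kernel (e i) t) t = (\<Sum>i\<in>A. c i * frac_kernel (a + e i) t)"
    by (subst frac_int_sum) (use i assms in \<open>auto simp: frac_int_cmult frac_int_kernel intro!: sum.cong\<close>)
qed

lemma caputo_domain_fraction_iff:
  "0 < \<alpha> \<Longrightarrow> \<alpha> \<le> 1 \<Longrightarrow> caputo_domain \<alpha> f \<longleftrightarrow> (\<forall>T>0. abs_continuous_on 0 T f)"
  using caputo_domain_iff_regular[of 0 \<alpha> f] by (simp add: regular_def)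

lemma sum_atLeast1_atMost_remove_last:
  fixes f :: "nat \<Rightarrow> real"
  shows "m \<ge> 1 \<Longrightarrow> (\<Sum>j=1..m. f j) = (\<Sum>j=1..m-1. f j) + f m"
  by (cases m) simp_all

lemma sum_lessThan_remove_0:
  fixes f :: "nat \<Rightarrow> real"
  assumes "m \<ge> 1"
  shows "(\<Sum>j<m. f j) = f 0 + (\<Sum>j=1..m-1. f j)"
proof -
  have "{..<m} = insert 0 {1..m-1}" using assms by auto
  then show ?thesis by simp
qed

section \<open>Reduction of both problems to one Volterra equation\<close>

locale multi_term =
  fixes m p :: nat and a \<alpha> C :: "nat \<Rightarrow> real"
  assumes m2: "m \<ge> 2" and am: "a m \<noteq> 0" and \<alpha>1: "real p < \<alpha> 1"
    and \<alpha>_step: "\<And>j. 1 \<le> j \<Longrightarrow> j < m \<Longrightarrow> \<alpha> j < \<alpha> (j + 1)" and \<alpha>m: "\<alpha> m \<le> real p + 1"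
begin

lemma \<alpha>_less:
  assumes "1 \<le> i" "i < j" "j \<le> m"
  shows "\<alpha> i < \<alpha> j"
  using assms(2,3)
proof (induction j rule: less_induct)
  case (less j)
  then obtain k where k: "j = Suc k" "i \<le> k" by (cases j) auto
  have "\<alpha> k < \<alpha> j" using \<alpha>_step[of k] k assms(1) less.prems by simp
  then show ?case using less.IH[of k] k less.prems by (cases "i = k") auto
qed

lemma \<alpha>_bounds:
  assumes "1 \<le> j" "j \<le> m"
  shows "real p < \<alpha> j" "0 < \<alpha> j" "\<alpha> j \<le> real p + 1" "\<alpha> j \<le> \<alpha> m" "j < m \<Longrightarrow> \<alpha> j < \<alpha> m"
proof -
  show 1: "real p < \<alpha> j" using \<alpha>_less[of 1 j] \<alpha>1 assms by (cases "j = 1") auto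
  then show "0 < \<alpha> j" by (meson le_less_trans of_nat_0_le_iff)
  show "\<alpha> j \<le> \<alpha> m" using \<alpha>_less[of j m] assms by (cases "j = m") auto
  then show "\<alpha> j \<le> real p + 1" using \<alpha>m by simp
  show "j < m \<Longrightarrow> \<alpha> j < \<alpha> m" using \<alpha>_less assms by blast
qed

lemma \<alpha>_bounds_strict: "1 \<le> j \<Longrightarrow> j < m \<Longrightarrow> \<alpha> j < real p + 1"
  using \<alpha>_bounds[of j] \<alpha>m by simp

text \<open>Both problems reduce to \<open>volterra w t = 0\<close> for the derivative \<open>w\<close> of order \<open>\<alpha> m\<close> of \<open>x\<close>,
  since then \<open>x\<close> and its derivatives of order \<open>\<alpha> j\<close> are fractional integrals of \<open>w\<close>.\<close>

definition volterra :: "(real \<Rightarrow> real) \<Rightarrow> real \<Rightarrow> real" where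
  "volterra w t = a 0 * (taylor p C t + frac_int (\<alpha> m) w t)
     + (\<Sum>j=1..m-1. a j * frac_int (\<alpha> m - \<alpha> j) w t) + a m * w t"

text \<open>The orders of the integrals in \<open>volterra\<close>. The term with \<open>a 0\<close>
  is a derivative of order 0; the parameter \<open>\<alpha> 0\<close> is unconstrained, hence the
  case distinction.\<close>

definition ord :: "nat \<Rightarrow> real" where
  "ord j = (if j = 0 then \<alpha> m else \<alpha> m - \<alpha> j)"

lemma ord_pos: "j < m \<Longrightarrow> ord j > 0"
  using \<alpha>_bounds[of m] \<alpha>_bounds[of j] m2 by (auto simp: ord_def)

lemma volterra_ord:
  "volterra w t = a 0 * taylor p C t + (\<Sum>j<m. a j * frac_int (ord j) w t) + a m * w t"
  using m2 by (simp add: volterra_def sum_lessThan_remove_0 ord_def algebra_simps)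

text \<open>The Taylor term cancels in the difference of two solutions, which leaves a homogeneous
  equation. Splitting the integrals of the difference requires integrability at \<open>t\<close>,
  available almost everywhere.\<close>

lemma volterra_unique:
  assumes w: "causal_L1 w1" "causal_L1 w2"
    and e: "AE t in lborel. t > 0 \<longrightarrow> volterra w1 t = 0" "AE t in lborel. t > 0 \<longrightarrow> volterra w2 t = 0"
  shows "AE t in lborel. w1 t = w2 t"
proof -
  define d where "d = (\<lambda>t. w1 t + (-1) * w2 t)"
  have d: "causal_L1 d" unfolding d_def by (intro causal_L1_add causal_L1_cmult w)
  have "AE t in lborel. \<forall>j\<in>{..<m}. frac_integrable (ord j) w1 t"
    "AE t in lborel. \<forall>j\<in>{..<m}. frac_integrable (ord j) w2 t"
    by (intro AE_finite_allI AE_frac_integrable w ord_pos; simp)+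
  with e have "AE t in lborel. d t = (\<Sum>j<m. (- a j / a m) * frac_int (ord j) d t)"
  proof eventually_elim
    case (elim t)
    show ?case
    proof (cases "t > 0")
      case True
      have s: "frac_int (ord j) d t = frac_int (ord j) w1 t + (-1) * frac_int (ord j) w2 t" if "j < m" for j
        unfolding d_def frac_int_cmult[of _ "-1", symmetric] using elim that
        by (intro frac_int_add frac_integrable_cmult) auto
      have "(\<Sum>j<m. (- a j / a m) * frac_int (ord j) d t)
          = (\<Sum>j<m. (- a j / a m) * frac_int (ord j) w1 t - (- a j / a m) * frac_int (ord j) w2 t)"
        by (intro sum.cong refl) (simp add: s algebra_simps)
      also have "\<dots> = (- 1 / a m) * ((\<Sum>j<m. a j * frac_int (ord j) w1 t) - (\<Sum>j<m. a j * frac_int (ord j) w2 t))"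
        by (simp add: sum_subtractf sum_distrib_left right_diff_distrib sum_negf)
      also have "(\<Sum>j<m. a j * frac_int (ord j) w1 t) - (\<Sum>j<m. a j * frac_int (ord j) w2 t) = - a m * d t"
        using elim(1,2) True by (simp add: volterra_ord d_def algebra_simps)
      finally show ?thesis using am by simp
    next
      case False
      then have "frac_int (ord j) d t = 0" for j
        using causal_L1D(2)[OF d] by (intro frac_int_nonpos) auto
      then show ?thesis using False causal_L1D(2)[OF d, of t] by simp
    qed
  qed
  from fractional_equation_unique[of "{..<m}" ord d "\<lambda>j. - a j / a m", OF _ _ d this]
  have "AE t in lborel. d t = 0" using ord_pos by simp
  then show ?thesis by eventually_elim (simp add: d_def)
qed

text \<open>The differentiated equation is solved for \<open>v\<close> in L1 and then integrated
  back: \<open>frac_int 1\<close> turns the almost everywhere identity for \<open>v\<close> into one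
  valid at every \<open>t > 0\<close>.\<close>

lemma volterra_exists:
  obtains u v where "causal_L1 v" "\<And>t. t > 0 \<Longrightarrow> volterra (lincomb u v 1) t = 0"
proof -
  \<comment> \<open>Forced by the limit at 0 from the right, where all integrals of the solution
    vanish and \<open>a 0 * C 0 + a m * u = 0\<close> remains.\<close>
  define u where "u = - (a 0 / a m) * C 0"
  define b where "b j = - a j / a m" for j
  \<comment> \<open>Formal derivative of the terms free of \<open>v\<close>, divided by
    \<open>- a m\<close>: the monomial of degree \<open>i\<close> drops from order
    \<open>i + 1\<close> to order \<open>i\<close>, and the integral of order \<open>ord j\<close>
    of the constant \<open>u\<close> becomes \<open>u * frac_kernel (ord j)\<close>. The constant
    \<open>C 0\<close> drops out, so the first sum starts at 1.\<close>
  define g where "g t = (\<Sum>i=1..p. (b 0 * C i) * frac_kernel (real i) t) + (\<Sum>j<m. (b j * u) * frac_kernel (ord j) t)" for t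
  have g: "causal_L1 g"
    unfolding g_def[abs_def]
    by (intro causal_L1_add causal_L1_sum causal_L1_cmult causal_L1_kernel) (auto intro: ord_pos)
  have ge: "integrable lborel (\<lambda>t. exp (- l * t) * g t)" if "l > 0" for l
  proof -
    have "integrable lborel (\<lambda>t. (\<Sum>i=1..p. (b 0 * C i) * (exp (- l * t) * frac_kernel (real i) t))
        + (\<Sum>j<m. (b j * u) * (exp (- l * t) * frac_kernel (ord j) t)))"
      using that by (intro Bochner_Integration.integrable_add Bochner_Integration.integrable_sum
          integrable_mult_right integrable_exp_frac_kernel) (auto intro: ord_pos)
    then show ?thesis
      by (simp add: g_def distrib_left sum_distrib_left mult.left_commute del: mult_minus_left)
  qed
  obtain v where v: "causal_L1 v" "AE t in lborel. v t = g t + (\<Sum>j<m. b j * frac_int (ord j) v t)"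
    using fractional_equation_exists[of "{..<m}" ord g b] g ge ord_pos by auto
  have "volterra (lincomb u v 1) t = 0" if t: "t > 0" for t
  proof -
    note vi = causal_L1D(1,3)[OF v(1)]
    have gi: "frac_int 1 g t = (\<Sum>i=1..p. (b 0 * C i) * frac_kernel (1 + real i) t)
        + (\<Sum>j<m. (b j * u) * frac_kernel (1 + ord j) t)"
    proof -
      have pos: "\<And>i. i \<in> {1..p} \<Longrightarrow> real i > 0" "\<And>j. j \<in> {..<m} \<Longrightarrow> ord j > 0"
        using ord_pos by auto
      show ?thesis
        unfolding g_def[abs_def]
        by (subst frac_int_add[OF frac_integrable_sum_kernel frac_integrable_sum_kernel])
          (use pos in \<open>simp_all only: frac_int_sum_kernel[OF zero_less_one] zero_less_one\<close>)
    qed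
    have ki: "frac_integrable 1 (\<lambda>s. b j * frac_int (ord j) v s) t" if "j < m" for j
      using vi(2)[of "1 + ord j"] ord_pos[OF that]
      by (intro frac_integrable_cmult frac_integrable_frac_int vi(1)) auto
    have "frac_int 1 v t = frac_int 1 (\<lambda>t. g t + (\<Sum>j<m. b j * frac_int (ord j) v t)) t"
    proof (rule frac_int_cong_AE[OF vi(1) _ v(2)])
      note [measurable] = vi(1) causal_L1D(1)[OF g]
      show "(\<lambda>t. g t + (\<Sum>j<m. b j * frac_int (ord j) v t)) \<in> borel_measurable borel" by measurable
    qed
    also have "\<dots> = frac_int 1 g t + (\<Sum>j<m. frac_int 1 (\<lambda>s. b j * frac_int (ord j) v s) t)"
      using ki causal_L1D(3)[OF g] by (subst frac_int_add) (auto intro!: frac_integrable_sum frac_int_sum)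
    also have "(\<Sum>j<m. frac_int 1 (\<lambda>s. b j * frac_int (ord j) v s) t) = (\<Sum>j<m. b j * frac_int (1 + ord j) v t)"
      using vi(2) ord_pos by (intro sum.cong refl) (simp add: frac_int_cmult frac_int_frac_int vi(1) less_imp_le)
    finally have v1: "frac_int 1 v t = (\<Sum>i=1..p. (b 0 * C i) * frac_kernel (1 + real i) t)
        + (\<Sum>j<m. b j * lincomb u v (1 + ord j) t)"
      unfolding gi by (simp add: lincomb_def sum.distrib algebra_simps)
    have li: "frac_int (ord j) (lincomb u v 1) t = lincomb u v (1 + ord j) t" if "j < m" for j
      using frac_int_lincomb[OF v(1) ord_pos[OF that], of 1 u t] ord_pos[OF that] by (simp add: add.commute)
    have ta: "taylor p C t = C 0 + (\<Sum>i=1..p. C i * frac_kernel (1 + real i) t)"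
    proof -
      have "{..p} = insert 0 {1..p}" by auto
      then show ?thesis unfolding taylor_eq_frac_kernel[OF t] using t by (simp add: add.commute)
    qed
    have "a m * lincomb u v 1 t = - a 0 * C 0 + a m * frac_int 1 v t"
      using t am by (simp add: lincomb_def u_def algebra_simps)
    also have "a m * frac_int 1 v t = - a 0 * (\<Sum>i=1..p. C i * frac_kernel (1 + real i) t)
        - (\<Sum>j<m. a j * lincomb u v (1 + ord j) t)"
      unfolding v1 using am by (simp add: distrib_left right_diff_distrib sum_distrib_left b_def sum_negf mult.assoc)
    finally show ?thesis
      unfolding volterra_ord ta using li by (simp add: algebra_simps)
  qed
  with v(1) show thesis by (rule that)
qed


lemma caputo_domain_iff: "1 \<le> j \<Longrightarrow> j \<le> m \<Longrightarrow> caputo_domain (\<alpha> j) x \<longleftrightarrow> regular p x"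
  using \<alpha>_bounds by (intro caputo_domain_iff_regular) auto

lemma step_bounds:
  assumes "1 \<le> j" "j < m"
  shows "0 < \<alpha> (j + 1) - \<alpha> j" "\<alpha> (j + 1) - \<alpha> j < 1"
  using \<alpha>_step[OF assms] \<alpha>_bounds(1)[of j] \<alpha>_bounds(3)[of "j + 1"] assms by auto

lemma step_representation:
  assumes "1 \<le> j" "j < m" and h: "causal_L1 h" and y: "\<And>t. t \<ge> 0 \<Longrightarrow> y t = frac_int 1 h t" and "t > 0"
  shows "caputo_exists (\<alpha> (j + 1) - \<alpha> j) y t \<longleftrightarrow> frac_integrable (1 - (\<alpha> (j + 1) - \<alpha> j)) h t"
    and "caputo_deriv (\<alpha> (j + 1) - \<alpha> j) y t = frac_int (1 - (\<alpha> (j + 1) - \<alpha> j)) h t"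
proof -
  have "y s = taylor 0 (\<lambda>_. 0) s + frac_int (real 0 + 1) h s" if "s \<ge> 0" for s
    using y[OF that] by (simp add: taylor_def)
  note * = caputo_representation[OF h this _ _ \<open>t > 0\<close>, of "\<alpha> (j + 1) - \<alpha> j"]
  show "caputo_exists (\<alpha> (j + 1) - \<alpha> j) y t \<longleftrightarrow> frac_integrable (1 - (\<alpha> (j + 1) - \<alpha> j)) h t"
    "caputo_deriv (\<alpha> (j + 1) - \<alpha> j) y t = frac_int (1 - (\<alpha> (j + 1) - \<alpha> j)) h t"
    using * step_bounds[OF assms(1,2)] by simp_all
qed

text \<open>Existence of the Caputo derivative of order \<open>\<alpha> j\<close> is integrability
  of the density \<open>h\<close> to order \<open>p + 1 - \<alpha> j\<close> at \<open>t\<close>,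
  which is just what the semigroup law requires in order to express that derivative through
  \<open>w\<close>.\<close>

lemma solves_equation_volterra:
  assumes "solves_equation m p a \<alpha> C x"
  obtains w where "causal_L1 w" "AE t in lborel. t > 0 \<longrightarrow> volterra w t = 0"
    "\<And>t. t \<ge> 0 \<Longrightarrow> x t = taylor p C t + frac_int (\<alpha> m) w t"
proof -
  from assms have dom: "caputo_domain (\<alpha> 1) x"
    and ex: "\<And>t j. t > 0 \<Longrightarrow> 1 \<le> j \<Longrightarrow> j \<le> m \<Longrightarrow> caputo_exists (\<alpha> j) x t"
    and eq: "\<And>t. t > 0 \<Longrightarrow> a 0 * x t + (\<Sum>j=1..m. a j * caputo_deriv (\<alpha> j) x t) = 0"
    and init: "\<And>i. i \<le> p \<Longrightarrow> nth_deriv i x 0 = C i"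
    using m2 by (auto simp: solves_equation_def)
  have "regular p x" using dom caputo_domain_iff[of 1 x] m2 by simp
  then obtain h where h: "causal_L1 h"
    and x': "\<And>t. t \<ge> 0 \<Longrightarrow> x t = taylor p (\<lambda>i. nth_deriv i x 0) t + frac_int (real p + 1) h t"
    using regular_representation by blast
  have x: "x t = taylor p C t + frac_int (real p + 1) h t" if "t \<ge> 0" for t
    using x'[OF that] init by (simp add: taylor_def)
  note hm = causal_L1D(1)[OF h] and hi = causal_L1D(3)[OF h]
  have rep: "frac_integrable (real p + 1 - \<alpha> j) h t" "caputo_deriv (\<alpha> j) x t = frac_int (real p + 1 - \<alpha> j) h t"
    if "1 \<le> j" "j \<le> m" "\<alpha> j < real p + 1" "t > 0" for j t
    using caputo_representation[of h x p C "\<alpha> j" t] h x \<alpha>_bounds(1)[OF that(1,2)] that ex by auto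
  define \<gamma> where "\<gamma> = real p + 1 - \<alpha> m"
  have \<gamma>0: "\<gamma> \<ge> 0" using \<alpha>m by (simp add: \<gamma>_def)
  \<comment> \<open>\<open>frac_int 0\<close> is not the identity, so the case
    \<open>\<alpha> m = p + 1\<close> is separated.\<close>
  define w where "w = (if \<gamma> = 0 then h else frac_int \<gamma> h)"
  have w: "causal_L1 w" using h \<gamma>0 by (simp add: w_def causal_L1_frac_int)
  have iter: "frac_int c w t = frac_int (c + \<gamma>) h t" if "c > 0" "frac_integrable (c + \<gamma>) h t" for c t
    using that \<gamma>0 frac_int_frac_int[of c \<gamma> h t] hm by (auto simp: w_def)
  have lower: "caputo_deriv (\<alpha> j) x t = frac_int (\<alpha> m - \<alpha> j) w t" if "1 \<le> j" "j < m" "t > 0" for j t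
    using rep[of j t] \<alpha>_bounds_strict[OF that(1,2)] \<alpha>_bounds(5)[of j] that iter[of "\<alpha> m - \<alpha> j" t]
    by (simp add: \<gamma>_def)
  have xw: "x t = taylor p C t + frac_int (\<alpha> m) w t" if "t \<ge> 0" for t
    using x[OF that] iter[of "\<alpha> m" t] hi[of "real p + 1" t] \<alpha>_bounds(2)[of m] m2 by (simp add: \<gamma>_def)
  \<comment> \<open>For \<open>\<gamma> = 0\<close> the derivative is the ordinary one, which equals
    the density \<open>h\<close> only almost everywhere.\<close>
  have top: "AE t in lborel. t > 0 \<longrightarrow> caputo_deriv (\<alpha> m) x t = w t"
  proof (cases "\<gamma> = 0")
    case True
    then have "\<alpha> m = real (Suc p)" by (simp add: \<gamma>_def)
    then have "nat \<lceil>\<alpha> m\<rceil> = Suc p" "caputo_deriv (\<alpha> m) x t = nth_deriv (Suc p) x t" for t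
      by (simp_all add: caputo_deriv_def del: nth_deriv.simps of_nat_Suc)
    moreover have "AE t in lborel. t > 0 \<longrightarrow> nth_deriv (Suc p) x t = h t"
      by (rule representation_AE[OF h x])
    ultimately show ?thesis using True by (simp add: w_def del: nth_deriv.simps)
  next
    case False
    then have "caputo_deriv (\<alpha> m) x t = w t" if "t > 0" for t
      using rep(2)[of m t] m2 that \<gamma>0 by (simp add: w_def \<gamma>_def)
    then show ?thesis by simp
  qed
  have "AE t in lborel. t > 0 \<longrightarrow> volterra w t = 0"
    using top
  proof eventually_elim
    case (elim t)
    show ?case
    proof
      assume t: "t > 0"
      have "volterra w t = a 0 * x t + (\<Sum>j=1..m-1. a j * caputo_deriv (\<alpha> j) x t) + a m * caputo_deriv (\<alpha> m) x t"
        using t elim xw[of t] lower[OF _ _ t] by (auto simp: volterra_def intro!: sum.cong)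
      also have "\<dots> = a 0 * x t + (\<Sum>j=1..m. a j * caputo_deriv (\<alpha> j) x t)"
        using sum_atLeast1_atMost_remove_last[of m "\<lambda>j. a j * caputo_deriv (\<alpha> j) x t"] m2 by linarith
      also have "\<dots> = 0" by (rule eq[OF t])
      finally show "volterra w t = 0" .
    qed
  qed
  with w xw show thesis by (intro that)
qed

text \<open>The system differentiates \<open>x\<close> only to order \<open>\<alpha> 1\<close>.
  Therefore \<open>w\<close> is built at the far end of the chain, as the last derivative of
  \<open>y (m - 1)\<close>, and the formulas are carried back down to \<open>x\<close>.\<close>

lemma solves_system_volterra:
  assumes "solves_system m p a \<alpha> C x y"
  obtains w where "causal_L1 w" "AE t in lborel. t > 0 \<longrightarrow> volterra w t = 0"
    "\<And>t. t \<ge> 0 \<Longrightarrow> x t = taylor p C t + frac_int (\<alpha> m) w t"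
    "\<And>j t. 1 \<le> j \<Longrightarrow> j < m \<Longrightarrow> t \<ge> 0 \<Longrightarrow> y j t = frac_int (\<alpha> m - \<alpha> j) w t"
proof -
  \<comment> \<open>Continues the family \<open>y\<close> by the right-hand side of the last
    equation as member \<open>m\<close>, which makes all steps of the chain alike.\<close>
  define z where "z j t = (if j < m then y j t else (- 1) / a m * (a 0 * x t + (\<Sum>j=1..m - 1. a j * y j t)))" for j t
  from assms have c1: "caputo_eq (\<alpha> 1) x (y 1)"
    and cj': "\<And>j. 1 \<le> j \<Longrightarrow> j \<le> m - 2 \<Longrightarrow> caputo_eq (\<alpha> (j + 1) - \<alpha> j) (y j) (y (j + 1))"
    and cm: "caputo_eq (\<alpha> m - \<alpha> (m - 1)) (y (m - 1)) (\<lambda>t. (- 1) / a m * (a 0 * x t + (\<Sum>j=1..m - 1. a j * y j t)))"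
    and init: "\<And>i. i \<le> p \<Longrightarrow> nth_deriv i x 0 = C i"
    and y0: "\<And>j. 1 \<le> j \<Longrightarrow> j < m \<Longrightarrow> y j 0 = 0"
    by (auto simp: solves_system_def)
  have cj: "caputo_eq (\<alpha> (j + 1) - \<alpha> j) (y j) (z (j + 1))" if "1 \<le> j" "j < m" for j
  proof (cases "j \<le> m - 2")
    case True
    then have "z (j + 1) = y (j + 1)" using that by (auto simp: z_def fun_eq_iff)
    with cj'[OF that(1) True] show ?thesis by simp
  next
    case False
    then have j: "j = m - 1" "j + 1 = m" using that by auto
    have "z m = (\<lambda>t. (- 1) / a m * (a 0 * x t + (\<Sum>j=1..m - 1. a j * y j t)))"
      by (simp add: z_def fun_eq_iff)
    with cm show ?thesis unfolding j(2) unfolding j(1) by simp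
  qed
  have "regular p x" using c1 caputo_domain_iff[of 1 x] m2 by (simp add: caputo_eq_def)
  then obtain h where h: "causal_L1 h"
    and x': "\<And>t. t \<ge> 0 \<Longrightarrow> x t = taylor p (\<lambda>i. nth_deriv i x 0) t + frac_int (real p + 1) h t"
    using regular_representation by blast
  have x: "x t = taylor p C t + frac_int (real p + 1) h t" if "t \<ge> 0" for t
    using x'[OF that] init by (simp add: taylor_def)
  have "1 \<le> (1::nat)" "1 < m" using m2 by auto
  note b1 = \<alpha>_bounds_strict[OF this] \<alpha>_bounds(5)[OF \<open>1 \<le> 1\<close> less_imp_le[OF \<open>1 < m\<close>] \<open>1 < m\<close>]
  have y1: "frac_integrable (real p + 1 - \<alpha> 1) h t" "y 1 t = frac_int (real p + 1 - \<alpha> 1) h t" if "t > 0" for t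
    using caputo_representation[of h x p C "\<alpha> 1" t] h x \<alpha>1 b1(1) c1 that by (auto simp: caputo_eq_def)
  have "\<exists>k. causal_L1 k \<and> (\<forall>t\<ge>0. y j t = frac_int 1 k t)" if "1 \<le> j" "j < m" for j
  proof -
    have "regular 0 (y j)"
      using cj[OF that] caputo_domain_iff_regular[of 0 "\<alpha> (j + 1) - \<alpha> j" "y j"] step_bounds[OF that]
      by (simp add: caputo_eq_def)
    then obtain k where "causal_L1 k"
      "\<And>t. t \<ge> 0 \<Longrightarrow> y j t = taylor 0 (\<lambda>i. nth_deriv i (y j) 0) t + frac_int (real 0 + 1) k t"
      using regular_representation by blast
    then show ?thesis using y0[OF that] by (intro exI[of _ k]) (simp add: taylor_def)
  qed
  then obtain k where k: "\<And>j. 1 \<le> j \<Longrightarrow> j < m \<Longrightarrow> causal_L1 (k j)"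
    and yk: "\<And>j t. 1 \<le> j \<Longrightarrow> j < m \<Longrightarrow> t \<ge> 0 \<Longrightarrow> y j t = frac_int 1 (k j) t" by metis
  define \<delta> where "\<delta> j = \<alpha> (j + 1) - \<alpha> j" for j
  have zk: "z (j + 1) t = frac_int (1 - \<delta> j) (k j) t" if "1 \<le> j" "j < m" "t > 0" for j t
    using step_representation(2)[OF that(1,2) k[OF that(1,2)] yk[OF that(1,2)] that(3)] cj[OF that(1,2)] that(3)
    by (simp add: caputo_eq_def \<delta>_def)
  define w where "w = frac_int (1 - \<delta> (m - 1)) (k (m - 1))"
  have m1: "1 \<le> m - 1" "m - 1 < m" "m - 1 + 1 = m" using m2 by auto
  have w: "causal_L1 w"
    unfolding w_def using k[OF m1(1,2)] step_bounds[OF m1(1,2)] by (intro causal_L1_frac_int) (auto simp: \<delta>_def)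
  have wz: "w t = z m t" if "t > 0" for t
    using zk[OF m1(1,2) that] m1(3) by (simp add: w_def)
  \<comment> \<open>The orders \<open>\<alpha> m - \<alpha> j\<close> are below 1, where local
    integrability does not suffice at every point. On positive arguments \<open>w\<close> is the
    last right-hand side, a combination of continuous functions, and so it is bounded on bounded
    intervals.\<close>
  have wi: "frac_integrable c w T" if c: "c > 0" for c T
  proof -
    define Z where "Z t = (- 1) / a m * (a 0 * (taylor p C t + frac_int (real p + 1) h t)
        + (\<Sum>j=1..m - 1. a j * frac_int 1 (k j) t))" for t
    have "continuous_on {0..T} Z"
      unfolding Z_def[abs_def] using h k
      by (intro continuous_intros continuous_on_subset[OF continuous_on_frac_int]) auto
    then have "bounded (Z ` {0..T})"
      by (intro compact_imp_bounded compact_continuous_image) auto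
    then obtain B where B: "\<And>t. t \<in> {0..T} \<Longrightarrow> \<bar>Z t\<bar> \<le> B"
      unfolding bounded_iff by (metis imageI real_norm_def)
    have "\<bar>w t\<bar> \<le> B" if t: "0 < t" "t < T" for t
    proof -
      have "w t = Z t"
        unfolding wz[OF t(1)] z_def Z_def using x[of t] yk t by (auto intro!: sum.cong)
      then show ?thesis using B[of t] t by simp
    qed
    then show ?thesis
      using causal_L1D(1,2)[OF w] c by (intro frac_integrable_bounded) auto
  qed
  \<comment> \<open>Downward induction from \<open>m - 1\<close>: integrating the equation for
    \<open>y n\<close> adds \<open>\<delta> n\<close> to the order already found for
    \<open>y (n + 1)\<close>.\<close>
  have yw: "\<forall>t\<ge>0. y j t = frac_int (\<alpha> m - \<alpha> j) w t" if "1 \<le> j" "j < m" for j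
  proof -
    have "j \<le> m - 1" using that by simp
    then show ?thesis
    proof (induction rule: inc_induct)
      case base
      have e: "\<alpha> m - \<alpha> (m - 1) = \<delta> (m - 1)" unfolding \<delta>_def m1(3) ..
      have d: "\<delta> (m - 1) > 0" "1 - \<delta> (m - 1) > 0"
        using step_bounds[OF m1(1,2)] unfolding \<delta>_def by simp_all
      show ?case
      proof (intro allI impI)
        fix t :: real assume "t \<ge> 0"
        have "frac_int (\<delta> (m - 1)) w t = frac_int (\<delta> (m - 1) + (1 - \<delta> (m - 1))) (k (m - 1)) t"
          unfolding w_def using causal_L1D(1,3)[OF k[OF m1(1,2)]] d by (intro frac_int_frac_int) auto
        then show "y (m - 1) t = frac_int (\<alpha> m - \<alpha> (m - 1)) w t"
          unfolding e yk[OF m1(1,2) \<open>t \<ge> 0\<close>] by simp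
      qed
    next
      case (step n)
      then have n: "1 \<le> n" "n < m" "n + 1 < m" using that by auto
      have eq: "frac_int (1 - \<delta> n) (k n) = frac_int (\<alpha> m - \<alpha> (n + 1)) w"
      proof
        fix t
        show "frac_int (1 - \<delta> n) (k n) t = frac_int (\<alpha> m - \<alpha> (n + 1)) w t"
        proof (cases "t > 0")
          case True
          then show ?thesis using zk[OF n(1,2) True] step.IH n(3) by (simp add: z_def)
        next
          case False
          then show ?thesis
            using causal_L1D(2)[OF w] causal_L1D(2)[OF k[OF n(1,2)]] by (simp add: frac_int_nonpos)
        qed
      qed
      have d: "\<delta> n > 0" "\<delta> n < 1" using step_bounds[OF n(1,2)] by (simp_all add: \<delta>_def)
      have e: "\<alpha> m - \<alpha> (n + 1) > 0" using \<alpha>_bounds(5)[of "n + 1"] n by simp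
      show ?case
      proof (intro allI impI)
        fix t :: real assume "t \<ge> 0"
        have "y n t = frac_int (\<delta> n) (frac_int (1 - \<delta> n) (k n)) t"
          using yk[OF n(1,2) \<open>t \<ge> 0\<close>] d causal_L1D(1,3)[OF k[OF n(1,2)]] by (simp add: frac_int_frac_int)
        also have "\<dots> = frac_int (\<delta> n + (\<alpha> m - \<alpha> (n + 1))) w t"
          unfolding eq using d e by (intro frac_int_frac_int causal_L1D(1)[OF w] wi) auto
        finally show "y n t = frac_int (\<alpha> m - \<alpha> n) w t" by (simp add: \<delta>_def)
      qed
    qed
  qed
  \<comment> \<open>The first equation in terms of \<open>h\<close> and \<open>w\<close>. Applying
    \<open>frac_int (\<alpha> 1)\<close> to both sides gives the remainder in the expansion of
    \<open>x\<close>.\<close>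
  have top: "frac_int (real p + 1 - \<alpha> 1) h = frac_int (\<alpha> m - \<alpha> 1) w"
  proof
    fix t
    show "frac_int (real p + 1 - \<alpha> 1) h t = frac_int (\<alpha> m - \<alpha> 1) w t"
    proof (cases "t > 0")
      case True
      then show ?thesis using y1(2)[OF True] yw[of 1] m2 by simp
    next
      case False
      then show ?thesis using causal_L1D(2)[OF w] causal_L1D(2)[OF h] by (simp add: frac_int_nonpos)
    qed
  qed
  have "frac_int (\<alpha> 1) (frac_int (real p + 1 - \<alpha> 1) h) t = frac_int (real p + 1) h t" for t
    using frac_int_frac_int[of "\<alpha> 1" "real p + 1 - \<alpha> 1" h t] causal_L1D(1,3)[OF h] b1(1) \<alpha>_bounds(2)[of 1] m2
    by simp
  moreover have "frac_int (\<alpha> 1) (frac_int (\<alpha> m - \<alpha> 1) w) t = frac_int (\<alpha> m) w t" for t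
    using frac_int_frac_int[of "\<alpha> 1" "\<alpha> m - \<alpha> 1" w t] causal_L1D(1)[OF w] wi \<alpha>_bounds(2)[of 1] \<alpha>_bounds(2)[of m] b1(2) m2
    by simp
  ultimately have xw: "x t = taylor p C t + frac_int (\<alpha> m) w t" if "t \<ge> 0" for t
    using x[OF that] unfolding top by simp
  have "volterra w t = 0" if t: "t > 0" for t
  proof -
    have "(\<Sum>j=1..m-1. a j * frac_int (\<alpha> m - \<alpha> j) w t) = (\<Sum>j=1..m-1. a j * y j t)"
      using yw t by (intro sum.cong refl) auto
    then show ?thesis
      using xw[of t] t am unfolding volterra_def wz[OF t] by (simp add: z_def)
  qed
  then show thesis using w xw yw by (intro that[of w]) auto
qed


end

section \<open>The explicit solution and its uniqueness\<close>

locale multi_term_solution = multi_term +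
  fixes u :: real and v :: "real \<Rightarrow> real"
  assumes v: "causal_L1 v" and vol: "\<And>t. t > 0 \<Longrightarrow> volterra (lincomb u v 1) t = 0"
begin

definition sol_x :: "real \<Rightarrow> real" where
  "sol_x t = taylor p C t + lincomb u v (\<alpha> m + 1) t"

text \<open>For \<open>j = m\<close> this is \<open>lincomb u v 1\<close>, the function
  \<open>w\<close> itself, so that the last equation becomes one more step of the same kind.\<close>

definition sol_y :: "nat \<Rightarrow> real \<Rightarrow> real" where
  "sol_y j t = lincomb u v (\<alpha> m - \<alpha> j + 1) t"

lemma frac_int_lincomb_1: "c > 0 \<Longrightarrow> frac_int c (lincomb u v 1) t = lincomb u v (c + 1) t"
  using frac_int_lincomb[OF v] by simp

text \<open>Uniqueness is an almost everywhere statement, but fractional integrals ignore null sets,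
  so the integrals of \<open>w\<close> are determined at every \<open>t\<close>.\<close>

lemma volterra_solution:
  assumes "causal_L1 w" "AE t in lborel. t > 0 \<longrightarrow> volterra w t = 0"
  shows "c > 0 \<Longrightarrow> frac_int c w t = lincomb u v (c + 1) t"
proof -
  have L: "causal_L1 (lincomb u v 1)" by (rule causal_L1_lincomb[OF v]) simp
  have "AE t in lborel. w t = lincomb u v 1 t"
    by (rule volterra_unique[OF assms(1) L assms(2)]) (simp add: vol)
  then have "frac_int c w t = frac_int c (lincomb u v 1) t"
    by (rule frac_int_cong_AE[OF causal_L1D(1)[OF assms(1)] causal_L1D(1)[OF L]])
  then show "c > 0 \<Longrightarrow> frac_int c w t = lincomb u v (c + 1) t" by (simp add: frac_int_lincomb_1)
qed

lemma solves_equation_imp_eq: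
  assumes "solves_equation m p a \<alpha> C x" "t \<ge> 0"
  shows "x t = sol_x t"
proof -
  obtain w where w: "causal_L1 w" "AE t in lborel. t > 0 \<longrightarrow> volterra w t = 0"
    and x: "\<And>t. t \<ge> 0 \<Longrightarrow> x t = taylor p C t + frac_int (\<alpha> m) w t"
    using solves_equation_volterra[OF assms(1)] by blast
  show ?thesis
    using x[OF assms(2)] volterra_solution[OF w] \<alpha>_bounds(2)[of m] m2 by (simp add: sol_x_def)
qed

lemma solves_system_imp_eq:
  assumes "solves_system m p a \<alpha> C x y" "t \<ge> 0"
  shows "x t = sol_x t" "1 \<le> j \<Longrightarrow> j < m \<Longrightarrow> y j t = sol_y j t"
proof -
  obtain w where w: "causal_L1 w" "AE t in lborel. t > 0 \<longrightarrow> volterra w t = 0"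
    and x: "\<And>t. t \<ge> 0 \<Longrightarrow> x t = taylor p C t + frac_int (\<alpha> m) w t"
    and y: "\<And>j t. 1 \<le> j \<Longrightarrow> j < m \<Longrightarrow> t \<ge> 0 \<Longrightarrow> y j t = frac_int (\<alpha> m - \<alpha> j) w t"
    using solves_system_volterra[OF assms(1)] by blast
  show "x t = sol_x t"
    using x[OF assms(2)] volterra_solution[OF w] \<alpha>_bounds(2)[of m] m2 by (simp add: sol_x_def)
  show "1 \<le> j \<Longrightarrow> j < m \<Longrightarrow> y j t = sol_y j t"
    using y[OF _ _ assms(2)] volterra_solution[OF w] \<alpha>_bounds(5)[of j] by (simp add: sol_y_def)
qed

text \<open>The density of \<open>x\<close> is a \<open>lincomb\<close> of order
  \<open>\<alpha> m - p\<close>, possibly below 1 and then possibly unbounded at 0, yet locally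
  integrable. Adding the order \<open>p + 1 - \<alpha> j\<close> raises the total to at least 1,
  which gives existence at every \<open>t > 0\<close>.\<close>

lemma sol_x_caputo:
  assumes x: "\<And>t. t \<ge> 0 \<Longrightarrow> x t = sol_x t"
  shows "regular p x" "i \<le> p \<Longrightarrow> nth_deriv i x 0 = C i"
    and "1 \<le> j \<Longrightarrow> j \<le> m \<Longrightarrow> t > 0 \<Longrightarrow> caputo_exists (\<alpha> j) x t \<and> caputo_deriv (\<alpha> j) x t = sol_y j t"
proof -
  define h where "h = lincomb u v (\<alpha> m - real p)"
  have pos: "\<alpha> m - real p > 0" using \<alpha>_bounds(1)[of m] m2 by simp
  have h: "causal_L1 h" unfolding h_def by (rule causal_L1_lincomb[OF v pos])
  have hi: "frac_integrable c h t" "frac_int c h t = lincomb u v (c + (\<alpha> m - real p)) t"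
    if "c > 0" "c + (\<alpha> m - real p) \<ge> 1" for c t
    unfolding h_def using frac_integrable_lincomb[OF v that(1) pos that(2)] frac_int_lincomb[OF v that(1) pos that(2)]
    by auto
  have rep: "x t = taylor p C t + frac_int (real p + 1) h t" if "t \<ge> 0" for t
    using x[OF that] hi(2)[of "real p + 1" t] pos by (simp add: sol_x_def add.commute)
  show "regular p x" "i \<le> p \<Longrightarrow> nth_deriv i x 0 = C i"
    using representation_regular(1,2)[of h x p C] h rep by blast+
  show "caputo_exists (\<alpha> j) x t \<and> caputo_deriv (\<alpha> j) x t = sol_y j t" if j: "1 \<le> j" "j \<le> m" and t: "t > 0"
  proof (cases "\<alpha> j < real p + 1")
    case True
    have "frac_integrable (real p + 1 - \<alpha> j) h t" "frac_int (real p + 1 - \<alpha> j) h t = sol_y j t"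
      using hi[of "real p + 1 - \<alpha> j" t] True \<alpha>_bounds(4)[OF j] by (simp_all add: sol_y_def algebra_simps)
    then show ?thesis
      using caputo_representation[of h x p C "\<alpha> j" t] h rep \<alpha>_bounds(1)[OF j] True t by auto
  next
    \<comment> \<open>Here the derivative is an ordinary one and must exist at every
      \<open>t > 0\<close>, not only almost everywhere. It does, because \<open>frac_int 1 v\<close>
      is continuous.\<close>
    case False
    with \<alpha>_bounds(3,4)[OF j] \<alpha>m have \<alpha>: "\<alpha> j = real (Suc p)" "\<alpha> m = real (Suc p)" by simp_all
    have n: "nat \<lceil>\<alpha> j\<rceil> = Suc p" unfolding \<alpha>(1) by (simp del: of_nat_Suc)
    have h1: "h = lincomb u v 1" using \<alpha>(2) by (simp add: h_def)
    \<comment> \<open>The part with \<open>u\<close> is split off as \<open>u * s\<close>: for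
      \<open>u \<noteq> 0\<close> the function \<open>lincomb u v 1\<close> jumps at 0 from the
      value 0 to the limit \<open>u\<close>, so differentiating its primitive as that of a
      continuous function on \<open>{0..}\<close> is impossible.\<close>
    have f: "nth_deriv p x s = C p + (u * s + frac_int 2 v s)" if s: "s \<ge> 0" for s
    proof -
      have "frac_kernel 2 s = s" using s frac_kernel_Suc[of s 1] by (cases "s = 0") auto
      then have "frac_int 1 h s = u * s + frac_int 2 v s"
        using frac_int_lincomb_1[of 1 s] by (simp add: h1 lincomb_def)
      then show ?thesis using representation_regular(3)[of h x p C s] h rep s by simp
    qed
    have "frac_int 2 v = frac_int 1 (frac_int 1 v)"
      using frac_int_frac_int[of 1 1 v] causal_L1D(1,3)[OF v] by (auto simp: fun_eq_iff)
    then have "(frac_int 2 v has_vector_derivative frac_int 1 v t) (at t within {0..})"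
      using t v by (auto intro!: frac_int_1_has_vector_derivative causal_L1_frac_int continuous_on_frac_int)
    then have "((\<lambda>s. C p + (u * s + frac_int 2 v s)) has_vector_derivative 0 + (u * 1 + frac_int 1 v t)) (at t within {0..})"
      by (intro has_vector_derivative_add has_vector_derivative_const has_vector_derivative_mult_right has_vector_derivative_id)
    moreover have "0 + (u * 1 + frac_int 1 v t) = sol_y j t"
      using t \<alpha> by (simp add: sol_y_def lincomb_def)
    ultimately have "((\<lambda>s. C p + (u * s + frac_int 2 v s)) has_vector_derivative sol_y j t) (at t within {0..})"
      by simp
    from vector_derivative_nonneg_eqI[of "nth_deriv p x", OF f _ this] t
    have "(nth_deriv p x has_vector_derivative sol_y j t) (at t within {0..})" "nth_deriv (Suc p) x t = sol_y j t"
      by simp_all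
    then show ?thesis
      using \<alpha>(1) n differentiableI_vector[of "nth_deriv p x"]
      by (auto simp: caputo_exists_def caputo_deriv_def simp del: nth_deriv.simps of_nat_Suc)
  qed
qed

lemma volterra_sol:
  assumes "t > 0"
  shows "a 0 * sol_x t + (\<Sum>j=1..m-1. a j * sol_y j t) + a m * sol_y m t = 0"
proof -
  have "(\<Sum>j=1..m-1. a j * frac_int (\<alpha> m - \<alpha> j) (lincomb u v 1) t) = (\<Sum>j=1..m-1. a j * sol_y j t)"
    using \<alpha>_bounds(5) by (intro sum.cong refl) (auto simp: sol_y_def frac_int_lincomb_1)
  then show ?thesis
    using vol[OF assms] frac_int_lincomb_1[of "\<alpha> m" t] \<alpha>_bounds(2)[of m] m2
    by (simp add: volterra_def sol_x_def sol_y_def)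
qed

lemma sol_solves_equation:
  assumes x: "\<And>t. t \<ge> 0 \<Longrightarrow> x t = sol_x t"
  shows "solves_equation m p a \<alpha> C x"
  unfolding solves_equation_def
proof (intro conjI ballI allI impI)
  fix j assume "j \<in> {1..m}"
  then show "caputo_domain (\<alpha> j) x" using sol_x_caputo(1)[of x] x by (simp add: caputo_domain_iff)
next
  fix t :: real and j assume "t > 0" "j \<in> {1..m}"
  then show "caputo_exists (\<alpha> j) x t" using sol_x_caputo(3)[of x j t] x by simp
next
  fix t :: real assume t: "t > 0"
  have "(\<Sum>j=1..m. a j * caputo_deriv (\<alpha> j) x t) = (\<Sum>j=1..m. a j * sol_y j t)"
    using sol_x_caputo(3)[of x _ t] x t by (intro sum.cong refl) auto
  then show "a 0 * x t + (\<Sum>j=1..m. a j * caputo_deriv (\<alpha> j) x t) = 0"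
    using volterra_sol[OF t] x[of t] t m2 sum_atLeast1_atMost_remove_last[of m "\<lambda>j. a j * sol_y j t"] by simp
next
  fix i assume "i \<le> p"
  then show "nth_deriv i x 0 = C i" using sol_x_caputo(2)[of x i] x by simp
qed

lemma sol_solves_system:
  assumes x: "\<And>t. t \<ge> 0 \<Longrightarrow> x t = sol_x t"
  shows "solves_system m p a \<alpha> C x sol_y"
proof -
  \<comment> \<open>\<open>z\<close> is compared on positive arguments only: at 0,
    \<open>sol_y m\<close> is 0, whereas the last right-hand side is
    \<open>- a 0 * C 0 / a m\<close>.\<close>
  have step: "caputo_eq (\<alpha> (j + 1) - \<alpha> j) (sol_y j) z"
    if j: "1 \<le> j" "j < m" and z: "\<And>t. t > 0 \<Longrightarrow> sol_y (j + 1) t = z t" for j z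
  proof -
    define h where "h = lincomb u v (\<alpha> m - \<alpha> j)"
    have pos: "\<alpha> m - \<alpha> j > 0" using \<alpha>_bounds(5)[of j] j by simp
    have h: "causal_L1 h" unfolding h_def by (rule causal_L1_lincomb[OF v pos])
    have yh: "sol_y j = frac_int 1 h"
      using frac_int_lincomb[OF v zero_less_one pos] pos by (simp add: fun_eq_iff sol_y_def h_def add.commute)
    have "abs_continuous_on 0 T (sol_y j)" for T
      unfolding yh by (rule abs_continuous_on_frac_int[OF h])
    then have "caputo_domain (\<alpha> (j + 1) - \<alpha> j) (sol_y j)"
      using step_bounds[OF j] by (simp add: caputo_domain_fraction_iff)
    moreover have "caputo_exists (\<alpha> (j + 1) - \<alpha> j) (sol_y j) t \<and> caputo_deriv (\<alpha> (j + 1) - \<alpha> j) (sol_y j) t = z t"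
      if t: "t > 0" for t
    proof -
      define c where "c = 1 - (\<alpha> (j + 1) - \<alpha> j)"
      have c: "c > 0" "c + (\<alpha> m - \<alpha> j) \<ge> 1" "c + (\<alpha> m - \<alpha> j) = \<alpha> m - \<alpha> (j + 1) + 1"
        using step_bounds[OF j] \<alpha>_bounds(4)[of "j + 1"] j by (auto simp: c_def)
      have "frac_integrable c h t" "frac_int c h t = sol_y (j + 1) t"
        unfolding h_def using frac_integrable_lincomb[OF v c(1) pos c(2)] frac_int_lincomb[OF v c(1) pos c(2)] c(3)
        by (simp_all add: sol_y_def)
      then show ?thesis
        using step_representation[OF j h _ t, of "sol_y j"] z[OF t] by (simp add: yh c_def)
    qed
    ultimately show ?thesis by (simp add: caputo_eq_def)
  qed
  have "caputo_eq (\<alpha> 1) x (sol_y 1)"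
    using sol_x_caputo(1)[of x] sol_x_caputo(3)[of x 1] x m2 by (simp add: caputo_eq_def caputo_domain_iff)
  moreover have "\<forall>j\<in>{1..m - 2}. caputo_eq (\<alpha> (j + 1) - \<alpha> j) (sol_y j) (sol_y (j + 1))"
    using m2 by (intro ballI step) auto
  moreover have "caputo_eq (\<alpha> m - \<alpha> (m - 1)) (sol_y (m - 1))
       (\<lambda>t. (- 1) / a m * (a 0 * x t + (\<Sum>j=1..m - 1. a j * sol_y j t)))"
  proof -
    have m1: "1 \<le> m - 1" "m - 1 < m" "m - 1 + 1 = m" using m2 by auto
    have key: "sol_y (m - 1 + 1) t = (- 1) / a m * (a 0 * x t + (\<Sum>j=1..m - 1. a j * sol_y j t))" if t: "t > 0" for t
      unfolding m1(3)
    proof -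
      have "a m * sol_y m t = - (a 0 * x t + (\<Sum>j=1..m - 1. a j * sol_y j t))"
        using volterra_sol[OF t] x[of t] t by simp
      then show "sol_y m t = (- 1) / a m * (a 0 * x t + (\<Sum>j=1..m - 1. a j * sol_y j t))"
        using am by (simp add: field_simps)
    qed
    have "caputo_eq (\<alpha> (m - 1 + 1) - \<alpha> (m - 1)) (sol_y (m - 1))
       (\<lambda>t. (- 1) / a m * (a 0 * x t + (\<Sum>j=1..m - 1. a j * sol_y j t)))"
      by (rule step[OF m1(1,2)]) (rule key)
    then show ?thesis unfolding m1(3) .
  qed
  moreover have "\<forall>i\<le>p. nth_deriv i x 0 = C i" using sol_x_caputo(2)[of x] x by simp
  moreover have "\<forall>j\<in>{1..m - 1}. sol_y j 0 = 0" using lincomb_0[OF v] by (simp add: sol_y_def)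
  ultimately show ?thesis unfolding solves_system_def by blast
qed

end

text \<open>The solutions of the equation and the first components of solutions of the system are
  the same functions, namely those that agree with \<open>sol_x\<close> on \<open>{0..}\<close>;
  existence and uniqueness come along.\<close>

lemma (in multi_term) equivalence:
  "(\<forall>x. solves_equation m p a \<alpha> C x \<longleftrightarrow> (\<exists>y. solves_system m p a \<alpha> C x y)) \<and>
    (\<exists>x y. solves_equation m p a \<alpha> C x \<and> solves_system m p a \<alpha> C x y \<and>
       (\<forall>x'. solves_equation m p a \<alpha> C x' \<longrightarrow> (\<forall>t\<ge>0. x' t = x t)) \<and>
       (\<forall>x' y'. solves_system m p a \<alpha> C x' y' \<longrightarrow>
          (\<forall>t\<ge>0. x' t = x t \<and> (\<forall>j\<in>{1..m - 1}. y' j t = y j t))))"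
proof -
  obtain u v where uv: "causal_L1 v" "\<And>t. t > 0 \<Longrightarrow> volterra (lincomb u v 1) t = 0"
    using volterra_exists by blast
  interpret multi_term_solution m p a \<alpha> C u v by unfold_locales (fact uv)+
  show ?thesis
  proof (intro conjI)
    show "\<forall>x. solves_equation m p a \<alpha> C x \<longleftrightarrow> (\<exists>y. solves_system m p a \<alpha> C x y)"
    proof (intro allI iffI)
      fix x assume "solves_equation m p a \<alpha> C x"
      then have "solves_system m p a \<alpha> C x sol_y"
        by (intro sol_solves_system solves_equation_imp_eq)
      then show "\<exists>y. solves_system m p a \<alpha> C x y" by (intro exI[of _ sol_y])
    next
      fix x assume "\<exists>y. solves_system m p a \<alpha> C x y"
      then obtain y where "solves_system m p a \<alpha> C x y" ..
      then show "solves_equation m p a \<alpha> C x"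
        by (intro sol_solves_equation solves_system_imp_eq(1))
    qed
    have "solves_equation m p a \<alpha> C sol_x" by (rule sol_solves_equation) (rule refl)
    moreover have "solves_system m p a \<alpha> C sol_x sol_y" by (rule sol_solves_system) (rule refl)
    moreover have "\<forall>x'. solves_equation m p a \<alpha> C x' \<longrightarrow> (\<forall>t\<ge>0. x' t = sol_x t)"
      using solves_equation_imp_eq by blast
    moreover have "\<forall>x' y'. solves_system m p a \<alpha> C x' y' \<longrightarrow>
        (\<forall>t\<ge>0. x' t = sol_x t \<and> (\<forall>j\<in>{1..m - 1}. y' j t = sol_y j t))"
    proof (intro allI impI conjI ballI)
      fix x' y' t j assume *: "solves_system m p a \<alpha> C x' y'" "0 \<le> (t :: real)"
      show "x' t = sol_x t" by (rule solves_system_imp_eq(1)[OF *])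
      assume "j \<in> {1..m - 1}"
      then show "y' j t = sol_y j t" using m2 by (intro solves_system_imp_eq(2)[OF *]) auto
    qed
    ultimately show "\<exists>x y. solves_equation m p a \<alpha> C x \<and> solves_system m p a \<alpha> C x y \<and>
       (\<forall>x'. solves_equation m p a \<alpha> C x' \<longrightarrow> (\<forall>t\<ge>0. x' t = x t)) \<and>
       (\<forall>x' y'. solves_system m p a \<alpha> C x' y' \<longrightarrow>
          (\<forall>t\<ge>0. x' t = x t \<and> (\<forall>j\<in>{1..m - 1}. y' j t = y j t)))"
      by blast
  qed
qed

theorem theorem5p3:
  fixes m p :: nat and a \<alpha> :: "nat \<Rightarrow> real"
  assumes "m \<ge> 2"
    and "a m \<noteq> 0"
    and "real p < \<alpha> 1"
    and "\<And>j. 1 \<le> j \<Longrightarrow> j < m \<Longrightarrow> \<alpha> j < \<alpha> (j + 1)"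
    and "\<alpha> m \<le> real p + 1"
  shows "\<forall>C :: nat \<Rightarrow> real.
    (\<forall>x. solves_equation m p a \<alpha> C x \<longleftrightarrow> (\<exists>y. solves_system m p a \<alpha> C x y)) \<and>
    (\<exists>x y. solves_equation m p a \<alpha> C x \<and> solves_system m p a \<alpha> C x y \<and>
       (\<forall>x'. solves_equation m p a \<alpha> C x' \<longrightarrow> (\<forall>t\<ge>0. x' t = x t)) \<and>
       (\<forall>x' y'. solves_system m p a \<alpha> C x' y' \<longrightarrow>
          (\<forall>t\<ge>0. x' t = x t \<and> (\<forall>j\<in>{1..m - 1}. y' j t = y j t))))"
proof
  fix C :: "nat \<Rightarrow> real"
  interpret multi_term m p a \<alpha> C by unfold_locales (use assms in auto)
  from equivalence show "(\<forall>x. solves_equation m p a \<alpha> C x \<longleftrightarrow> (\<exists>y. solves_system m p a \<alpha> C x y)) \<and>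
    (\<exists>x y. solves_equation m p a \<alpha> C x \<and> solves_system m p a \<alpha> C x y \<and>
       (\<forall>x'. solves_equation m p a \<alpha> C x' \<longrightarrow> (\<forall>t\<ge>0. x' t = x t)) \<and>
       (\<forall>x' y'. solves_system m p a \<alpha> C x' y' \<longrightarrow>
          (\<forall>t\<ge>0. x' t = x t \<and> (\<forall>j\<in>{1..m - 1}. y' j t = y j t))))" .
qed

end
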